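(* Let $m\ge2$, $\mathfrak g=\mathfrak{gl}(m)$ and $\eta'=\epsilon_1-\epsilon_m$. For $\mu\in\mathfrak h^*$ let $\mathcal D^m(\mu)$ be the $(m-1)\times(m-1)$ matrix whose $(i,j)$ entry is $e_{m+1-i,\,m-j}$ for $i\le j$, whose $(i+1,i)$ entry is $-a_{m-1-i}$ for $1\le i\le m-2$, and whose other entries are $0$, where $a_k=(\mu+\rho,\epsilon_1-\epsilon_{k+1})-1$; that is $$\mathcal D^m(\mu)=\begin{bmatrix}e_{m,m-1}&e_{m,m-2}&\cdots&e_{m,2}&e_{m,1}\\-a_{m-2}&e_{m-1,m-2}&\cdots&e_{m-1,2}&e_{m-1,1}\\0&-a_{m-3}&\cdots&e_{m-2,2}&e_{m-2,1}\\\vdots&\vdots&\ddots&\vdots&\vdots\\0&0&\cdots&-a_1&e_{2,1}\end{bmatrix}.$$ Then the Šapovalov element $\theta_{\eta'}$ for the pair $(\eta',1)$ satisfies $$\theta_{\eta'}(\mu)=\overset{\longrightarrow}{\det}\ \mathcal D^m(\mu)$$ for all $\mu\in\mathfrak h^*$ with $(\mu+\rho,\eta')=1$.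
   Context: Ground field $\mathbb C$. $e_{i,j}$ are the matrix units of $\mathfrak g=\mathfrak{gl}(m)$; $\mathfrak h$ is the diagonal subalgebra, $\epsilon_i(e_{j,j})=\delta_{ij}$, $(\epsilon_i,\epsilon_j)=\delta_{ij}$; $h_\alpha\in\mathfrak h$ satisfies $\beta(h_\alpha)=(\alpha,\beta)$ for all $\beta\in\mathfrak h^*$. $\Delta^+=\{\epsilon_i-\epsilon_j:i<j\}$, $\Pi$ the simple roots $\epsilon_i-\epsilon_{i+1}$; $\mathfrak n^\pm$ strictly upper/lower triangular matrices, $\mathfrak b^-=\mathfrak h\oplus\mathfrak n^-$; $\rho$ is the half-sum of positive roots. Noncommutative determinant of an $n\times n$ matrix $B=(b_{ij})$: $\overset{\longrightarrow}{\det}(B)=\sum_{w\in S_n}\operatorname{sign}(w)\,b_{w(1),1}b_{w(2),2}\cdots b_{w(n),n}$. Šapovalov element for $(\eta',1)$: an element $\theta\in U(\mathfrak b^-)$ of weight $-\eta'$ of the form $\theta=\sum_\pi e_{-\pi}H_\pi$, $H_\pi\in U(\mathfrak h)$, where $\pi$ runs over functions $\Delta^+\to\mathbb Z_{\ge0}$ with $\sum\pi(\alpha)\alpha=\eta'$, $e_{-\pi}$ is the product of the $e_{-\alpha}^{\pi(\alpha)}$ in a fixed order on $\Delta^+$, with $H_{\pi^0}=1$ for the unique $\pi^0$ vanishing off $\Pi$, and $e_\alpha\theta\in U(\mathfrak g)(h_{\eta'}+\rho(h_{\eta'})-(\eta',\eta')/2)+U(\mathfrak g)\mathfrak n^+$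 for all $\alpha\in\Delta^+$. Its evaluation at $\mu\in\mathfrak h^*$ is $\theta(\mu)=\sum_\pi e_{-\pi}H_\pi(\mu)\in U(\mathfrak n^-)$, where $U(\mathfrak h)=S(\mathfrak h)$ is identified with polynomial functions on $\mathfrak h^*$. For $\mu$ in the hyperplane $(\mu+\rho,\eta')=1$ this evaluation does not depend on the choice of Šapovalov element. *)

theory Defs
  imports
    Complex_Main
    "HOL-Library.Poly_Mapping"
    "HOL-Library.Function_Algebras"
    "HOL-Combinatorics.Permutations"
    "HOL-Algebra.Ideal"
    "HOL-Algebra.QuotRing"
begin

section \<open>The Lie algebra \<open>gl(m)\<close> and its weights\<close>

text \<open>
  Elements of \<open>gl(m)\<close> are matrices \<open>nat \<Rightarrow> nat \<Rightarrow> complex\<close> and elements of the dual of the diagonal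
  subalgebra are families \<open>nat \<Rightarrow> complex\<close>, where \<open>\<beta> i = \<beta>(e\<^bsub>i,i\<^esub>)\<close> is the coefficient of
  \<open>\<epsilon>\<^sub>i\<close> in \<open>\<beta>\<close>. Indices are 1-based; only the entries with indices in \<open>{1..m}\<close> matter.
\<close>

type_synonym gl_mat = "nat \<Rightarrow> nat \<Rightarrow> complex"
type_synonym weight = "nat \<Rightarrow> complex"

definition gl_bracket :: "nat \<Rightarrow> gl_mat \<Rightarrow> gl_mat \<Rightarrow> gl_mat" where
  "gl_bracket m x y = (\<lambda>i j. (\<Sum>k\<in>{1..m}. x i k * y k j) - (\<Sum>k\<in>{1..m}. y i k * x k j))"

definition gl_eps :: "nat \<Rightarrow> weight" where
  "gl_eps i = (\<lambda>k. if k = i then 1 else 0)"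

definition wt_form :: "nat \<Rightarrow> weight \<Rightarrow> weight \<Rightarrow> complex" where
  "wt_form m \<alpha> \<beta> = (\<Sum>i\<in>{1..m}. \<alpha> i * \<beta> i)"

text \<open>The value of a weight on (the diagonal of) a matrix.\<close>

definition wt_eval :: "nat \<Rightarrow> weight \<Rightarrow> gl_mat \<Rightarrow> complex" where
  "wt_eval m \<beta> x = (\<Sum>i\<in>{1..m}. \<beta> i * x i i)"

text \<open>
  The matrix \<open>h\<^sub>\<alpha>\<close>; it is the diagonal matrix characterised by lemma \<open>wt_eval_h_mat\<close> below.
\<close>

definition h_mat :: "weight \<Rightarrow> gl_mat" where
  "h_mat \<alpha> = (\<lambda>i j. if i = j then \<alpha> i else 0)"

lemma wt_eval_h_mat: "wt_eval m \<beta> (h_mat \<alpha>) = wt_form m \<alpha> \<beta>"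
  by (simp add: wt_eval_def h_mat_def wt_form_def mult.commute)

text \<open>The pair \<open>(i, j)\<close> stands for the positive root \<open>\<epsilon>\<^sub>i - \<epsilon>\<^sub>j\<close>.\<close>

definition pos_roots :: "nat \<Rightarrow> (nat \<times> nat) set" where
  "pos_roots m = {(i, j). 1 \<le> i \<and> i < j \<and> j \<le> m}"

definition simple_roots :: "nat \<Rightarrow> (nat \<times> nat) set" where
  "simple_roots m = {(i, j). 1 \<le> i \<and> j = i + 1 \<and> j \<le> m}"

definition root_wt :: "nat \<times> nat \<Rightarrow> weight" where
  "root_wt \<alpha> = gl_eps (fst \<alpha>) - gl_eps (snd \<alpha>)"

definition gl_rho :: "nat \<Rightarrow> weight" where
  "gl_rho m = (\<lambda>k. (\<Sum>\<alpha>\<in>pos_roots m. root_wt \<alpha> k) / 2)"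


section \<open>The universal enveloping algebra \<open>U(gl(m))\<close>\<close>

text \<open>
  The tensor algebra of \<open>gl(m)\<close> is the free algebra on the matrix units: finitely supported
  functions on words in index pairs, multiplied by convolution with respect to concatenation of
  words. The following instance makes the convolution product of \<open>poly_mapping\<close> available.
\<close>

instantiation list :: (type) monoid_add
begin

definition zero_list :: "'a list" where "zero_list = []"

definition plus_list :: "'a list \<Rightarrow> 'a list \<Rightarrow> 'a list" where "plus_list xs ys = xs @ ys"

instance
  by standard (simp_all add: zero_list_def plus_list_def)

end

type_synonym gl_free = "(nat \<times> nat) list \<Rightarrow>\<^sub>0 complex"

definition tensor_alg :: "nat \<Rightarrow> gl_free ring" where
  "tensor_alg m =
    \<lparr>carrier = {p. \<forall>w\<in>Poly_Mapping.keys p. set w \<subseteq> {1..m} \<times> {1..m}},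
     mult = (*), one = 1, zero = 0, add = (+)\<rparr>"

definition gl_emb :: "nat \<Rightarrow> gl_mat \<Rightarrow> gl_free" where
  "gl_emb m x = (\<Sum>i\<in>{1..m}. \<Sum>j\<in>{1..m}. Poly_Mapping.single [(i, j)] (x i j))"

definition lie_ideal :: "nat \<Rightarrow> gl_free set" where
  "lie_ideal m = genideal (tensor_alg m)
    {gl_emb m x * gl_emb m y - gl_emb m y * gl_emb m x - gl_emb m (gl_bracket m x y) | x y. True}"

definition Ugl :: "nat \<Rightarrow> gl_free set ring" where
  "Ugl m = tensor_alg m Quot lie_ideal m"

definition U_class :: "nat \<Rightarrow> gl_free \<Rightarrow> gl_free set" where
  "U_class m p = lie_ideal m +>\<^bsub>tensor_alg m\<^esub> p"

definition U_emb :: "nat \<Rightarrow> gl_mat \<Rightarrow> gl_free set" where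
  "U_emb m x = U_class m (gl_emb m x)"

definition U_scalar :: "nat \<Rightarrow> complex \<Rightarrow> gl_free set" where
  "U_scalar m c = U_class m (Poly_Mapping.single [] c)"

definition U_unit :: "nat \<Rightarrow> nat \<Rightarrow> nat \<Rightarrow> gl_free set" where
  "U_unit m i j = U_emb m (\<lambda>k l. if k = i \<and> l = j then 1 else 0)"

lemma ring_tensor_alg: "ring (tensor_alg m)"
proof -
  let ?W = "{w :: (nat \<times> nat) list. set w \<subseteq> {1..m} \<times> {1..m}}"
  have car: "carrier (tensor_alg m) = {p. Poly_Mapping.keys p \<subseteq> ?W}"
    by (auto simp: tensor_alg_def)
  have mult: "Poly_Mapping.keys (p * q) \<subseteq> ?W"
    if "Poly_Mapping.keys p \<subseteq> ?W" "Poly_Mapping.keys q \<subseteq> ?W" for p q :: gl_free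
    using keys_mult[of p q] that by (fastforce simp: plus_list_def)
  have add: "Poly_Mapping.keys (p + q) \<subseteq> ?W"
    if "Poly_Mapping.keys p \<subseteq> ?W" "Poly_Mapping.keys q \<subseteq> ?W" for p q :: gl_free
    using keys_add[of p q] that by blast
  show ?thesis
  proof (rule ringI)
    show "abelian_group (tensor_alg m)"
    proof (rule abelian_groupI)
      fix p assume p: "p \<in> carrier (tensor_alg m)"
      then have "- p \<in> carrier (tensor_alg m)" by (simp add: car)
      then show "\<exists>q\<in>carrier (tensor_alg m). q \<oplus>\<^bsub>tensor_alg m\<^esub> p = \<zero>\<^bsub>tensor_alg m\<^esub>"
        by (intro bexI[of _ "- p"]) (simp_all add: tensor_alg_def)
    qed (use add in \<open>simp_all add: car\<close>, simp_all add: tensor_alg_def algebra_simps)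
    show "Group.monoid (tensor_alg m)"
    proof (rule Group.monoidI)
      show "\<one>\<^bsub>tensor_alg m\<^esub> \<in> carrier (tensor_alg m)"
        by (simp add: tensor_alg_def zero_list_def)
    qed (use mult in \<open>simp_all add: car\<close>, simp_all add: tensor_alg_def algebra_simps)
  qed (simp_all add: tensor_alg_def algebra_simps)
qed

lemma gl_emb_closed: "gl_emb m x \<in> carrier (tensor_alg m)"
proof -
  interpret ring "tensor_alg m" by (rule ring_tensor_alg)
  have sum_closed: "(\<Sum>i\<in>A. f i) \<in> carrier (tensor_alg m)"
    if "finite A" "\<And>i. i \<in> A \<Longrightarrow> f i \<in> carrier (tensor_alg m)" for A :: "nat set" and f
    using that
  proof (induction A rule: finite_induct)
    case (insert a A)
    then have "f a \<oplus>\<^bsub>tensor_alg m\<^esub> sum f A \<in> carrier (tensor_alg m)" by simp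
    with insert show ?case by (simp add: tensor_alg_def)
  qed (simp add: tensor_alg_def)
  show ?thesis
    unfolding gl_emb_def by (intro sum_closed finite_atLeastAtMost) (auto simp: tensor_alg_def)
qed

lemma minus_tensor_alg:
  assumes "p \<in> carrier (tensor_alg m)" "q \<in> carrier (tensor_alg m)"
  shows "p \<ominus>\<^bsub>tensor_alg m\<^esub> q = p - q"
proof -
  interpret ring "tensor_alg m" by (rule ring_tensor_alg)
  have "(p \<ominus>\<^bsub>tensor_alg m\<^esub> q) \<oplus>\<^bsub>tensor_alg m\<^esub> q = p"
    using assms by (simp add: minus_eq a_assoc l_neg)
  then have "(p \<ominus>\<^bsub>tensor_alg m\<^esub> q) + q = p" by (simp add: tensor_alg_def)
  then show ?thesis by (simp add: eq_diff_eq)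
qed

lemma lie_relator_closed:
  "gl_emb m x * gl_emb m y - gl_emb m y * gl_emb m x - gl_emb m (gl_bracket m x y)
     \<in> carrier (tensor_alg m)"
proof -
  interpret ring "tensor_alg m" by (rule ring_tensor_alg)
  have mult: "p * q \<in> carrier (tensor_alg m)"
    if "p \<in> carrier (tensor_alg m)" "q \<in> carrier (tensor_alg m)" for p q
    using m_closed[OF that] by (simp add: tensor_alg_def)
  have diff: "p - q \<in> carrier (tensor_alg m)"
    if "p \<in> carrier (tensor_alg m)" "q \<in> carrier (tensor_alg m)" for p q
    using minus_closed[OF that] minus_tensor_alg[OF that] by simp
  show ?thesis by (intro diff mult gl_emb_closed)
qed

lemma ideal_lie_ideal: "ideal (lie_ideal m) (tensor_alg m)"
  unfolding lie_ideal_def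
  by (rule ring.genideal_ideal[OF ring_tensor_alg]) (auto intro: lie_relator_closed)

lemma ring_Ugl: "ring (Ugl m)"
  unfolding Ugl_def by (rule ideal.quotient_is_ring[OF ideal_lie_ideal])

lemma U_class_ring_hom: "U_class m \<in> ring_hom (tensor_alg m) (Ugl m)"
proof -
  have "U_class m = (+>\<^bsub>tensor_alg m\<^esub>) (lie_ideal m)" by (rule ext) (simp add: U_class_def)
  then show ?thesis unfolding Ugl_def using ideal.rcos_ring_hom[OF ideal_lie_ideal] by simp
qed

lemma U_emb_bracket:
  "U_emb m (gl_bracket m x y) =
     U_emb m x \<otimes>\<^bsub>Ugl m\<^esub> U_emb m y \<ominus>\<^bsub>Ugl m\<^esub> U_emb m y \<otimes>\<^bsub>Ugl m\<^esub> U_emb m x"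
proof -
  interpret T: ring "tensor_alg m" by (rule ring_tensor_alg)
  interpret h: ring_hom_ring "tensor_alg m" "Ugl m" "U_class m"
    by (rule ring_hom_ringI2[OF ring_tensor_alg ring_Ugl U_class_ring_hom])
  note cl = gl_emb_closed[of m x] gl_emb_closed[of m y] gl_emb_closed[of m "gl_bracket m x y"]
  let ?b = "gl_emb m (gl_bracket m x y)"
  let ?c = "gl_emb m x \<otimes>\<^bsub>tensor_alg m\<^esub> gl_emb m y \<ominus>\<^bsub>tensor_alg m\<^esub>
    gl_emb m y \<otimes>\<^bsub>tensor_alg m\<^esub> gl_emb m x"
  have c: "?c \<in> carrier (tensor_alg m)" using cl by simp
  have eq: "?c \<ominus>\<^bsub>tensor_alg m\<^esub> ?b =
      gl_emb m x * gl_emb m y - gl_emb m y * gl_emb m x - ?b"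
    by (subst minus_tensor_alg[OF c cl(3)],
        subst minus_tensor_alg[OF T.m_closed[OF cl(1,2)] T.m_closed[OF cl(2,1)]])
      (simp add: tensor_alg_def)
  have "?c \<ominus>\<^bsub>tensor_alg m\<^esub> ?b \<in> lie_ideal m"
    unfolding eq lie_ideal_def
    by (rule subsetD[OF ring.genideal_self[OF ring_tensor_alg]]) (auto intro: lie_relator_closed)
  then have "U_class m ?c = U_class m ?b"
    unfolding U_class_def
    using ring.quotient_eq_iff_same_a_r_cos[OF ring_tensor_alg ideal_lie_ideal c cl(3)] by simp
  then show ?thesis
    using cl by (simp add: U_emb_def a_minus_def)
qed


section \<open>Noncommutative determinants\<close>

definition ncprod :: "('a, 'b) ring_scheme \<Rightarrow> 'a list \<Rightarrow> 'a" where
  "ncprod R xs = foldr (mult R) xs \<one>\<^bsub>R\<^esub>"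

definition ncdet :: "('a, 'b) ring_scheme \<Rightarrow> nat \<Rightarrow> (nat \<Rightarrow> nat \<Rightarrow> 'a) \<Rightarrow> 'a" where
  "ncdet R n B = (\<Oplus>\<^bsub>R\<^esub>w\<in>{w. w permutes {1..n}}.
     [sign w] \<cdot>\<^bsub>R\<^esub> ncprod R (map (\<lambda>k. B (w k) k) [1..<n + 1]))"


section \<open>Shapovalov elements\<close>

text \<open>
  \<open>S(h)\<close> is the polynomial ring in \<open>e\<^bsub>1,1\<^esub>, \<dots>, e\<^bsub>m,m\<^esub>\<close>: finitely supported functions on exponent
  vectors. \<open>U_poly\<close> is the identification with \<open>U(h) \<subseteq> U(gl(m))\<close>, and \<open>h_poly_eval\<close> the
  identification with polynomial functions of a weight.
\<close>

type_synonym h_poly = "(nat \<Rightarrow>\<^sub>0 nat) \<Rightarrow>\<^sub>0 complex"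

definition h_polys :: "nat \<Rightarrow> h_poly set" where
  "h_polys m = {P. \<forall>k\<in>Poly_Mapping.keys P. Poly_Mapping.keys k \<subseteq> {1..m}}"

definition h_poly_eval :: "nat \<Rightarrow> h_poly \<Rightarrow> weight \<Rightarrow> complex" where
  "h_poly_eval m P \<mu> = (\<Sum>k\<in>Poly_Mapping.keys P.
     Poly_Mapping.lookup P k * (\<Prod>i\<in>{1..m}. \<mu> i ^ Poly_Mapping.lookup k i))"

definition U_poly :: "nat \<Rightarrow> h_poly \<Rightarrow> gl_free set" where
  "U_poly m P = (\<Oplus>\<^bsub>Ugl m\<^esub>k\<in>Poly_Mapping.keys P.
     U_scalar m (Poly_Mapping.lookup P k) \<otimes>\<^bsub>Ugl m\<^esub>
     ncprod (Ugl m) (map (\<lambda>i. U_unit m i i [^]\<^bsub>Ugl m\<^esub> Poly_Mapping.lookup k i) [1..<m + 1]))"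

definition root_partitions :: "nat \<Rightarrow> weight \<Rightarrow> (nat \<times> nat \<Rightarrow> nat) set" where
  "root_partitions m \<eta> = {\<pi>. (\<forall>\<alpha>. \<alpha> \<notin> pos_roots m \<longrightarrow> \<pi> \<alpha> = 0) \<and>
     (\<forall>k\<in>{1..m}. (\<Sum>\<alpha>\<in>pos_roots m. of_nat (\<pi> \<alpha>) * root_wt \<alpha> k) = \<eta> k)}"

text \<open>
  The list \<open>ord\<close> enumerates the positive roots and fixes the order of the factors; the root vector
  of \<open>-\<alpha>\<close> for \<open>\<alpha> = \<epsilon>\<^sub>i - \<epsilon>\<^sub>j\<close> is \<open>e\<^bsub>j,i\<^esub>\<close>.
\<close>

definition e_neg :: "nat \<Rightarrow> (nat \<times> nat) list \<Rightarrow> (nat \<times> nat \<Rightarrow> nat) \<Rightarrow> gl_free set" where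
  "e_neg m ord \<pi> =
    ncprod (Ugl m) (map (\<lambda>\<alpha>. U_unit m (snd \<alpha>) (fst \<alpha>) [^]\<^bsub>Ugl m\<^esub> \<pi> \<alpha>) ord)"

definition U_left_ideal :: "nat \<Rightarrow> gl_free set \<Rightarrow> gl_free set set" where
  "U_left_ideal m x = {u \<otimes>\<^bsub>Ugl m\<^esub> x | u. u \<in> carrier (Ugl m)}"

definition U_n_plus :: "nat \<Rightarrow> gl_free set set" where
  "U_n_plus m = {(\<Oplus>\<^bsub>Ugl m\<^esub>\<alpha>\<in>pos_roots m. u \<alpha> \<otimes>\<^bsub>Ugl m\<^esub> U_unit m (fst \<alpha>) (snd \<alpha>)) | u.
     u \<in> pos_roots m \<rightarrow> carrier (Ugl m)}"

text \<open>
  \<open>shapovalov m ord \<eta> \<theta> H\<close>: \<open>\<theta>\<close> is a Shapovalov element for the pair \<open>(\<eta>, 1)\<close>, with coefficients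
  \<open>H\<close>. That \<open>\<theta>\<close> lies in the enveloping algebra of the lower triangular matrices and has
  weight \<open>-\<eta>\<close> is a consequence of the form of the expansion.
\<close>

definition shapovalov ::
  "nat \<Rightarrow> (nat \<times> nat) list \<Rightarrow> weight \<Rightarrow> gl_free set \<Rightarrow> ((nat \<times> nat \<Rightarrow> nat) \<Rightarrow> h_poly) \<Rightarrow> bool" where
  "shapovalov m ord \<eta> \<theta> H \<longleftrightarrow>
     (\<forall>\<pi>\<in>root_partitions m \<eta>. H \<pi> \<in> h_polys m) \<and>
     \<theta> = (\<Oplus>\<^bsub>Ugl m\<^esub>\<pi>\<in>root_partitions m \<eta>. e_neg m ord \<pi> \<otimes>\<^bsub>Ugl m\<^esub> U_poly m (H \<pi>)) \<and>
     (\<forall>\<pi>\<in>root_partitions m \<eta>. (\<forall>\<alpha>. \<alpha> \<notin> simple_roots m \<longrightarrow> \<pi> \<alpha> = 0) \<longrightarrow> H \<pi> = 1) \<and>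
     (\<forall>\<alpha>\<in>pos_roots m. U_unit m (fst \<alpha>) (snd \<alpha>) \<otimes>\<^bsub>Ugl m\<^esub> \<theta> \<in>
        U_left_ideal m (U_emb m (h_mat \<eta>) \<oplus>\<^bsub>Ugl m\<^esub>
          U_scalar m (wt_eval m (gl_rho m) (h_mat \<eta>) - wt_form m \<eta> \<eta> / 2))
        <+>\<^bsub>Ugl m\<^esub> U_n_plus m)"

text \<open>The evaluation at \<open>\<mu>\<close> of the element with coefficients \<open>H\<close>.\<close>

definition shapovalov_eval ::
  "nat \<Rightarrow> (nat \<times> nat) list \<Rightarrow> weight \<Rightarrow> ((nat \<times> nat \<Rightarrow> nat) \<Rightarrow> h_poly) \<Rightarrow> weight \<Rightarrow> gl_free set" where
  "shapovalov_eval m ord \<eta> H \<mu> =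
     (\<Oplus>\<^bsub>Ugl m\<^esub>\<pi>\<in>root_partitions m \<eta>.
        e_neg m ord \<pi> \<otimes>\<^bsub>Ugl m\<^esub> U_scalar m (h_poly_eval m (H \<pi>) \<mu>))"


section \<open>The matrix\<close>

definition a_coeff :: "nat \<Rightarrow> weight \<Rightarrow> nat \<Rightarrow> complex" where
  "a_coeff m \<mu> k = wt_form m (\<mu> + gl_rho m) (gl_eps 1 - gl_eps (k + 1)) - 1"

definition D_matrix :: "nat \<Rightarrow> weight \<Rightarrow> nat \<Rightarrow> nat \<Rightarrow> gl_free set" where
  "D_matrix m \<mu> i j =
     (if i \<le> j then U_unit m (m + 1 - i) (m - j)
      else if i = j + 1 then U_scalar m (- a_coeff m \<mu> (m - 1 - j))
      else \<zero>\<^bsub>Ugl m\<^esub>)"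

end

theory Submission
  imports Defs
begin

text \<open>
  Fix \<open>\<mu>\<close> on the hyperplane. The Verma module of highest weight \<open>\<mu>\<close> is realised by differential
  operators on (formal) power series in variables \<open>y\<^bsub>l,k\<^esub>\<close>, \<open>k < l\<close>, by adding one row and column
  at a time, so that \<open>e\<^bsub>l,k\<^esub>\<close> acts on the constant 1 as multiplication by \<open>y\<^bsub>l,k\<^esub>\<close>.
  For \<open>T = {1 = t\<^sub>0 < \<dots> < t\<^sub>r = m}\<close> put \<open>E\<^sub>T = e\<^bsub>t\<^sub>r,t\<^sub>r\<^sub>-\<^sub>1\<^esub> \<cdots> e\<^bsub>t\<^sub>1,t\<^sub>0\<^esub>\<close>;
  it maps 1 to the monomial \<open>\<Prod> y\<^bsub>t\<^sub>i,t\<^sub>i\<^sub>-\<^sub>1\<^esub>\<close>. Reordering factors shows that every element of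
  weight \<open>-\<eta>'\<close> of \<open>U(n\<^sup>-)\<close> is a combination of the \<open>E\<^sub>T\<close>, whose coefficients can therefore be read off
  from its action on 1, and that the coefficient at the full set \<open>{1..m}\<close> is that of the simple roots.

  On the hyperplane the Shapovalov element sends 1 to a vector killed by all \<open>e\<^bsub>a,a+1\<^esub>\<close>. Comparing
  coefficients in these equations shows inductively that deleting \<open>b\<close> from \<open>T\<close> multiplies the
  coefficient by \<open>a\<^bsub>b-1\<^esub>\<close>, so the coefficient at \<open>T\<close> is the product of the \<open>a\<^bsub>b-1\<^esub>\<close> over \<open>b \<notin> T\<close>.
  The expansion of the Hessenberg determinant has exactly these coefficients.
\<close>


section \<open>Additive operators on power series\<close>

text \<open>\<open>Ugl\<close> is a bare quotient of a free algebra, so nothing separates the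
  classes of the \<open>E\<^sub>T\<close> at the start; their independence is a piece of the PBW
  theorem. Hence the division of labour: inside the algebra the \<open>E\<^sub>T\<close> are only
  shown to span, and a concrete module in which they send 1 to different monomials makes the
  coefficients well defined. Building this module one row and column at a time leaves the relations
  of gl to be verified for a single extension step.

  The hyperplane enters through the generator of the left ideal: it acts on 1 by the scalar
  \<open>(\<mu> + \<rho>, \<eta>') - (\<eta>', \<eta>') / 2 = 1 - 1 = 0\<close>, and this is why the
  image of 1 is singular.

  Origin of the constants: for \<open>T\<close> containing \<open>a\<close> and
  \<open>a + 1\<close>, with \<open>a > 1\<close>, the equation of \<open>e_{a,a+1}\<close> involves
  the coefficients at \<open>T\<close>, at \<open>T\<close> without \<open>a\<close> and at
  \<open>T\<close> without \<open>a + 1\<close>. If \<open>A b\<close> is the factor for deleting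
  \<open>b\<close>, it reads \<open>A (a + 1) = A a + \<mu> a - \<mu> (a + 1) + 1\<close>, while
  \<open>a = 1\<close> gives \<open>A 2 = \<mu> 1 - \<mu> 2\<close>. So
  \<open>A b = \<mu> 1 - \<mu> b + b - 2\<close>, and the entries of \<open>\<rho>\<close> drop by 1
  at each step, which turns this into \<open>a_{b-1}\<close>.\<close>

type_synonym 'k pseries = "('k \<Rightarrow> nat) \<Rightarrow> complex"

text \<open>Only additivity is demanded: it already makes the operators a \<open>ring_1\<close>, so
  that the commutator identities below become calculations in a type class. Complex scalars enter as
  the operators \<open>scal c\<close>.\<close>

typedef 'k endo = "{f :: 'k pseries \<Rightarrow> 'k pseries. \<forall>x y. f (x + y) = f x + f y}"
  morphisms app Endo
  by (rule exI[of _ id]) simp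

setup_lifting type_definition_endo

lemma endo_eqI: "(\<And>x. app f x = app g x) \<Longrightarrow> f = g"
  by transfer auto

lemma app_add [simp]: "app f (x + y) = app f x + app f y"
  by transfer auto

lemma app_zero [simp]: "app f 0 = 0"
  using app_add[of f 0 0] by simp

instantiation endo :: (type) ring_1
begin

lift_definition zero_endo :: "'a endo" is "\<lambda>x. 0" by simp
lift_definition one_endo :: "'a endo" is "\<lambda>x. x" by simp
lift_definition plus_endo :: "'a endo \<Rightarrow> 'a endo \<Rightarrow> 'a endo" is "\<lambda>f g x. f x + g x"
  by (simp add: algebra_simps)
lift_definition minus_endo :: "'a endo \<Rightarrow> 'a endo \<Rightarrow> 'a endo" is "\<lambda>f g x. f x - g x"
  by (simp add: algebra_simps)
lift_definition uminus_endo :: "'a endo \<Rightarrow> 'a endo" is "\<lambda>f x. - f x"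
  by simp
lift_definition times_endo :: "'a endo \<Rightarrow> 'a endo \<Rightarrow> 'a endo" is "\<lambda>f g x. f (g x)"
  by simp

instance
proof
  show "(0 :: 'a endo) \<noteq> 1"
    by transfer (simp add: fun_eq_iff exI[of _ 1])
qed (transfer; auto simp: algebra_simps)+

end

lemma app_simps [simp]:
  "app 0 x = 0" "app (f + g) x = app f x + app g x" "app (f - g) x = app f x - app g x"
  "app (- f) x = - app f x" "app (f * g) x = app f (app g x)" "app 1 x = x"
  by (transfer; simp)+

lemma app_sum: "app (sum F A) x = (\<Sum>i\<in>A. app (F i) x)"
  by (induction A rule: infinite_finite_induct) auto

lift_definition scal :: "complex \<Rightarrow> 'k endo" is "\<lambda>c f n. c * f n"
  by (simp add: fun_eq_iff algebra_simps)

text \<open>In terms of coefficients, multiplication by the variable \<open>k\<close>;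
  \<open>derX\<close> is the partial derivative in that variable.\<close>

lift_definition shiftX :: "'k \<Rightarrow> 'k endo" is
  "\<lambda>k f n. if n k = 0 then 0 else f (n(k := n k - 1))"
  by (simp add: fun_eq_iff)

lift_definition derX :: "'k \<Rightarrow> 'k endo" is
  "\<lambda>k f n. of_nat (n k + 1) * f (n(k := n k + 1))"
  by (simp add: fun_eq_iff algebra_simps)

lemma app_scal [simp]: "app (scal c) f n = c * f n"
  by transfer simp

lemma app_shiftX: "app (shiftX k) f n = (if n k = 0 then 0 else f (n(k := n k - 1)))"
  by transfer simp

lemma app_derX: "app (derX k) f n = of_nat (n k + 1) * f (n(k := n k + 1))"
  by transfer simp

lemma shiftX_commute: "shiftX j * shiftX k = shiftX k * shiftX j"
proof (cases "j = k")
  case False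
  then show ?thesis
    by (intro endo_eqI ext) (simp add: app_shiftX fun_upd_twist[OF False])
qed simp

lemma derX_commute: "derX j * derX k = derX k * derX j"
proof (cases "j = k")
  case False
  then show ?thesis
    by (intro endo_eqI ext) (simp add: app_derX fun_upd_twist[OF False])
qed simp

lemma derX_shiftX: "derX j * shiftX k = shiftX k * derX j + (if j = k then 1 else 0)"
proof (cases "j = k")
  case True
  then show ?thesis
    by (intro endo_eqI ext) (simp add: app_derX app_shiftX algebra_simps of_nat_diff)
next
  case False
  then show ?thesis
    by (intro endo_eqI ext) (simp add: app_derX app_shiftX fun_upd_twist[OF False])
qed

lemma scal_commute: "scal c * shiftX k = shiftX k * scal c" "scal c * derX k = derX k * scal c"
  "scal c * scal d = scal d * scal c"
  by (intro endo_eqI ext; simp add: app_shiftX app_derX)+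

lemma scal_hom: "scal (a + b) = (scal a + scal b :: 'k endo)" "scal (a * b) = scal a * scal b" "scal 0 = 0" "scal 1 = 1"
   "scal (- a) = - scal a" "scal (a - b) = scal a - scal b"
  by (intro endo_eqI ext; simp add: algebra_simps)+

section \<open>A realisation of the Verma module\<close>

definition gl_rels :: "nat \<Rightarrow> (nat \<Rightarrow> nat \<Rightarrow> 'r::ring_1) \<Rightarrow> bool" where
  "gl_rels n e \<longleftrightarrow> (\<forall>i\<in>{1..n}. \<forall>j\<in>{1..n}. \<forall>k\<in>{1..n}. \<forall>l\<in>{1..n}.
     e i j * e k l - e k l * e i j = (if j = k then e i l else 0) - (if i = l then e k j else 0))"

text \<open>
  The representation of \<open>gl(n + 1)\<close> induced from a representation \<open>e\<close> of \<open>gl(n)\<close>, extended by \<open>c\<close> on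
  \<open>e\<^bsub>n+1,n+1\<^esub>\<close> and by \<open>0\<close> on \<open>e\<^bsub>i,n+1\<^esub>\<close>, to the polynomials in \<open>y\<^sub>1, \<dots>, y\<^sub>n\<close>, where
  \<open>y\<^sub>j\<close> is the action of \<open>e\<^bsub>n+1,j\<^esub>\<close>.
\<close>

definition gl_extend ::
  "nat \<Rightarrow> (nat \<Rightarrow> nat \<Rightarrow> 'r) \<Rightarrow> (nat \<Rightarrow> 'r) \<Rightarrow> (nat \<Rightarrow> 'r) \<Rightarrow> 'r \<Rightarrow> nat \<Rightarrow> nat \<Rightarrow> 'r::ring_1" where
  "gl_extend n e y d c i j =
    (if i \<le> n \<and> j \<le> n then e i j - y j * d i
     else if j \<le> n then y j
     else if i \<le> n then (\<Sum>k\<in>{1..n}. e i k * d k) - (c + (\<Sum>k\<in>{1..n}. y k * d k)) * d i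
     else c + (\<Sum>k\<in>{1..n}. y k * d k))"

text \<open>The \<open>y\<close> and \<open>d\<close> form a Weyl algebra commuting with
  \<open>e\<close>, and the entries arise by pushing root vectors through products of the
  \<open>y\<close>. The relations are checked by type of index, at most \<open>n\<close> or equal to
  \<open>n + 1\<close>; all of them come down to the commutators of \<open>N\<close> and
  \<open>A\<close> with the generators.\<close>

lemma gl_rels_extend:
  fixes e :: "nat \<Rightarrow> nat \<Rightarrow> 'r::ring_1"
  assumes rel: "gl_rels n e"
    and ey: "\<And>i j k. i \<in> {1..n} \<Longrightarrow> j \<in> {1..n} \<Longrightarrow> k \<in> {1..n} \<Longrightarrow> y k * e i j = e i j * y k"
    and ed: "\<And>i j k. i \<in> {1..n} \<Longrightarrow> j \<in> {1..n} \<Longrightarrow> k \<in> {1..n} \<Longrightarrow> d k * e i j = e i j * d k"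
    and yy: "\<And>j k. y j * y k = y k * y j"
    and dd: "\<And>j k. d j * d k = d k * d j"
    and dy: "\<And>j k. d j * y k = y k * d j + (if j = k then 1 else 0)"
    and cy: "\<And>k. y k * c = c * y k"
    and cd: "\<And>k. d k * c = c * d k"
    and ce: "\<And>i j. i \<in> {1..n} \<Longrightarrow> j \<in> {1..n} \<Longrightarrow> e i j * c = c * e i j"
  shows "gl_rels (Suc n) (gl_extend n e y d c)"
proof -
  \<comment> \<open>The Euler operator, which measures the degree in the \<open>y\<close>: its
    commutators with \<open>y k\<close> and \<open>d k\<close> are \<open>y k\<close> and
    \<open>- d k\<close>.\<close>
  define N where "N = (\<Sum>k\<in>{1..n}. y k * d k)"
  define A where "A i = (\<Sum>k\<in>{1..n}. e i k * d k)" for i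
  define f where "f i j = e i j - y j * d i" for i j
  define B where "B i = A i - (c + N) * d i" for i
  let ?I = "{1..n}"
  have dyl: "d j * (y k * x) = y k * (d j * x) + (if j = k then x else 0)" for j k x
    using dy[of j k] by (simp add: algebra_simps flip: mult.assoc)
  have yyl: "y j * (y k * x) = y k * (y j * x)" for j k x
    using yy[of j k] by (simp flip: mult.assoc)
  have Nd: "d k * N = N * d k + d k" if k: "k \<in> ?I" for k
  proof -
    have "d k * N = (\<Sum>l\<in>?I. y l * d l * d k + (if k = l then d l else 0))"
      unfolding N_def sum_distrib_left
      by (rule sum.cong) (simp_all add: dyl mult.assoc dd[of k])
    also have "\<dots> = N * d k + d k"
      using k by (simp add: sum.distrib N_def sum_distrib_right)
    finally show ?thesis .
  qed
  have Ny: "N * y k = y k * N + y k" if k: "k \<in> ?I" for k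
  proof -
    have "N * y k = (\<Sum>l\<in>?I. y k * (y l * d l) + (if l = k then y l else 0))"
      unfolding N_def sum_distrib_right
      by (rule sum.cong) (simp_all add: mult.assoc dy distrib_left yyl[of _ k])
    also have "\<dots> = y k * N + y k"
      using k by (simp add: sum.distrib N_def sum_distrib_left)
    finally show ?thesis .
  qed
  have Ne: "N * e i j = e i j * N" if "i \<in> ?I" "j \<in> ?I" for i j
    unfolding N_def sum_distrib_left sum_distrib_right
    using that by (intro sum.cong) (simp_all add: mult.assoc ed, simp add: ey flip: mult.assoc)
  have eyl: "y k * (e i j * x) = e i j * (y k * x)"
    and edl: "d k * (e i j * x) = e i j * (d k * x)" if "i \<in> ?I" "j \<in> ?I" "k \<in> ?I" for i j k x
    using ey[OF that] ed[OF that] by (simp_all flip: mult.assoc)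
  have eNl: "N * (e i j * x) = e i j * (N * x)"
    and ecl: "c * (e i j * x) = e i j * (c * x)" if "i \<in> ?I" "j \<in> ?I" for i j x
    using Ne[OF that] ce[OF that] by (simp_all flip: mult.assoc)
  have Nyd: "N * (y j * d i) = (y j * d i) * N" if "i \<in> ?I" "j \<in> ?I" for i j
  proof -
    have "N * (y j * d i) - (y j * d i) * N = (N * y j - y j * N) * d i - y j * (d i * N - N * d i)"
      by (simp add: algebra_simps)
    then show ?thesis unfolding Ny[OF that(2)] Nd[OF that(1)] by simp
  qed
  have ee: "e i j * e k l - e k l * e i j = (if j = k then e i l else 0) - (if i = l then e k j else 0)"
    if "i \<in> ?I" "j \<in> ?I" "k \<in> ?I" "l \<in> ?I" for i j k l
    using rel that unfolding gl_rels_def by blast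
  have r1: "f i j * f k l - f k l * f i j = (if j = k then f i l else 0) - (if i = l then f k j else 0)"
    if "i \<in> ?I" "j \<in> ?I" "k \<in> ?I" "l \<in> ?I" for i j k l
  proof -
    have 1: "(y j * d i) * (y l * d k) - (y l * d k) * (y j * d i)
        = (if i = l then y j * d k else 0) - (if j = k then y l * d i else 0)"
      by (simp add: mult.assoc dyl distrib_left dd[of i k] yyl[of j l])
    have 2: "e i j * (y l * d k) = (y l * d k) * e i j" "e k l * (y j * d i) = (y j * d i) * e k l"
      using that by (simp_all add: mult.assoc ed) (simp_all add: ey flip: mult.assoc)
    have "f i j * f k l - f k l * f i j = (e i j * e k l - e k l * e i j)
       + ((y j * d i) * (y l * d k) - (y l * d k) * (y j * d i))"
      unfolding f_def using 2 by (simp add: algebra_simps)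
    then show ?thesis unfolding 1 using ee[OF that] by (simp add: f_def)
  qed
  have r2: "f i j * y k - y k * f i j = - (if i = k then y j else 0)"
    if "i \<in> ?I" "j \<in> ?I" "k \<in> ?I" for i j k
  proof -
    have "f i j * y k - y k * f i j = (e i j * y k - y k * e i j) - y j * (d i * y k - y k * d i)
        + (y k * y j - y j * y k) * d i"
      unfolding f_def by (simp add: algebra_simps)
    then show ?thesis unfolding ey[OF that] dy yy[of k j] by simp
  qed
  have r3: "f i j * (c + N) = (c + N) * f i j" if "i \<in> ?I" "j \<in> ?I" for i j
  proof -
    have "c * (y j * d i) = (y j * d i) * c"
      by (simp add: mult.assoc cd) (simp add: cy flip: mult.assoc)
    then show ?thesis
      unfolding f_def using that Nyd[OF that] Ne[OF that] ce[OF that] by (simp add: algebra_simps)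
  qed
  have eA: "e i j * A k - A k * e i j = (if j = k then A i else 0) - e k j * d i"
    if "i \<in> ?I" "j \<in> ?I" "k \<in> ?I" for i j k
  proof -
    have "e i j * A k - A k * e i j = (\<Sum>l\<in>?I. (e i j * e k l - e k l * e i j) * d l)"
      unfolding A_def sum_distrib_left sum_distrib_right sum_subtractf[symmetric]
      using that by (intro sum.cong) (simp_all add: algebra_simps ed)
    also have "\<dots> = (\<Sum>l\<in>?I. (if j = k then e i l * d l else 0) - (if i = l then e k j * d l else 0))"
      using that by (intro sum.cong) (simp_all add: ee left_diff_distrib)
    finally show ?thesis using that by (simp add: sum_subtractf A_def)
  qed
  have dA: "d j * A i = A i * d j" if "i \<in> ?I" "j \<in> ?I" for i j
    unfolding A_def sum_distrib_left sum_distrib_right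
    using that by (intro sum.cong) (simp_all add: mult.assoc edl dd[of j])
  have Ay: "A i * y j = y j * A i + e i j" if "i \<in> ?I" "j \<in> ?I" for i j
  proof -
    have "A i * y j = (\<Sum>k\<in>?I. y j * (e i k * d k) + (if k = j then e i k else 0))"
      unfolding A_def sum_distrib_right
      using that by (intro sum.cong)
        (simp_all add: mult.assoc dy distrib_left eyl)
    then show ?thesis using that by (simp add: sum.distrib A_def sum_distrib_left)
  qed
  have AN: "A i * N = N * A i + A i" if "i \<in> ?I" for i
  proof -
    have "A i * N = (\<Sum>k\<in>?I. N * (e i k * d k) + e i k * d k)"
      unfolding A_def sum_distrib_right
      using that by (intro sum.cong)
        (simp_all add: mult.assoc Nd distrib_left eNl)
    then show ?thesis by (simp add: sum.distrib A_def sum_distrib_left)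
  qed
  have Ac: "A i * c = c * A i" if "i \<in> ?I" for i
    unfolding A_def sum_distrib_right sum_distrib_left
    using that by (intro sum.cong) (simp_all add: mult.assoc cd ecl)
  have AA: "A i * A j - A j * A i = A i * d j - A j * d i" if "i \<in> ?I" "j \<in> ?I" for i j
  proof -
    have "A i * A j - A j * A i = (\<Sum>l\<in>?I. (e i l * A j - A j * e i l) * d l)"
      unfolding A_def[of i] sum_distrib_left sum_distrib_right sum_subtractf[symmetric]
      using that by (intro sum.cong) (simp_all add: algebra_simps dA)
    also have "\<dots> = (\<Sum>l\<in>?I. (if l = j then A i * d l else 0) - e j l * d l * d i)"
      using that by (intro sum.cong) (auto simp: eA algebra_simps dd[of i])
    finally show ?thesis using that by (simp add: sum_subtractf A_def sum_distrib_right)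
  qed
  \<comment> \<open>\<open>f i j\<close> moves \<open>d k\<close> and \<open>A k\<close> by the same
    rule and commutes with \<open>c + N\<close>, so it moves \<open>B k\<close> by that rule
    too.\<close>
  have r6: "f i j * B k - B k * f i j = (if j = k then B i else 0)"
    if i: "i \<in> ?I" and j: "j \<in> ?I" and k: "k \<in> ?I" for i j k
  proof -
    have dfd: "f i j * d k - d k * f i j = (if j = k then d i else 0)"
    proof -
      have "f i j * d k - d k * f i j = (e i j * d k - d k * e i j) + (d k * y j - y j * d k) * d i
          + y j * (d k * d i - d i * d k)"
        unfolding f_def by (simp add: algebra_simps)
      then show ?thesis unfolding ed[OF i j k] dy dd[of k i] by auto
    qed
    have ydA: "(y j * d i) * A k - A k * (y j * d i) = - e k j * d i"
    proof -
      have "(y j * d i) * A k - A k * (y j * d i) = y j * (d i * A k - A k * d i)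
          - (A k * y j - y j * A k) * d i"
        by (simp add: algebra_simps)
      then show ?thesis unfolding dA[OF k i] Ay[OF k j] by simp
    qed
    have fA: "f i j * A k - A k * f i j = (if j = k then A i else 0)"
    proof -
      have "f i j * A k - A k * f i j = (e i j * A k - A k * e i j)
          - ((y j * d i) * A k - A k * (y j * d i))"
        unfolding f_def by (simp add: algebra_simps)
      then show ?thesis unfolding eA[OF that] ydA by simp
    qed
    have "f i j * B k - B k * f i j = (f i j * A k - A k * f i j)
      - (c + N) * (f i j * d k - d k * f i j) - (f i j * (c + N) - (c + N) * f i j) * d k"
      unfolding B_def by (simp add: algebra_simps)
    then show ?thesis unfolding fA dfd r3[OF i j] by (simp add: B_def)
  qed
  have r7: "B i * y j - y j * B i = f i j - (if i = j then c + N else 0)"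
    if i: "i \<in> ?I" and j: "j \<in> ?I" for i j
  proof -
    have "B i * y j - y j * B i = (A i * y j - y j * A i) - (c + N) * (d i * y j - y j * d i)
       - (c * y j - y j * c) * d i - (N * y j - y j * N) * d i"
      unfolding B_def by (simp add: algebra_simps)
    then show ?thesis
      unfolding Ay[OF that] dy Ny[OF j] cy by (simp add: f_def)
  qed
  have r8: "B i * (c + N) - (c + N) * B i = B i" if i: "i \<in> ?I" for i
  proof -
    have "B i * (c + N) - (c + N) * B i = (A i * c - c * A i) + (A i * N - N * A i)
      - (c + N) * (d i * c - c * d i) - (c + N) * (d i * N - N * d i) "
      unfolding B_def by (simp add: algebra_simps)
    then show ?thesis
      unfolding Ac[OF i] AN[OF i] cd Nd[OF i] by (simp add: B_def)
  qed
  have r9: "B i * B j = B j * B i" if i: "i \<in> ?I" and j: "j \<in> ?I" for i j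
  proof -
    have ACd: "A i * (c + N) - (c + N) * A i = A i" if "i \<in> ?I" for i
      using Ac[OF that] AN[OF that] by (simp add: algebra_simps)
    have dCd: "d i * (c + N) - (c + N) * d i = d i" if "i \<in> ?I" for i
      using cd Nd[OF that] by (simp add: algebra_simps)
    \<comment> \<open>Regrouped so that only known commutators occur. Those of \<open>A\<close> with
      \<open>c + N\<close> cancel \<open>A i * d j - A j * d i\<close>; the remaining terms cancel
      or vanish.\<close>
    have "B i * B j - B j * B i = (A i * A j - A j * A i)
        - (A i * (c + N) - (c + N) * A i) * d j + (A j * (c + N) - (c + N) * A j) * d i
        - (c + N) * (A i * d j - d j * A i) + (c + N) * (A j * d i - d i * A j)
        + (c + N) * (d i * (c + N) - (c + N) * d i) * d j - (c + N) * (d j * (c + N) - (c + N) * d j) * d i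
        + (c + N) * (c + N) * (d i * d j - d j * d i)"
      unfolding B_def by (simp add: algebra_simps)
    then have "B i * B j - B j * B i = 0"
      unfolding ACd[OF i] ACd[OF j] dCd[OF i] dCd[OF j] AA[OF that] dA[OF i j] dA[OF j i]
      by (simp add: algebra_simps dd[of j i])
    then show ?thesis by simp
  qed
  have ext: "gl_extend n e y d c i j = (if i \<in> ?I then if j \<in> ?I then f i j else B i else if j \<in> ?I then y j else c + N)"
    if "i \<in> {1..Suc n}" "j \<in> {1..Suc n}" for i j
    using that by (auto simp: gl_extend_def f_def B_def A_def N_def)
  \<comment> \<open>Mirror images, since the case distinction meets pairs of index types in both
    orders.\<close>
  have r2': "y k * f i j - f i j * y k = (if i = k then y j else 0)"
    if "i \<in> ?I" "j \<in> ?I" "k \<in> ?I" for i j k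
    using r2[OF that] by (simp add: algebra_simps)
  have r6': "B k * f i j - f i j * B k = - (if j = k then B i else 0)"
    if "i \<in> ?I" "j \<in> ?I" "k \<in> ?I" for i j k
    using r6[OF that] by (simp add: algebra_simps)
  have r7': "y j * B i - B i * y j = (if i = j then c + N else 0) - f i j"
    if "i \<in> ?I" "j \<in> ?I" for i j
    using r7[OF that] by (simp add: algebra_simps)
  have r8': "(c + N) * B i - B i * (c + N) = - B i" if "i \<in> ?I" for i
    using r8[OF that] by (simp add: algebra_simps)
  have r5: "(c + N) * y j - y j * (c + N) = y j" if "j \<in> ?I" for j
    using Ny[OF that] cy by (simp add: algebra_simps)
  have r5': "y j * (c + N) - (c + N) * y j = - y j" if "j \<in> ?I" for j
    using Ny[OF that] cy by (simp add: algebra_simps)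
  show ?thesis
    unfolding gl_rels_def
  proof (intro ballI)
    fix i j k l
    assume *: "i \<in> {1..Suc n}" "j \<in> {1..Suc n}" "k \<in> {1..Suc n}" "l \<in> {1..Suc n}"
    have out: "x \<in> ?I \<or> x = Suc n \<and> Suc n \<notin> ?I" if "x \<in> {1..Suc n}" for x
      using that by auto
    show "gl_extend n e y d c i j * gl_extend n e y d c k l - gl_extend n e y d c k l * gl_extend n e y d c i j
      = (if j = k then gl_extend n e y d c i l else 0) - (if i = l then gl_extend n e y d c k j else 0)"
      unfolding ext[OF *(1,2)] ext[OF *(3,4)] ext[OF *(1,4)] ext[OF *(3,2)]
      using out[OF *(1)] out[OF *(2)] out[OF *(3)] out[OF *(4)]
      by (elim disjE conjE; simp add: r1 r2 r2' r3 r5 r5' r6 r6' r7 r7' r8 r8' r9 yy)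
  qed
qed

lemma gl_extend_commute:
  assumes "\<And>i j. x * e i j = e i j * x" "\<And>k. x * y k = y k * x" "\<And>k. x * d k = d k * x" "x * c = c * x"
  shows "x * gl_extend n e y d c i j = gl_extend n e y d c i j * x"
proof -
  have mul: "x * (p * q) = p * q * x" if "x * p = p * x" "x * q = q * x" for p q
    using that by (metis mult.assoc)
  have sum: "x * sum g A = sum g A * x" if "\<And>k. x * g k = g k * x" for g :: "nat \<Rightarrow> _" and A
    using that by (simp add: sum_distrib_left sum_distrib_right)
  have N: "x * (c + (\<Sum>k\<in>{1..n}. y k * d k)) = (c + (\<Sum>k\<in>{1..n}. y k * d k)) * x"
    using sum[OF mul[OF assms(2,3)]] assms(4) by (simp add: distrib_left distrib_right)
  show ?thesis
    unfolding gl_extend_def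
    using assms(1,2) mul[OF assms(2,3)] sum[OF mul[OF assms(1,3)]] mul[OF N assms(3)] N
    by (simp only: left_diff_distrib right_diff_distrib split: if_splits) simp
qed

text \<open>Each stage induces from block upper triangular matrices with blocks of size
  \<open>n\<close> and 1, so the iteration amounts to inducing the character \<open>\<mu>\<close>
  from all upper triangular matrices. The variable \<open>(l, k)\<close> enters at stage
  \<open>l\<close>.\<close>

primrec verma :: "(nat \<Rightarrow> complex) \<Rightarrow> nat \<Rightarrow> nat \<Rightarrow> nat \<Rightarrow> (nat \<times> nat) endo" where
  "verma \<mu> 0 = (\<lambda>i j. 0)"
| "verma \<mu> (Suc n) = gl_extend n (verma \<mu> n) (\<lambda>k. shiftX (Suc n, k)) (\<lambda>k. derX (Suc n, k))
     (scal (\<mu> (Suc n)))"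

lemma verma_commute_scal: "scal c * verma \<mu> n i j = verma \<mu> n i j * scal c"
  by (induction n arbitrary: i j) (simp_all add: gl_extend_commute scal_commute)

text \<open>Stage \<open>n\<close> is built from variables and derivatives of rows up to
  \<open>n\<close>, so a later row commutes with it. This supplies the commutation hypotheses of
  \<open>gl_rels_extend\<close>.\<close>

lemma verma_commute_shiftX: "n < l \<Longrightarrow> shiftX (l, k) * verma \<mu> n i j = verma \<mu> n i j * shiftX (l, k)"
  by (induction n arbitrary: i j)
    (simp_all add: gl_extend_commute shiftX_commute derX_shiftX flip: scal_commute(1))

lemma verma_commute_derX: "n < l \<Longrightarrow> derX (l, k) * verma \<mu> n i j = verma \<mu> n i j * derX (l, k)"
  by (induction n arbitrary: i j)
    (simp_all add: gl_extend_commute derX_commute derX_shiftX flip: scal_commute(2))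

lemma verma_rels: "gl_rels n (verma \<mu> n)"
proof (induction n)
  case 0
  show ?case by (simp add: gl_rels_def)
next
  case (Suc n)
  show ?case
    unfolding verma.simps
    by (rule gl_rels_extend[OF Suc.IH])
      (simp_all add: verma_commute_shiftX verma_commute_derX shiftX_commute derX_commute derX_shiftX
        scal_commute verma_commute_scal)
qed

section \<open>Monomials, the highest weight vector and explicit formulas for the action\<close>

definition mono_vec :: "('k \<Rightarrow> nat) \<Rightarrow> 'k pseries" where
  "mono_vec p = (\<lambda>n. if n = p then 1 else 0)"

lemma shiftX_mono_vec: "app (shiftX k) (mono_vec p) = mono_vec (p(k := p k + 1))"
proof
  fix n
  have "n k \<noteq> 0 \<and> n(k := n k - 1) = p \<longleftrightarrow> n = p(k := p k + 1)"
    by (auto simp: fun_eq_iff)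
  then show "app (shiftX k) (mono_vec p) n = mono_vec (p(k := p k + 1)) n"
    by (auto simp: app_shiftX mono_vec_def)
qed

lemma derX_mono_vec: "p k = 0 \<Longrightarrow> app (derX k) (mono_vec p) = 0"
  by (auto simp: fun_eq_iff app_derX mono_vec_def)

text \<open>Every correction added by a stage ends in a derivative, which kills the constant 1; only
  the scalar inserted at stage \<open>i\<close> remains.\<close>

lemma verma_diag_vac:
  assumes "i \<in> {1..n}"
  shows "app (verma \<mu> n i i) (mono_vec (\<lambda>_. 0)) = app (scal (\<mu> i)) (mono_vec (\<lambda>_. 0))"
  using assms
proof (induction n)
  case (Suc n)
  then show ?case
    by (cases "i = Suc n") (simp_all add: gl_extend_def app_sum derX_mono_vec)
qed simp

lemma verma_upper_vac:
  assumes "1 \<le> i" "i < j" "j \<le> n"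
  shows "app (verma \<mu> n i j) (mono_vec (\<lambda>_. 0)) = 0"
  using assms
proof (induction n)
  case (Suc n)
  then show ?case
    by (cases "j = Suc n") (simp_all add: gl_extend_def app_sum derX_mono_vec)
qed simp

text \<open>Stage \<open>b\<close> creates the operator as a multiplication. The term for a later
  row \<open>l\<close> records that commuting \<open>e_{b,a}\<close> past \<open>e_{l,b}\<close>
  produces \<open>- e_{l,a}\<close>.\<close>

lemma verma_lower:
  assumes "1 \<le> a" "a < b" "b \<le> n"
  shows "verma \<mu> n b a = shiftX (b, a) - (\<Sum>l\<in>{Suc b..n}. shiftX (l, a) * derX (l, b))"
  using assms(3)
proof (induction n rule: dec_induct)
  case base
  show ?case using assms by (cases b) (simp_all add: gl_extend_def)
next
  case (step n)
  then show ?case using assms by (simp add: gl_extend_def algebra_simps)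
qed

text \<open>The operator is created at stage \<open>a + 1\<close> from row \<open>a\<close> of the
  stage before, whose entries are multiplications except for the diagonal one. The later stages
  contribute the last sum.\<close>

lemma verma_simple:
  assumes "1 \<le> a" "a < n"
  shows "verma \<mu> n a (Suc a) =
      (\<Sum>j\<in>{1..<a}. shiftX (a, j) * derX (Suc a, j))
      + (scal (\<mu> a) + (\<Sum>k\<in>{1..<a}. shiftX (a, k) * derX (a, k))) * derX (Suc a, a)
      - (scal (\<mu> (Suc a)) + (\<Sum>k\<in>{1..a}. shiftX (Suc a, k) * derX (Suc a, k))) * derX (Suc a, a)
      - (\<Sum>l\<in>{Suc (Suc a)..n}. shiftX (l, Suc a) * derX (l, a))"
  using Suc_leI[OF assms(2)]
proof (induction n rule: dec_induct)
  case base
  obtain a' where a: "a = Suc a'" using assms by (cases a) auto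
  have "(\<Sum>k\<in>{1..a}. verma \<mu> a a k * derX (Suc a, k))
      = (\<Sum>k\<in>{1..<a}. verma \<mu> a a k * derX (Suc a, k)) + verma \<mu> a a a * derX (Suc a, a)"
    using assms by (subst atLeastLessThanSuc_atLeastAtMost[symmetric]) simp
  also have "(\<Sum>k\<in>{1..<a}. verma \<mu> a a k * derX (Suc a, k)) = (\<Sum>j\<in>{1..<a}. shiftX (a, j) * derX (Suc a, j))"
    by (rule sum.cong) (auto simp: a gl_extend_def)
  also have "verma \<mu> a a a = scal (\<mu> a) + (\<Sum>k\<in>{1..<a}. shiftX (a, k) * derX (a, k))"
    by (simp add: a gl_extend_def atLeastLessThanSuc_atLeastAtMost)
  finally show ?case using assms by (simp add: gl_extend_def)
next
  case (step n)
  then show ?case using assms by (simp add: gl_extend_def algebra_simps)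
qed

section \<open>Singular vectors\<close>

text \<open>
  A set \<open>T\<close> of cut points divides an interval into blocks; \<open>(l, k)\<close> encodes the block from \<open>k\<close> to
  \<open>l > k\<close>, in the index order of \<open>e\<^bsub>l,k\<^esub>\<close>, and \<open>chi T\<close> is the exponent of the monomial of \<open>T\<close>.
\<close>

definition blk :: "nat set \<Rightarrow> nat \<times> nat \<Rightarrow> bool" where
  "blk T = (\<lambda>(l, k). k \<in> T \<and> l \<in> T \<and> k < l \<and> (\<forall>x\<in>T. x \<le> k \<or> l \<le> x))"

lemma blkD:
  assumes "blk T (l, k)"
  shows "k \<in> T" "l \<in> T" "k < l" "x \<in> T \<Longrightarrow> x \<le> k \<or> l \<le> x"
  using assms by (simp_all add: blk_def)

definition chi :: "nat set \<Rightarrow> nat \<times> nat \<Rightarrow> nat" where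
  "chi T p = (if blk T p then 1 else 0)"

lemma blk_unique_right: "blk T (a, p) \<Longrightarrow> blk T (a, q) \<Longrightarrow> p = q"
  using blkD[of T a p] blkD[of T a q] by (meson leD le_antisym)

lemma blk_unique_left: "blk T (p, a) \<Longrightarrow> blk T (q, a) \<Longrightarrow> p = q"
  using blkD[of T p a] blkD[of T q a] by (meson leD le_antisym)

lemma blk_exists_right:
  assumes "a \<in> T" "x \<in> T" "x < a" 
  obtains p where "blk T (a, p)" "x \<le> p"
proof -
  let ?p = "Max {y \<in> T. y < a}"
  have f: "finite {y \<in> T. y < a}" by simp
  have "?p \<in> {y \<in> T. y < a}" using assms by (intro Max_in[OF f]) auto
  moreover have "y \<le> ?p" if "y \<in> T" "y < a" for y
    using that by (intro Max_ge[OF f]) simp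
  ultimately have "blk T (a, ?p) \<and> x \<le> ?p"
    unfolding blk_def using assms by (auto simp: not_le[symmetric])
  then show thesis using that by blast
qed

lemma blk_exists_left:
  assumes "a \<in> T" "x \<in> T" "a < x"
  obtains p where "blk T (p, a)" "p \<le> x"
proof -
  define p where "p = (LEAST y. y \<in> T \<and> a < y)"
  have 1: "p \<in> T \<and> a < p" unfolding p_def by (rule LeastI[of _ x]) (use assms in auto)
  have 2: "p \<le> y" if "y \<in> T" "a < y" for y unfolding p_def by (rule Least_le) (use that in auto)
  have "blk T (p, a) \<and> p \<le> x"
    unfolding blk_def using assms 1 2 by (auto simp: not_le[symmetric])
  then show thesis using that by blast
qed

lemma blk_remove:
  assumes ap: "blk T (a, p)" and ba: "blk T (b, a)"
  shows "blk (T - {a}) (l, k) \<longleftrightarrow> (l, k) = (b, p) \<or> blk T (l, k) \<and> (l, k) \<noteq> (a, p) \<and> (l, k) \<noteq> (b, a)"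
proof
  assume *: "blk (T - {a}) (l, k)"
  then have kl: "k \<in> T" "l \<in> T" "k \<noteq> a" "l \<noteq> a" "k < l"
    and no: "x \<in> T \<Longrightarrow> x \<noteq> a \<Longrightarrow> x \<le> k \<or> l \<le> x" for x
    by (simp_all add: blk_def)
  show "(l, k) = (b, p) \<or> blk T (l, k) \<and> (l, k) \<noteq> (a, p) \<and> (l, k) \<noteq> (b, a)"
  proof (cases "k < a \<and> a < l")
    case True
    have "k = p"
      using no[OF blkD(1)[OF ap]] blkD(3)[OF ap] blkD(4)[OF ap kl(1)] True by linarith
    moreover have "l = b"
      using no[OF blkD(2)[OF ba]] blkD(3)[OF ba] blkD(4)[OF ba kl(2)] True by linarith
    ultimately show ?thesis by simp
  next
    case False
    then have "a \<le> k \<or> l \<le> a" by linarith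
    then have "x \<le> k \<or> l \<le> x" if "x \<in> T" for x
      using no[OF that] by (cases "x = a") simp_all
    then show ?thesis using kl by (simp add: blk_def)
  qed
next
  assume "(l, k) = (b, p) \<or> blk T (l, k) \<and> (l, k) \<noteq> (a, p) \<and> (l, k) \<noteq> (b, a)"
  then show "blk (T - {a}) (l, k)"
  proof
    assume "(l, k) = (b, p)"
    moreover have "x \<le> p \<or> b \<le> x" if "x \<in> T" "x \<noteq> a" for x
      using blkD(4)[OF ap that(1)] blkD(4)[OF ba that(1)] that(2) by linarith
    ultimately show ?thesis
      using blkD(1-3)[OF ap] blkD(1-3)[OF ba] by (simp add: blk_def)
  next
    assume *: "blk T (l, k) \<and> (l, k) \<noteq> (a, p) \<and> (l, k) \<noteq> (b, a)"
    have "l \<noteq> a"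
    proof
      assume "l = a"
      then show False using * blk_unique_right[OF ap, of k] by simp
    qed
    moreover have "k \<noteq> a"
    proof
      assume "k = a"
      then show False using * blk_unique_left[OF ba, of l] by simp
    qed
    ultimately show ?thesis using * by (simp add: blk_def)
  qed
qed

text \<open>Deleting a cut point merges the blocks on its two sides, so two variables are traded for
  one. The shifts and derivatives of \<open>verma_simple\<close> are matched against exponents in
  this form.\<close>

lemma chi_remove:
  assumes "blk T (a, p)" "blk T (b, a)"
  shows "chi (T - {a}) = (chi T)((a, p) := 0, (b, a) := 0, (b, p) := 1)"
proof
  fix q :: "nat \<times> nat"
  have "p < a" "a < b" using blkD(3)[OF assms(1)] blkD(3)[OF assms(2)] by simp_all
  then show "chi (T - {a}) q = ((chi T)((a, p) := 0, (b, a) := 0, (b, p) := 1)) q"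
    using blk_remove[OF assms, of "fst q" "snd q"] by (cases q) (auto simp: chi_def)
qed

text \<open>The first and last sum of \<open>verma_simple\<close> carry the coefficients at the cut
  sets without \<open>a\<close> and without \<open>a + 1\<close>, the weight terms the one at
  \<open>T\<close>. The extra 1 counts the block with upper end \<open>a\<close>, which exists
  unless \<open>a = 1\<close>.\<close>

lemma verma_simple_coeff:
  assumes f: "app (verma \<mu> m a (Suc a)) f = 0"
    and T: "T \<subseteq> {1..m}" "1 \<in> T" "m \<in> T" "a \<in> T" "Suc a \<in> T"
  shows "(if 1 < a then f (chi (T - {a})) else 0) - (if Suc a < m then f (chi (T - {Suc a})) else 0)
     + (\<mu> a - \<mu> (Suc a) + (if 1 < a then 1 else 0)) * f (chi T) = 0"
proof -
  have a: "1 \<le> a" "a < m" using T by auto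
  have "x \<le> a \<or> Suc a \<le> x" for x by linarith
  then have ba: "blk T (Suc a, a)" using T by (simp add: blk_def)
  \<comment> \<open>The equation is the coefficient of \<open>e\<^bsub>a,a+1\<^esub> f\<close> at the monomial of \<open>T\<close> without the block
    from \<open>a\<close> to \<open>a + 1\<close>.\<close>
  define n where "n = (chi T)((Suc a, a) := 0)"
  have n0: "n(Suc a, a) = 0" and chiT: "n((Suc a, a) := Suc 0) = chi T"
    using ba by (auto simp: n_def chi_def fun_eq_iff)
  have na: "n (Suc a, k) = 0" for k
    using blk_unique_right[OF ba, of k] by (auto simp: n_def chi_def)
  have nb: "n (l, a) = 0" for l
    using blk_unique_left[OF ba, of l] by (auto simp: n_def chi_def)
  have s1: "(\<Sum>j\<in>{1..<a}. app (shiftX (a, j) * derX (Suc a, j)) f n) = (if 1 < a then f (chi (T - {a})) else 0)"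
  proof (cases "1 < a")
    case True
    obtain p where p: "blk T (a, p)" "1 \<le> p" using blk_exists_right[of a T 1] T True by auto
    have pa: "p < a" using p by (simp add: blk_def)
    have "app (shiftX (a, j) * derX (Suc a, j)) f n = (if j = p then f (chi (T - {a})) else 0)" for j
    proof (cases "j = p")
      case True
      then show ?thesis
        using p pa na[of p] ba unfolding chi_remove[OF p(1) ba]
        by (simp add: app_shiftX app_derX) (simp add: n_def chi_def fun_upd_twist)
    next
      case False
      then have "n (a, j) = 0" using blk_unique_right[OF p(1), of j] by (auto simp: n_def chi_def)
      then show ?thesis using False by (simp add: app_shiftX)
    qed
    then show ?thesis using p pa True by simp
  qed simp
  have s4: "(\<Sum>l\<in>{Suc (Suc a)..m}. app (shiftX (l, Suc a) * derX (l, a)) f n) = (if Suc a < m then f (chi (T - {Suc a})) else 0)"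
  proof (cases "Suc a < m")
    case True
    obtain p where p: "blk T (p, Suc a)" "p \<le> m" using blk_exists_left[of "Suc a" T m] T True by auto
    have pa: "Suc a < p" using p by (simp add: blk_def)
    have "app (shiftX (l, Suc a) * derX (l, a)) f n = (if l = p then f (chi (T - {Suc a})) else 0)" for l
    proof (cases "l = p")
      case True
      then show ?thesis
        using p pa nb[of p] ba unfolding chi_remove[OF ba p(1)]
        by (simp add: app_shiftX app_derX) (simp add: n_def chi_def fun_upd_twist)
    next
      case False
      then have "n (l, Suc a) = 0" using blk_unique_left[OF p(1), of l] by (auto simp: n_def chi_def)
      then show ?thesis using False by (simp add: app_shiftX)
    qed
    then show ?thesis using p pa True by simp
  qed simp
  \<comment> \<open>The Euler operator of row \<open>a\<close> counts the blocks with upper end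
    \<open>a\<close>: exactly one for \<open>a > 1\<close>, because
    \<open>1 \<in> T\<close>.\<close>
  have s2: "(\<Sum>k\<in>{1..<a}. app (shiftX (a, k) * derX (a, k)) g n) = (if 1 < a then g n else 0)" for g
  proof (cases "1 < a")
    case True
    obtain p where p: "blk T (a, p)" "1 \<le> p" using blk_exists_right[of a T 1] T True by auto
    have pa: "p < a" using p by (simp add: blk_def)
    have "app (shiftX (a, j) * derX (a, j)) g n = (if j = p then g n else 0)" for j
    proof (cases "j = p")
      case True
      then have "n (a, j) = 1" using p by (simp add: n_def chi_def)
      then show ?thesis using True
        by (simp add: app_shiftX app_derX fun_upd_idem)
    next
      case False
      then have "n (a, j) = 0" using blk_unique_right[OF p(1), of j] by (auto simp: n_def chi_def)
      then show ?thesis using False by (simp add: app_shiftX)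
    qed
    then show ?thesis using p pa True by simp
  qed simp
  \<comment> \<open>The only block with upper end \<open>a + 1\<close> has been taken out of
    \<open>n\<close>, so this Euler operator gives 0.\<close>
  have s3: "(\<Sum>k\<in>{1..a}. app (shiftX (Suc a, k) * derX (Suc a, k)) g n) = 0" for g
    by (intro sum.neutral) (simp add: app_shiftX na)
  have d: "app (derX (Suc a, a)) f n = f (chi T)"
    by (simp add: app_derX n0 chiT)
  have sumn: "sum F A n = (\<Sum>k\<in>A. F k n)" for F :: "nat \<Rightarrow> (nat \<times> nat) pseries" and A
    by (induction A rule: infinite_finite_induct) auto
  have pd: "app ((p + q) * r) f = app p (app r f) + app q (app r f)" for p q r :: "(nat \<times> nat) endo"
    by simp
  have "app (verma \<mu> m a (Suc a)) f n =
      (if 1 < a then f (chi (T - {a})) else 0)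
      + (\<mu> a * f (chi T) + (if 1 < a then f (chi T) else 0))
      - (\<mu> (Suc a) * f (chi T) + 0)
      - (if Suc a < m then f (chi (T - {Suc a})) else 0)"
    unfolding verma_simple[OF a]
    by (simp only: app_simps(2,3) pd app_sum plus_fun_apply minus_apply sumn s1 s2 s3 s4 app_scal d)
  then show ?thesis using f by (simp add: algebra_simps)
qed

text \<open>The factor for deleting \<open>b\<close> does not depend on the rest of the cut set, so
  the points of \<open>S\<close> can be deleted one at a time. This independence is
  \<open>rem\<close>; its induction on \<open>b\<close> follows the equations, each of which ties
  \<open>a + 1\<close> to \<open>a\<close>.\<close>

lemma verma_singular_coeff:
  assumes f: "\<And>a. 1 \<le> a \<Longrightarrow> a < m \<Longrightarrow> app (verma \<mu> m a (Suc a)) f = 0"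
    and S: "S \<subseteq> {2..<m}" and m: "2 \<le> m"
  shows "f (chi ({1..m} - S)) = (\<Prod>b\<in>S. \<mu> 1 - \<mu> b + of_nat b - 2) * f (chi {1..m})"
proof -
  define A where "A b = \<mu> 1 - \<mu> b + of_nat b - 2" for b
  have two: "f (chi (T - {2})) = A 2 * f (chi T)"
    if "2 < m" "T \<subseteq> {1..m}" "1 \<in> T" "m \<in> T" "2 \<in> T" for T
  proof -
    have "app (verma \<mu> m 1 (Suc 1)) f = 0" using that by (intro f) simp_all
    from verma_simple_coeff[OF this, of T] show ?thesis
      using that by (simp add: A_def numeral_2_eq_2 algebra_simps)
  qed
  have stp: "f (chi (T - {Suc a})) = A (Suc a) * f (chi T)"
    if a: "1 < a" "Suc a < m" and T: "T \<subseteq> {1..m}" "1 \<in> T" "m \<in> T" "Suc a \<in> T" "a \<in> T"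
      and ih: "f (chi (T - {a})) = A a * f (chi T)" for a T
  proof -
    have "app (verma \<mu> m a (Suc a)) f = 0" using a by (intro f) simp_all
    from verma_simple_coeff[OF this, of T] show ?thesis
      using a T ih by (simp add: A_def algebra_simps)
  qed
  have rem: "f (chi (T - {b})) = A b * f (chi T)"
    if "2 \<le> b" "b < m" "T \<subseteq> {1..m}" "1 \<in> T" "m \<in> T" "b \<in> T" for b T
    using that
  proof (induction b arbitrary: T rule: dec_induct)
    case base
    then show ?case by (intro two)
  next
    case (step a)
    have a: "1 < a" "a < m" "Suc a < m" "a \<noteq> m" "a \<noteq> 1" using step.hyps step.prems by simp_all
    show ?case
    proof (cases "a \<in> T")
      case True
      show ?thesis
        by (rule stp[OF a(1,3) step.prems(2-5) True step.IH[OF a(2) step.prems(2-4) True]])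
    next
      case False
      \<comment> \<open>\<open>stp\<close> requires \<open>a\<close> in the cut set, so
        \<open>a\<close> is inserted and deleted again. Deleting it multiplies both sides of fact
        \<open>2\<close> by \<open>A a\<close>, which yields the claim for \<open>T\<close> without
        dividing by \<open>A a\<close>, a number that may be 0.\<close>
      let ?T = "insert a T"
      have T: "?T \<subseteq> {1..m}" "1 \<in> ?T" "m \<in> ?T" "Suc a \<in> ?T" "a \<in> ?T"
        using a step.prems by simp_all
      have T': "?T - {Suc a} \<subseteq> {1..m}" "1 \<in> ?T - {Suc a}" "m \<in> ?T - {Suc a}" "a \<in> ?T - {Suc a}"
        using T(1) a step.prems by (blast, simp_all)
      have 1: "f (chi (?T - {a})) = A a * f (chi ?T)"
        by (rule step.IH[OF a(2) T(1-3,5)])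
      have 2: "f (chi (?T - {Suc a})) = A (Suc a) * f (chi ?T)"
        by (rule stp[OF a(1,3) T 1])
      have 3: "f (chi (?T - {Suc a} - {a})) = A a * f (chi (?T - {Suc a}))"
        by (rule step.IH[OF a(2) T'])
      have "?T - {Suc a} - {a} = T - {Suc a}" "?T - {a} = T" using False by blast+
      then show ?thesis using 1 2 3 by (simp add: ac_simps)
    qed
  qed
  have "finite S" using S by (rule finite_subset) simp
  then show ?thesis using S
  proof (induction S rule: finite_induct)
    case (insert b S)
    have b: "2 \<le> b" "b < m" and S: "S \<subseteq> {2..<m}" using insert.prems by simp_all
    have "{1..m} - insert b S = {1..m} - S - {b}" by blast
    moreover have "f (chi ({1..m} - S - {b})) = A b * f (chi ({1..m} - S))"
    proof (rule rem[OF b])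
      show "1 \<in> {1..m} - S" "m \<in> {1..m} - S" using S m by auto
      show "b \<in> {1..m} - S" using b insert.hyps by simp
    qed blast
    ultimately show ?case using insert.IH[OF S] insert.hyps by (simp add: A_def mult.assoc)
  qed simp
qed

text \<open>No block of \<open>T\<close> reaches beyond \<open>p\<close>, so all derivatives in
  \<open>verma_lower\<close> vanish and the multiplication adds the block
  \<open>(n, p)\<close>.\<close>

lemma verma_lower_mono:
  assumes "1 \<le> p" "p < n" "n \<le> m" "T \<subseteq> {1..p}" "p \<in> T"
  shows "app (verma \<mu> m n p) (mono_vec (chi T)) = mono_vec (chi (insert n T))"
proof -
  have z: "chi T (l, k) = 0" if "n \<le> l" for l k
    using assms that by (auto simp: chi_def blk_def)
  have "blk (insert n T) (l, k) \<longleftrightarrow> blk T (l, k) \<or> (l, k) = (n, p)" for l k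
    using assms unfolding blk_def by (auto simp: subset_iff) (metis le_neq_implies_less not_le order.strict_trans1)+
  then have "chi (insert n T) = (chi T)((n, p) := chi T (n, p) + 1)"
    using z[of n p] by (auto simp: chi_def fun_eq_iff)
  moreover have "app (\<Sum>l\<in>{Suc n..m}. shiftX (l, p) * derX (l, n)) (mono_vec (chi T)) = 0"
    by (simp add: app_sum derX_mono_vec z)
  ultimately show ?thesis
    using assms by (simp add: verma_lower shiftX_mono_vec)
qed

section \<open>Hessenberg determinants\<close>

text \<open>\<open>ncdet\<close> for a type class ring, so that it can be expanded in the free
  algebra before passing to \<open>Ugl\<close>.\<close>

definition rdet :: "nat \<Rightarrow> (nat \<Rightarrow> nat \<Rightarrow> 'r::ring_1) \<Rightarrow> 'r" where
  "rdet n B = (\<Sum>w | w permutes {1..n}. of_int (sign w) * prod_list (map (\<lambda>k. B (w k) k) [1..<n + 1]))"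

lemma rdet_cong:
  assumes "\<And>i j. i \<in> {1..n} \<Longrightarrow> j \<in> {1..n} \<Longrightarrow> B i j = B' i j"
  shows "rdet n B = rdet n B'"
  unfolding rdet_def
proof (rule sum.cong[OF refl])
  fix w assume "w \<in> {w. w permutes {1..n}}"
  then have "w k \<in> {1..n}" if "k \<in> {1..n}" for k
    using permutes_in_image[of w "{1..n}" k] that by simp
  then have "map (\<lambda>k. B (w k) k) [1..<n + 1] = map (\<lambda>k. B' (w k) k) [1..<n + 1]"
    using assms by (intro map_cong) auto
  then show "of_int (sign w) * prod_list (map (\<lambda>k. B (w k) k) [1..<n + 1]) =
      of_int (sign w) * prod_list (map (\<lambda>k. B' (w k) k) [1..<n + 1])"
    by (simp only:)
qed

lemma rdet_1: "rdet 1 B = B 1 1"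
  by (simp add: rdet_def permutes_sing sign_id)

lemma prod_list_zero: "0 \<in> set xs \<Longrightarrow> prod_list xs = (0 :: 'r::ring_1)"
  by (induction xs) auto

text \<open>
  Row \<open>n + 1\<close> has nonzero entries in the columns \<open>n\<close> and \<open>n + 1\<close> only. If a permutation takes the
  entry in column \<open>n\<close>, that entry, being central, can be pulled out, and what remains is a
  determinant of size \<open>n\<close> whose last column is the old column \<open>n + 1\<close>.
\<close>

lemma rdet_hessenberg:
  fixes B :: "nat \<Rightarrow> nat \<Rightarrow> 'r::ring_1"
  assumes n: "1 \<le> n"
    and zero: "\<And>k. k \<in> {1..<n} \<Longrightarrow> B (Suc n) k = 0"
    and central: "\<And>x. x * B (Suc n) n = B (Suc n) n * x"
  shows "rdet (Suc n) B = rdet n B * B (Suc n) (Suc n)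
    - B (Suc n) n * rdet n (\<lambda>i j. if j = n then B i (Suc n) else B i j)"
proof -
  let ?a = "Suc n"
  define P where "P w = prod_list (map (\<lambda>k. B (w k) k) [1..<n + 1])" for w
  define t where "t w = of_int (sign w) * prod_list (map (\<lambda>k. B (w k) k) [1..<Suc n + 1])" for w
  have t: "t w = of_int (sign w) * (P w * B (w ?a) ?a)" for w
    by (simp add: t_def P_def)
  have [simp]: "finite {q. q permutes {1..n}}" by (simp add: finite_permutations)
  have "rdet (Suc n) B = sum t {w. w permutes insert ?a {1..n}}"
    unfolding rdet_def t_def using atLeastAtMostSuc_conv[of 1 n] by simp
  \<comment> \<open>Here \<open>b\<close> is the row met by column \<open>n + 1\<close>; the summand
    \<open>b = n + 1\<close> is the first term of the claim.\<close>
  also have "\<dots> = (\<Sum>b\<in>insert ?a {1..n}. \<Sum>q | q permutes {1..n}. t (transpose ?a b \<circ> q))"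
    by (rule sum_over_permutations_insert) simp_all
  also have "\<dots> = (\<Sum>q | q permutes {1..n}. t q) + (\<Sum>b\<in>{1..n}. \<Sum>q | q permutes {1..n}. t (transpose ?a b \<circ> q))"
    by simp
  also have "(\<Sum>b\<in>{1..n}. \<Sum>q | q permutes {1..n}. t (transpose ?a b \<circ> q)) = (\<Sum>q | q permutes {1..n}. \<Sum>b\<in>{1..n}. t (transpose ?a b \<circ> q))"
    by (rule sum.swap)
  also have "(\<Sum>q | q permutes {1..n}. t q) = rdet n B * B ?a ?a"
    unfolding rdet_def sum_distrib_right
  proof (rule sum.cong[OF refl])
    fix q assume "q \<in> {q. q permutes {1..n}}"
    then have "q ?a = ?a" by (auto intro: permutes_not_in)
    then show "t q = of_int (sign q) * prod_list (map (\<lambda>k. B (q k) k) [1..<n + 1]) * B ?a ?a"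
      by (simp add: t P_def mult.assoc)
  qed
  also have "(\<Sum>q | q permutes {1..n}. \<Sum>b\<in>{1..n}. t (transpose ?a b \<circ> q))
    = - (B ?a n * rdet n (\<lambda>i j. if j = n then B i ?a else B i j))"
    unfolding rdet_def sum_distrib_left sum_negf[symmetric]
  proof (rule sum.cong[OF refl])
    fix q assume "q \<in> {q. q permutes {1..n}}"
    then have q: "q permutes {1..n}" by simp
    have qa: "q ?a = ?a" by (rule permutes_not_in[OF q]) simp
    have qk: "q k \<in> {1..n}" if "k \<in> {1..n}" for k
      using permutes_in_image[OF q] that by blast
    have inj: "q j = q k \<longleftrightarrow> j = k" for j k using permutes_inj[OF q] by (simp add: inj_eq)
    have perm: "permutation q" using q by (auto simp: permutation_permutes)
    have t0: "t (transpose ?a b \<circ> q) = 0" if b: "b \<in> {1..n}" "b \<noteq> q n" for b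
    proof -
      \<comment> \<open>Row \<open>n + 1\<close> is now met in the column \<open>k\<close> with
        \<open>q k = b\<close>. It lies to the left of column \<open>n\<close>, where that row is
        zero.\<close>
      obtain k where k: "k \<in> {1..n}" "q k = b"
        using permutes_image[OF q] b(1) by (metis imageE)
      then have "k \<in> {1..<n}" using b(2) by (cases "k = n") auto
      then have "B ((transpose ?a b \<circ> q) k) k = 0" using k zero[of k] by simp
      then have "P (transpose ?a b \<circ> q) = 0"
        unfolding P_def set_map using k(1)
        by (intro prod_list_zero) (auto simp del: upt_Suc intro!: image_eqI[of _ _ k])
      then show ?thesis by (simp add: t)
    qed
    have "(\<Sum>b\<in>{1..n}. t (transpose ?a b \<circ> q)) = (\<Sum>b\<in>{1..n}. if b = q n then t (transpose ?a (q n) \<circ> q) else 0)"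
      using t0 by (intro sum.cong) auto
    also have "\<dots> = t (transpose ?a (q n) \<circ> q)"
      using qk[of n] n by simp
    also have "\<dots> = - (B ?a n * (of_int (sign q) * prod_list (map (\<lambda>k. if k = n then B (q k) ?a else B (q k) k) [1..<n + 1])))"
    proof -
      have "?a \<noteq> q n" using qk[of n] n by auto
      then have s: "sign (transpose ?a (q n) \<circ> q) = - sign q"
        by (simp add: sign_compose[OF permutation_swap_id perm] sign_swap_id)
      have n': "[1..<n + 1] = [1..<n] @ [n]" using n by (simp add: upt_Suc_append)
      have m: "map (\<lambda>k. B ((transpose ?a (q n) \<circ> q) k) k) [1..<n] = map (\<lambda>k. B (q k) k) [1..<n]"
      proof (rule map_cong[OF refl])
        fix k assume "k \<in> set [1..<n]"
        then have "q k \<noteq> ?a" "q k \<noteq> q n" using qk[of k] inj[of k n] by auto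
        then show "B ((transpose ?a (q n) \<circ> q) k) k = B (q k) k" by simp
      qed
      have m': "map (\<lambda>k. if k = n then B (q k) ?a else B (q k) k) [1..<n] = map (\<lambda>k. B (q k) k) [1..<n]"
        by (rule map_cong[OF refl]) simp
      have P: "P (transpose ?a (q n) \<circ> q) = prod_list (map (\<lambda>k. B (q k) k) [1..<n]) * B ?a n"
        unfolding P_def n' map_append m by simp
      show ?thesis
        unfolding t s P n' map_append m'
        using qa by (simp add: central mult.assoc) (simp add: central flip: mult.assoc)
    qed
    finally show "(\<Sum>b\<in>{1..n}. t (transpose ?a b \<circ> q)) =
      - (B ?a n * (of_int (sign q) * prod_list (map (\<lambda>k. if k = n then B (q k) ?a else B (q k) k) [1..<n + 1])))" .
  qed
  finally show ?thesis by simp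
qed

section \<open>Expansion of the determinant of \<open>D\<close> in the free algebra\<close>

definition gen :: "nat \<Rightarrow> nat \<Rightarrow> gl_free" where
  "gen i j = Poly_Mapping.single [(i, j)] 1"

definition cst :: "complex \<Rightarrow> gl_free" where
  "cst c = Poly_Mapping.single [] c"

lemma poly_mapping_sum_single:
  fixes p :: "'a \<Rightarrow>\<^sub>0 'b::comm_monoid_add"
  assumes "finite A" "Poly_Mapping.keys p \<subseteq> A"
  shows "p = (\<Sum>w\<in>A. Poly_Mapping.single w (Poly_Mapping.lookup p w))"
proof (rule poly_mapping_eqI)
  fix k
  show "Poly_Mapping.lookup p k = Poly_Mapping.lookup (\<Sum>w\<in>A. Poly_Mapping.single w (Poly_Mapping.lookup p w)) k"
    using assms by (auto simp: lookup_sum lookup_single when_def in_keys_iff)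
qed

lemma cst_simps: "cst 0 = 0" "cst 1 = 1" "cst (a + b) = cst a + cst b" "cst (a * b) = cst a * cst b"
   "cst (- a) = - cst a" "cst (a - b) = cst a - cst b"
proof -
  have "0 + 0 = (0 :: (nat \<times> nat) list)" by (rule add_0)
  then show "cst 0 = 0" "cst 1 = 1" "cst (a + b) = cst a + cst b" "cst (a * b) = cst a * cst b"
    "cst (- a) = - cst a" "cst (a - b) = cst a - cst b"
    unfolding cst_def zero_list_def[symmetric]
    by (simp_all add: single_add mult_single single_uminus single_diff)
qed

lemma cst_central: "cst c * p = p * cst c"
proof -
  have "p = (\<Sum>w\<in>Poly_Mapping.keys p. Poly_Mapping.single w (Poly_Mapping.lookup p w))"
    by (rule poly_mapping_sum_single) auto
  moreover have "cst c * (\<Sum>w\<in>A. Poly_Mapping.single w (f w)) = (\<Sum>w\<in>A. Poly_Mapping.single w (f w)) * cst c"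
    for A and f :: "(nat \<times> nat) list \<Rightarrow> complex"
    unfolding sum_distrib_left sum_distrib_right cst_def
    by (simp add: mult_single plus_list_def mult.commute)
  ultimately show ?thesis by metis
qed

section \<open>Products of root vectors along descending paths\<close>

fun epath :: "nat list \<Rightarrow> gl_free" where
  "epath (x # y # zs) = gen x y * epath (y # zs)"
| "epath zs = 1"

lemma epath_snoc: "epath (zs @ [y, x]) = epath (zs @ [y]) * gen y x"
proof (induction zs)
  case (Cons a zs)
  then show ?case by (cases zs) (simp_all add: mult.assoc)
qed simp

text \<open>The \<open>E\<^sub>T\<close> of the overview; its factors start from the largest cut
  point.\<close>

definition eprod :: "nat set \<Rightarrow> gl_free" where
  "eprod T = epath (rev (sorted_list_of_set T))"

lemma sorted_list_of_set_insert_top: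
  assumes "finite T" "\<And>x. x \<in> T \<Longrightarrow> x < n"
  shows "sorted_list_of_set (insert n T) = sorted_list_of_set T @ [n]"
proof -
  have "n \<notin> T" using assms(2) by blast
  then show ?thesis
    using assms by (simp add: sorted_insort_is_snoc less_imp_le)
qed

lemma sorted_list_of_set_insert_bot:
  assumes "finite T" "\<And>x. x \<in> T \<Longrightarrow> n < x"
  shows "sorted_list_of_set (insert n T) = n # sorted_list_of_set T"
proof -
  have "n \<notin> T" using assms(2) by blast
  then show ?thesis
    using assms by (simp add: insort_is_Cons less_imp_le)
qed

lemma eprod_singleton: "eprod {x} = 1"
  by (simp add: eprod_def)

lemma eprod_insert_top:
  assumes "T \<subseteq> {1..p}" "p \<in> T" "p < n"
  shows "eprod (insert n T) = gen n p * eprod T"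
proof -
  have f: "finite T" using assms(1) by (rule finite_subset) simp
  have "sorted_list_of_set (insert n T) = sorted_list_of_set T @ [n]"
    using assms f by (intro sorted_list_of_set_insert_top) auto
  moreover have "sorted_list_of_set (insert p (T - {p})) = sorted_list_of_set (T - {p}) @ [p]"
    using assms f by (intro sorted_list_of_set_insert_top) force+
  moreover have "insert p (T - {p}) = T" using assms(2) by blast
  ultimately show ?thesis by (simp add: eprod_def)
qed

text \<open>The determinant grows by right factors, at the small end of a cut set. The reduction of
  words and the action on 1 grow by left factors and use \<open>eprod_insert_top\<close>.\<close>

lemma eprod_insert_bot:
  assumes "finite T" "\<And>x. x \<in> T \<Longrightarrow> p \<le> x" "p \<in> T" "q < p"
  shows "eprod (insert q T) = eprod T * gen p q"
proof -
  have "sorted_list_of_set (insert q T) = q # sorted_list_of_set T"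
    using assms by (intro sorted_list_of_set_insert_bot) (auto intro: less_le_trans)
  moreover have "sorted_list_of_set (insert p (T - {p})) = p # sorted_list_of_set (T - {p})"
    using assms(1,2) by (intro sorted_list_of_set_insert_bot) (auto simp: order_less_le)
  moreover have "insert p (T - {p}) = T" using assms(3) by blast
  ultimately show ?thesis using epath_snoc[of "rev (sorted_list_of_set (T - {p}))" p q]
    by (simp add: eprod_def)
qed

text \<open>A lift of \<open>D_matrix\<close> to the free algebra. The numbers \<open>a\<close> stay
  arbitrary, since the expansion relies only on constants being central.\<close>

definition D_free :: "nat \<Rightarrow> (nat \<Rightarrow> complex) \<Rightarrow> nat \<Rightarrow> nat \<Rightarrow> gl_free" where
  "D_free m a i j = (if i \<le> j then gen (m + 1 - i) (m - j)
     else if i = j + 1 then cst (- a (m - 1 - j)) else 0)"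

text \<open>
  With \<open>p = m + 1 - n\<close>, the first \<open>n\<close> rows, with last column made of the \<open>e\<^bsub>i,q\<^esub>\<close>, describe the
  cut sets from \<open>q\<close> to \<open>m\<close> without elements strictly between \<open>q\<close> and \<open>p\<close>; the index \<open>S\<close> is the set of
  elements that are not cut points.
\<close>

lemma rdet_D_partial:
  assumes "1 \<le> n" "n < m" "q < m + 1 - n"
  shows "rdet n (\<lambda>i j. if j = n then gen (m + 1 - i) q else D_free m a i j)
    = (\<Sum>S\<in>Pow {m + 1 - n..<m}. cst (\<Prod>b\<in>S. a (b - 1)) * eprod (insert q ({m + 1 - n..m} - S)))"
  using assms
proof (induction n arbitrary: q rule: dec_induct)
  case base
  have "eprod (insert q {m}) = gen m q"
    using base eprod_insert_bot[of "{m}" m q] by (simp add: eprod_singleton)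
  then show ?case by (simp add: rdet_1[simplified] cst_simps)
next
  case (step n)
  define p where "p = m - n"
  have p: "m + 1 - Suc n = p" "m + 1 - n = Suc p" "q < p" "p < m" "m - Suc n = p - 1"
    using step by (auto simp: p_def)
  let ?B = "\<lambda>q i j. if j = Suc n then gen (m + 1 - i) q else D_free m a i j"
  let ?G = "\<lambda>q. rdet n (\<lambda>i j. if j = n then gen (m + 1 - i) q else D_free m a i j)"
  let ?F = "\<lambda>q S. cst (\<Prod>b\<in>S. a (b - 1)) * eprod (insert q ({Suc p..m} - S))"
  have G: "?G r = (\<Sum>S\<in>Pow {Suc p..<m}. ?F r S)" if "r \<le> p" for r
    using step.IH[of r] step.prems step.hyps that unfolding p(2) by simp
  have "rdet (Suc n) (?B q) = rdet n (?B q) * ?B q (Suc n) (Suc n)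
     - ?B q (Suc n) n * rdet n (\<lambda>i j. if j = n then ?B q i (Suc n) else ?B q i j)"
    using step.hyps by (intro rdet_hessenberg) (auto simp: D_free_def cst_central)
  \<comment> \<open>The first \<open>n\<close> rows of column \<open>n\<close> hold the
    \<open>e_{i,p}\<close>, so this is the induction hypothesis with \<open>p\<close> in place of
    \<open>q\<close>.\<close>
  also have "rdet n (?B q) = ?G p"
    by (rule rdet_cong) (auto simp: D_free_def p_def)
  also have "rdet n (\<lambda>i j. if j = n then ?B q i (Suc n) else ?B q i j) = ?G q"
    by (rule rdet_cong) auto
  also have "?B q (Suc n) n = - cst (a (p - 1))"
    using p(5) by (simp add: D_free_def cst_simps)
  also have "?B q (Suc n) (Suc n) = gen p q"
    using p(1) by simp
  \<comment> \<open>The sign of the subdiagonal entry cancels the sign of the expansion. In the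
    first summand \<open>p\<close> is a cut point, in the second it is skipped at the price
    \<open>a (p - 1)\<close>.\<close>
  finally have eq: "rdet (Suc n) (?B q) = ?G p * gen p q + cst (a (p - 1)) * ?G q"
    by simp
  have I: "{p..<m} = insert p {Suc p..<m}" "{p..m} = insert p {Suc p..m}" using p by auto
  have "?G p * gen p q = (\<Sum>S\<in>Pow {Suc p..<m}. cst (\<Prod>b\<in>S. a (b - 1)) * eprod (insert q ({p..m} - S)))"
    unfolding G[OF order_refl] sum_distrib_right
  proof (rule sum.cong[OF refl])
    fix S assume "S \<in> Pow {Suc p..<m}"
    then have "p \<notin> S" by auto
    then have "{p..m} - S = insert p ({Suc p..m} - S)" using I(2) by auto
    moreover have "eprod (insert q (insert p ({Suc p..m} - S))) = eprod (insert p ({Suc p..m} - S)) * gen p q"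
      using p by (intro eprod_insert_bot) auto
    ultimately show "?F p S * gen p q = cst (\<Prod>b\<in>S. a (b - 1)) * eprod (insert q ({p..m} - S))"
      by (simp add: mult.assoc)
  qed
  moreover have "cst (a (p - 1)) * ?G q =
     (\<Sum>S\<in>insert p ` Pow {Suc p..<m}. cst (\<Prod>b\<in>S. a (b - 1)) * eprod (insert q ({p..m} - S)))"
  proof -
    have inj: "inj_on (insert p) (Pow {Suc p..<m})"
    proof (rule inj_onI)
      fix S S' assume "S \<in> Pow {Suc p..<m}" "S' \<in> Pow {Suc p..<m}" "insert p S = insert p S'"
      moreover from this have "p \<notin> S" "p \<notin> S'" by auto
      ultimately show "S = S'" by (simp add: insert_ident)
    qed
    have "cst (a (p - 1)) * ?F q S =
        cst (\<Prod>b\<in>insert p S. a (b - 1)) * eprod (insert q ({p..m} - insert p S))"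
      if "S \<in> Pow {Suc p..<m}" for S
    proof -
      have "p \<notin> S" "finite S" using that by (auto intro: finite_subset)
      moreover have "{p..m} - insert p S = {Suc p..m} - S" using I(2) by auto
      ultimately show ?thesis by (simp add: cst_simps mult.assoc)
    qed
    then show ?thesis
      unfolding G[OF less_imp_le[OF p(3)]] sum_distrib_left sum.reindex[OF inj] o_def
      by (rule sum.cong[OF refl])
  qed
  ultimately have "rdet (Suc n) (?B q) = (\<Sum>S\<in>Pow {Suc p..<m} \<union> insert p ` Pow {Suc p..<m}.
      cst (\<Prod>b\<in>S. a (b - 1)) * eprod (insert q ({p..m} - S)))"
    unfolding eq by (subst sum.union_disjoint) auto
  then show ?case unfolding p(1) I(1) Pow_insert by simp
qed

lemma rdet_D_free:
  assumes "2 \<le> m"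
  shows "rdet (m - 1) (D_free m a) = (\<Sum>S\<in>Pow {2..<m}. cst (\<Prod>b\<in>S. a (b - 1)) * eprod ({1..m} - S))"
proof -
  have "rdet (m - 1) (D_free m a)
      = rdet (m - 1) (\<lambda>i j. if j = m - 1 then gen (m + 1 - i) 1 else D_free m a i j)"
    using assms by (intro rdet_cong) (auto simp: D_free_def)
  also have "\<dots> = (\<Sum>S\<in>Pow {2..<m}. cst (\<Prod>b\<in>S. a (b - 1)) * eprod (insert 1 ({2..m} - S)))"
    using assms by (subst rdet_D_partial) (auto simp: numeral_2_eq_2)
  also have "\<dots> = (\<Sum>S\<in>Pow {2..<m}. cst (\<Prod>b\<in>S. a (b - 1)) * eprod ({1..m} - S))"
  proof (rule sum.cong[OF refl])
    fix S assume "S \<in> Pow {2..<m}"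
    then have "1 \<notin> S" by auto
    moreover have "{1..m} = insert 1 {2..m}" using assms by auto
    ultimately have "insert 1 ({2..m} - S) = {1..m} - S" by auto
    then show "cst (\<Prod>b\<in>S. a (b - 1)) * eprod (insert 1 ({2..m} - S))
      = cst (\<Prod>b\<in>S. a (b - 1)) * eprod ({1..m} - S)" by simp
  qed
  finally show ?thesis .
qed

section \<open>Calculation in the enveloping algebra\<close>

lemma tensor_alg_simps:
  "mult (tensor_alg m) = (*)" "one (tensor_alg m) = 1" "zero (tensor_alg m) = 0" "add (tensor_alg m) = (+)"
  by (simp_all add: tensor_alg_def)

lemma carrier_tensor_alg_iff:
  "p \<in> carrier (tensor_alg m) \<longleftrightarrow> (\<forall>w\<in>Poly_Mapping.keys p. set w \<subseteq> {1..m} \<times> {1..m})"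
  by (simp add: tensor_alg_def)

lemma tensor_alg_closed:
  shows "0 \<in> carrier (tensor_alg m)" "1 \<in> carrier (tensor_alg m)" "cst c \<in> carrier (tensor_alg m)"
    and "p \<in> carrier (tensor_alg m) \<Longrightarrow> q \<in> carrier (tensor_alg m) \<Longrightarrow> p + q \<in> carrier (tensor_alg m)"
    and "p \<in> carrier (tensor_alg m) \<Longrightarrow> q \<in> carrier (tensor_alg m) \<Longrightarrow> p * q \<in> carrier (tensor_alg m)"
    and "p \<in> carrier (tensor_alg m) \<Longrightarrow> q \<in> carrier (tensor_alg m) \<Longrightarrow> p - q \<in> carrier (tensor_alg m)"
    and "p \<in> carrier (tensor_alg m) \<Longrightarrow> - p \<in> carrier (tensor_alg m)"
proof -
  interpret ring "tensor_alg m" by (rule ring_tensor_alg)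
  show "0 \<in> carrier (tensor_alg m)" "1 \<in> carrier (tensor_alg m)"
    using zero_closed one_closed by (simp_all add: tensor_alg_simps)
  show "cst c \<in> carrier (tensor_alg m)"
    by (simp add: carrier_tensor_alg_iff cst_def)
  show "p + q \<in> carrier (tensor_alg m)" "p * q \<in> carrier (tensor_alg m)" "p - q \<in> carrier (tensor_alg m)"
    if "p \<in> carrier (tensor_alg m)" "q \<in> carrier (tensor_alg m)"
    using add.m_closed[OF that] m_closed[OF that] minus_closed[OF that] minus_tensor_alg[OF that]
    by (simp_all add: tensor_alg_simps)
  show "- p \<in> carrier (tensor_alg m)" if "p \<in> carrier (tensor_alg m)"
    using that by (simp add: carrier_tensor_alg_iff)
qed

lemma gen_closed: "i \<in> {1..m} \<Longrightarrow> j \<in> {1..m} \<Longrightarrow> gen i j \<in> carrier (tensor_alg m)"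
  by (simp add: carrier_tensor_alg_iff gen_def)

lemma sum_closed: "(\<And>i. i \<in> A \<Longrightarrow> f i \<in> carrier (tensor_alg m)) \<Longrightarrow> sum f A \<in> carrier (tensor_alg m)"
  by (induction A rule: infinite_finite_induct) (auto intro: tensor_alg_closed)

lemma prod_list_closed: "(\<And>x. x \<in> set xs \<Longrightarrow> x \<in> carrier (tensor_alg m)) \<Longrightarrow> prod_list xs \<in> carrier (tensor_alg m)"
  by (induction xs) (auto intro: tensor_alg_closed)

lemma power_closed: "x \<in> carrier (tensor_alg m) \<Longrightarrow> x ^ k \<in> carrier (tensor_alg m)"
  by (induction k) (auto intro: tensor_alg_closed)

lemma of_int_closed: "of_int k \<in> carrier (tensor_alg m)"
proof -
  have "of_nat n \<in> carrier (tensor_alg m)" for n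
    by (induction n) (auto intro: tensor_alg_closed)
  then show ?thesis by (cases k rule: int_cases2) (auto intro: tensor_alg_closed)
qed

lemma U_class_hom:
  shows "U_class m 0 = \<zero>\<^bsub>Ugl m\<^esub>" "U_class m 1 = \<one>\<^bsub>Ugl m\<^esub>"
    and "p \<in> carrier (tensor_alg m) \<Longrightarrow> U_class m p \<in> carrier (Ugl m)"
    and "p \<in> carrier (tensor_alg m) \<Longrightarrow> q \<in> carrier (tensor_alg m) \<Longrightarrow>
      U_class m (p + q) = U_class m p \<oplus>\<^bsub>Ugl m\<^esub> U_class m q"
    and "p \<in> carrier (tensor_alg m) \<Longrightarrow> q \<in> carrier (tensor_alg m) \<Longrightarrow>
      U_class m (p * q) = U_class m p \<otimes>\<^bsub>Ugl m\<^esub> U_class m q"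
    and "p \<in> carrier (tensor_alg m) \<Longrightarrow> U_class m (- p) = \<ominus>\<^bsub>Ugl m\<^esub> U_class m p"
proof -
  interpret h: ring_hom_ring "tensor_alg m" "Ugl m" "U_class m"
    by (rule ring_hom_ringI2[OF ring_tensor_alg ring_Ugl U_class_ring_hom])
  show "U_class m 0 = \<zero>\<^bsub>Ugl m\<^esub>" "U_class m 1 = \<one>\<^bsub>Ugl m\<^esub>"
    using h.hom_zero h.hom_one by (simp_all add: tensor_alg_simps)
  show "U_class m p \<in> carrier (Ugl m)" if "p \<in> carrier (tensor_alg m)"
    using h.hom_closed[OF that] .
  show add: "U_class m (p + q) = U_class m p \<oplus>\<^bsub>Ugl m\<^esub> U_class m q"
    if "p \<in> carrier (tensor_alg m)" "q \<in> carrier (tensor_alg m)" for p q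
    using h.hom_add[OF that] by (simp add: tensor_alg_simps)
  show "U_class m (p * q) = U_class m p \<otimes>\<^bsub>Ugl m\<^esub> U_class m q"
    if "p \<in> carrier (tensor_alg m)" "q \<in> carrier (tensor_alg m)"
    using h.hom_mult[OF that] by (simp add: tensor_alg_simps)
  show "U_class m (- p) = \<ominus>\<^bsub>Ugl m\<^esub> U_class m p" if p: "p \<in> carrier (tensor_alg m)"
  proof -
    have mp: "- p \<in> carrier (tensor_alg m)" using p by (rule tensor_alg_closed)
    have "U_class m (- p) \<oplus>\<^bsub>Ugl m\<^esub> U_class m p = \<zero>\<^bsub>Ugl m\<^esub>"
      using add[OF mp p] \<open>U_class m 0 = _\<close> by simp
    then show ?thesis
      using h.hom_closed[OF p] h.hom_closed[OF mp] by (metis h.S.minus_equality h.S.a_comm)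
  qed
qed

lemma U_class_sum:
  assumes "finite A" "\<And>i. i \<in> A \<Longrightarrow> f i \<in> carrier (tensor_alg m)"
  shows "U_class m (sum f A) = (\<Oplus>\<^bsub>Ugl m\<^esub>i\<in>A. U_class m (f i))"
  using assms
proof (induction A rule: finite_induct)
  case empty
  interpret ring "Ugl m" by (rule ring_Ugl)
  show ?case by (simp add: U_class_hom)
next
  case (insert x F)
  interpret ring "Ugl m" by (rule ring_Ugl)
  show ?case using insert by (simp add: U_class_hom sum_closed Pi_def)
qed

lemma U_class_prod_list:
  "(\<And>x. x \<in> set xs \<Longrightarrow> x \<in> carrier (tensor_alg m)) \<Longrightarrow>
   U_class m (prod_list xs) = ncprod (Ugl m) (map (U_class m) xs)"
  by (induction xs) (simp_all add: ncprod_def U_class_hom prod_list_closed)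

lemma U_class_power:
  assumes "x \<in> carrier (tensor_alg m)"
  shows "U_class m (x ^ k) = U_class m x [^]\<^bsub>Ugl m\<^esub> k"
proof -
  interpret ring "Ugl m" by (rule ring_Ugl)
  show ?thesis
    using assms by (induction k) (simp_all add: U_class_hom power_closed power_Suc2 del: power_Suc)
qed

lemma lie_ideal_closed:
  shows "x \<in> lie_ideal m \<Longrightarrow> x \<in> carrier (tensor_alg m)"
    and "0 \<in> lie_ideal m"
    and "x \<in> lie_ideal m \<Longrightarrow> y \<in> lie_ideal m \<Longrightarrow> x + y \<in> lie_ideal m"
    and "x \<in> lie_ideal m \<Longrightarrow> p \<in> carrier (tensor_alg m) \<Longrightarrow> p * x \<in> lie_ideal m"
    and "x \<in> lie_ideal m \<Longrightarrow> p \<in> carrier (tensor_alg m) \<Longrightarrow> x * p \<in> lie_ideal m"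
proof -
  interpret ideal "lie_ideal m" "tensor_alg m" by (rule ideal_lie_ideal)
  show "x \<in> lie_ideal m \<Longrightarrow> x \<in> carrier (tensor_alg m)" by (rule Icarr)
  show "0 \<in> lie_ideal m" using additive_subgroup.zero_closed[OF is_additive_subgroup] by (simp add: tensor_alg_simps)
  show "x \<in> lie_ideal m \<Longrightarrow> y \<in> lie_ideal m \<Longrightarrow> x + y \<in> lie_ideal m"
    using additive_subgroup.a_closed[OF is_additive_subgroup, of x y] by (simp add: tensor_alg_simps)
  show "x \<in> lie_ideal m \<Longrightarrow> p \<in> carrier (tensor_alg m) \<Longrightarrow> p * x \<in> lie_ideal m"
    using I_l_closed[of x p] by (simp add: tensor_alg_simps)
  show "x \<in> lie_ideal m \<Longrightarrow> p \<in> carrier (tensor_alg m) \<Longrightarrow> x * p \<in> lie_ideal m"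
    using I_r_closed[of x p] by (simp add: tensor_alg_simps)
qed

lemma U_class_eq_iff:
  assumes "p \<in> carrier (tensor_alg m)" "q \<in> carrier (tensor_alg m)"
  shows "U_class m p = U_class m q \<longleftrightarrow> p - q \<in> lie_ideal m"
  unfolding U_class_def
  using ring.quotient_eq_iff_same_a_r_cos[OF ring_tensor_alg ideal_lie_ideal assms]
  by (simp add: minus_tensor_alg[OF assms])

lemma carrier_Ugl_cases:
  assumes "X \<in> carrier (Ugl m)"
  obtains p where "p \<in> carrier (tensor_alg m)" "X = U_class m p"
  using assms unfolding Ugl_def FactRing_def A_RCOSETS_def' U_class_def by auto

lemma gl_emb_unit:
  assumes "i \<in> {1..m}" "j \<in> {1..m}"
  shows "gl_emb m (\<lambda>k l. if k = i \<and> l = j then 1 else 0) = gen i j"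
proof -
  have "gl_emb m (\<lambda>k l. if k = i \<and> l = j then 1 else 0)
    = (\<Sum>k\<in>{1..m}. \<Sum>l\<in>{1..m}. if l = j then (if k = i then gen i j else 0) else 0)"
    unfolding gl_emb_def by (intro sum.cong refl) (simp add: gen_def)
  then show ?thesis using assms by simp
qed

lemma U_unit_eq: "i \<in> {1..m} \<Longrightarrow> j \<in> {1..m} \<Longrightarrow> U_unit m i j = U_class m (gen i j)"
  by (simp add: U_unit_def U_emb_def gl_emb_unit)

lemma U_scalar_eq: "U_scalar m c = U_class m (cst c)"
  by (simp add: U_scalar_def cst_def)

lemma gen_relation:
  assumes "i \<in> {1..m}" "j \<in> {1..m}" "k \<in> {1..m}" "l \<in> {1..m}"
  shows "gen i j * gen k l - gen k l * gen i j
    - ((if j = k then gen i l else 0) - (if i = l then gen k j else 0)) \<in> lie_ideal m"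
proof -
  let ?u = "\<lambda>i j r s. if r = i \<and> s = j then 1 else (0 :: complex)"
  have br: "gl_emb m (gl_bracket m (?u i j) (?u k l))
      = (if j = k then gl_emb m (?u i l) else 0) - (if i = l then gl_emb m (?u k j) else 0)"
  proof -
    have prod: "(\<Sum>t\<in>{1..m}. ?u i j r t * ?u k l t s) = (if j = k then ?u i l r s else 0)"
      if "j \<in> {1..m}" for i j k l r s
    proof -
      have "(\<Sum>t\<in>{1..m}. ?u i j r t * ?u k l t s) = (\<Sum>t\<in>{1..m}. if t = j then (if j = k then ?u i l r s else 0) else 0)"
        by (rule sum.cong) auto
      then show ?thesis using that by simp
    qed
    have "gl_bracket m (?u i j) (?u k l) = (\<lambda>r s. (if j = k then ?u i l r s else 0) - (if i = l then ?u k j r s else 0))"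
      unfolding gl_bracket_def prod[OF assms(2)] prod[OF assms(4)] by (intro ext) auto
    moreover have "gl_emb m (\<lambda>r s. x r s - y r s) = gl_emb m x - gl_emb m y" for x y
      by (simp add: gl_emb_def single_diff sum_subtractf)
    moreover have "gl_emb m (\<lambda>r s. if b then x r s else 0) = (if b then gl_emb m x else 0)" for b x
      by (simp add: gl_emb_def)
    ultimately show ?thesis by simp
  qed
  have "gl_emb m (?u i j) * gl_emb m (?u k l) - gl_emb m (?u k l) * gl_emb m (?u i j)
      - gl_emb m (gl_bracket m (?u i j) (?u k l)) \<in> lie_ideal m"
    unfolding lie_ideal_def
    by (rule subsetD[OF ring.genideal_self[OF ring_tensor_alg]]) (auto intro: lie_relator_closed)
  then show ?thesis
    unfolding br gl_emb_unit[OF assms(1,2)] gl_emb_unit[OF assms(3,4)]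
      gl_emb_unit[OF assms(1,4)] gl_emb_unit[OF assms(3,2)] .
qed

text \<open>
  \<open>red m n x c\<close>: modulo the Lie relators, \<open>x\<close> is a combination of the \<open>eprod T\<close> with \<open>T\<close> running from
  \<open>1\<close> to \<open>n\<close>, and \<open>c\<close> is the coefficient at the finest \<open>T\<close>. (That \<open>c\<close> is determined by \<open>x\<close> is only
  known once the \<open>eprod T\<close> have been separated by the Verma module.)
\<close>

inductive red :: "nat \<Rightarrow> nat \<Rightarrow> gl_free \<Rightarrow> complex \<Rightarrow> bool" for m n where
  red_eprod: "T \<subseteq> {1..n} \<Longrightarrow> 1 \<in> T \<Longrightarrow> n \<in> T \<Longrightarrow> red m n (eprod T) (if T = {1..n} then 1 else 0)"
| red_ideal: "x \<in> lie_ideal m \<Longrightarrow> red m n x 0"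
| red_add: "red m n x c \<Longrightarrow> red m n y d \<Longrightarrow> red m n (x + y) (c + d)"
| red_cst: "red m n x c \<Longrightarrow> red m n (cst s * x) (s * c)"

text \<open>The new factor puts the cut point \<open>n\<close> above \<open>p\<close> and skips
  everything in between, so the finest cut set can only arise for \<open>n = Suc p\<close>.\<close>

lemma red_left:
  assumes "red m p x c" "1 \<le> p" "p < n" "n \<le> m"
  shows "red m n (gen n p * x) (if n = Suc p then c else 0)"
  using assms(1)
proof induction
  case (red_eprod T)
  have "red m n (eprod (insert n T)) (if insert n T = {1..n} then 1 else 0)"
    using red_eprod assms by (intro red.red_eprod) auto
  moreover have "insert n T = {1..n} \<longleftrightarrow> n = Suc p \<and> T = {1..p}"
  proof
    assume eq: "insert n T = {1..n}"
    have "n - 1 \<in> insert n T" unfolding eq using assms by simp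
    then have "n - 1 \<in> T" using assms by auto
    then have "n - 1 \<le> p" using red_eprod(1) by auto
    then have np: "n = Suc p" using assms by simp
    have "n \<notin> T" using red_eprod(1) assms by auto
    then have "T = {1..n} - {n}" using eq by auto
    then show "n = Suc p \<and> T = {1..p}" using np by auto
  next
    assume "n = Suc p \<and> T = {1..p}"
    then show "insert n T = {1..n}" using assms by auto
  qed
  moreover have "eprod (insert n T) = gen n p * eprod T"
    using red_eprod assms by (intro eprod_insert_top) auto
  moreover have "(if n = Suc p then if T = {1..p} then 1 else 0 else 0)
      = (if n = Suc p \<and> T = {1..p} then 1 else (0::complex))" by simp
  ultimately show ?case by (simp only:)
next
  case (red_ideal x)
  then show ?case using assms by (simp add: red.red_ideal lie_ideal_closed gen_closed)
next
  case (red_add x c y d)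
  from red.red_add[OF red_add.IH] show ?case by (simp add: distrib_left split: if_splits)
next
  case (red_cst x c s)
  have "gen n p * (cst s * x) = cst s * (gen n p * x)"
    by (metis cst_central mult.assoc)
  with red.red_cst[OF red_cst.IH, of s] show ?case by (simp split: if_splits)
qed

section \<open>Words of negative root vectors and their reduction\<close>

definition word :: "(nat \<times> nat) list \<Rightarrow> gl_free" where
  "word l = prod_list (map (\<lambda>\<alpha>. gen (snd \<alpha>) (fst \<alpha>)) l)"

lemma word_simps: "word [] = 1" "word (\<alpha> # l) = gen (snd \<alpha>) (fst \<alpha>) * word l"
  "word (l @ l') = word l * word l'"
  by (simp_all add: word_def)

lemma word_closed: "set l \<subseteq> pos_roots m \<Longrightarrow> word l \<in> carrier (tensor_alg m)"
  unfolding word_def by (rule prod_list_closed) (auto simp: pos_roots_def intro!: gen_closed)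

lemma length_filter_Cons:
  "length (filter P (x # xs)) = (if P x then 1 else 0) + length (filter P xs)"
  by simp

text \<open>
  The balance of first and second indices expresses that the roots in the word add up to
  \<open>\<epsilon>\<^sub>1 - \<epsilon>\<^sub>n\<close>, without subtraction.
\<close>

definition is_path_word :: "nat \<Rightarrow> (nat \<times> nat) list \<Rightarrow> bool" where
  "is_path_word n l \<longleftrightarrow> set l \<subseteq> pos_roots n \<and>
     (\<forall>k. length (filter (\<lambda>\<alpha>. fst \<alpha> = k) l) + (if k = n then 1 else 0)
        = length (filter (\<lambda>\<alpha>. snd \<alpha> = k) l) + (if k = 1 then 1 else 0))"

text \<open>Cancelling \<open>(p, n)\<close> moves the endpoint of the balance to \<open>p\<close>.
  A second index beyond \<open>p\<close> is impossible: the largest one, \<open>j\<close>, would by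
  the balance also be a first index, of a root whose second index is larger still.\<close>

lemma is_path_word_tail:
  assumes "is_path_word n ((p, n) # ys)"
  shows "is_path_word p ys"
proof -
  have ys: "set ys \<subseteq> pos_roots n" and n: "1 \<le> p" "p < n"
    using assms by (auto simp: is_path_word_def pos_roots_def)
  have bal: "length (filter (\<lambda>\<alpha>. fst \<alpha> = k) ys) + (if k = p then 1 else 0)
        = length (filter (\<lambda>\<alpha>. snd \<alpha> = k) ys) + (if k = 1 then 1 else 0)" for k
  proof -
    have "length (filter (\<lambda>\<alpha>. fst \<alpha> = k) ((p, n) # ys)) + (if k = n then 1 else 0)
        = length (filter (\<lambda>\<alpha>. snd \<alpha> = k) ((p, n) # ys)) + (if k = 1 then 1 else 0)"
      using assms by (simp only: is_path_word_def)
    then show ?thesis by (simp split: if_splits)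
  qed
  have "set ys \<subseteq> pos_roots p"
  proof (rule ccontr)
    assume "\<not> set ys \<subseteq> pos_roots p"
    then obtain \<alpha> where \<alpha>: "\<alpha> \<in> set ys" "p < snd \<alpha>"
    proof -
      obtain \<alpha> where \<alpha>: "\<alpha> \<in> set ys" "\<alpha> \<notin> pos_roots p"
        using \<open>\<not> set ys \<subseteq> pos_roots p\<close> by blast
      then have "\<alpha> \<in> pos_roots n" using ys by blast
      then have "p < snd \<alpha>" using \<alpha>(2) by (cases \<alpha>) (simp add: pos_roots_def)
      then show thesis using that \<alpha>(1) by blast
    qed
    define j where "j = Max (snd ` set ys)"
    have j: "j \<in> snd ` set ys" unfolding j_def using \<alpha> by (intro Max_in) auto
    have max: "snd \<beta> \<le> j" if "\<beta> \<in> set ys" for \<beta> unfolding j_def using that by (intro Max_ge) auto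
    have "p < j" using max[OF \<alpha>(1)] \<alpha>(2) by simp
    obtain \<gamma> where "\<gamma> \<in> set ys" "snd \<gamma> = j" using j by auto
    then have "filter (\<lambda>\<alpha>. snd \<alpha> = j) ys \<noteq> []" by (auto simp: filter_empty_conv)
    then have "0 < length (filter (\<lambda>\<alpha>. snd \<alpha> = j) ys)" by simp
    then have "0 < length (filter (\<lambda>\<alpha>. fst \<alpha> = j) ys)" using bal[of j] \<open>p < j\<close> by simp
    then have "filter (\<lambda>\<alpha>. fst \<alpha> = j) ys \<noteq> []" by simp
    then obtain \<beta> where \<beta>: "\<beta> \<in> set ys" "fst \<beta> = j" by (auto simp: filter_empty_conv)
    then have "fst \<beta> < snd \<beta>" using ys by (auto simp: pos_roots_def)
    then show False using max[OF \<beta>(1)] \<beta>(2) by simp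
  qed
  then show ?thesis using bal by (simp add: is_path_word_def)
qed

lemma is_path_word_last:
  assumes "is_path_word n l" "1 < n"
  obtains xs p ys where "l = xs @ (p, n) # ys" "\<And>\<alpha>. \<alpha> \<in> set xs \<Longrightarrow> snd \<alpha> \<noteq> n"
proof -
  have l: "set l \<subseteq> pos_roots n" using assms by (simp add: is_path_word_def)
  have "length (filter (\<lambda>\<alpha>. fst \<alpha> = n) l) + 1 = length (filter (\<lambda>\<alpha>. snd \<alpha> = n) l)"
  proof -
    have "length (filter (\<lambda>\<alpha>. fst \<alpha> = n) l) + (if n = n then 1 else 0)
        = length (filter (\<lambda>\<alpha>. snd \<alpha> = n) l) + (if n = 1 then 1 else 0)"
      using assms(1) unfolding is_path_word_def by blast
    then show ?thesis using assms(2) by simp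
  qed
  then have "filter (\<lambda>\<alpha>. snd \<alpha> = n) l \<noteq> []" by (cases "filter (\<lambda>\<alpha>. snd \<alpha> = n) l") auto
  then have "\<exists>\<alpha>\<in>set l. snd \<alpha> = n" by (simp add: filter_empty_conv)
  then obtain xs \<alpha> ys where "l = xs @ \<alpha> # ys" "snd \<alpha> = n" "\<forall>\<beta>\<in>set xs. snd \<beta> \<noteq> n"
    using split_list_first_prop[of l "\<lambda>\<alpha>. snd \<alpha> = n"] by blast
  then show thesis using that[of xs "fst \<alpha>" ys] by auto
qed

text \<open>
  The unique factor \<open>e\<^bsub>n,p\<^esub>\<close> is moved to the front. Commuting it past \<open>e\<^bsub>p,q\<^esub>\<close> produces a shorter
  word containing the nonsimple root vector \<open>e\<^bsub>n,q\<^esub>\<close>.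
\<close>

lemma red_word:
  assumes "is_path_word n l" "1 \<le> n" "n \<le> m"
  shows "red m n (word l) (if set l \<subseteq> simple_roots m then 1 else 0)"
  using assms
proof (induction "length l" arbitrary: l n rule: less_induct)
  case less
  \<comment> \<open>An inner induction on the prefix standing before \<open>e_{n,p}\<close>; shorter
    words are left to the outer induction on length.\<close>
  have moved: "red m n (word (xs @ (p, n) # ys)) (if set (xs @ (p, n) # ys) \<subseteq> simple_roots m then 1 else 0)"
    if "is_path_word n (xs @ (p, n) # ys)" "length (xs @ (p, n) # ys) = length l"
       "\<And>\<alpha>. \<alpha> \<in> set xs \<Longrightarrow> snd \<alpha> \<noteq> n" for xs p ys
    using that
  proof (induction xs arbitrary: ys rule: rev_induct)
    case Nil
    then have path: "is_path_word p ys" and p: "1 \<le> p" "p < n"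
      using is_path_word_tail[of n p ys] by (auto simp: is_path_word_def pos_roots_def)
    have "red m p (word ys) (if set ys \<subseteq> simple_roots m then 1 else 0)"
      using Nil path p less.prems by (intro less.hyps) auto
    from red_left[OF this p less.prems(3)] show ?case
      using p less.prems by (simp add: word_simps simple_roots_def split: if_splits)
  next
    case (snoc \<beta> xs)
    obtain q j where \<beta>: "\<beta> = (q, j)" by (cases \<beta>)
    have sub: "set (xs @ (q, j) # (p, n) # ys) \<subseteq> pos_roots n"
      using snoc.prems(1) by (simp add: is_path_word_def \<beta>)
    have qj: "1 \<le> q" "q < j" "j \<le> n" "j \<noteq> n" "1 \<le> p" "p < n"
      using sub snoc.prems(3)[of \<beta>] by (auto simp: pos_roots_def \<beta>)
    have subm: "set xs \<subseteq> pos_roots m" "set ys \<subseteq> pos_roots m"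
      using sub less.prems by (auto simp: pos_roots_def)
    have bal: "length (filter (\<lambda>\<alpha>. fst \<alpha> = k) ((xs @ [\<beta>]) @ (p, n) # ys)) + (if k = n then 1 else 0)
      = length (filter (\<lambda>\<alpha>. snd \<alpha> = k) ((xs @ [\<beta>]) @ (p, n) # ys)) + (if k = 1 then 1 else 0)" for k
      using snoc.prems(1) unfolding is_path_word_def by blast
    define r where "r = gen j q * gen n p - gen n p * gen j q - ((if q = n then gen j p else 0) - (if j = p then gen n q else 0))"
    have r: "r \<in> lie_ideal m"
      unfolding r_def using qj less.prems by (intro gen_relation) auto
    have swap: "gen j q * gen n p = gen n p * gen j q - (if j = p then gen n q else 0) + r"
      unfolding r_def using qj by simp
    have "word ((xs @ [\<beta>]) @ (p, n) # ys) = word xs * (gen j q * gen n p) * word ys"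
      by (simp add: word_simps \<beta> mult.assoc)
    also have "\<dots> = word (xs @ (p, n) # (q, j) # ys)
       + (cst (- 1) * (if j = p then word (xs @ (q, n) # ys) else 0) + word xs * r * word ys)"
      unfolding swap by (simp add: word_simps cst_simps distrib_left distrib_right left_diff_distrib right_diff_distrib mult.assoc)
    finally have eq: "word ((xs @ [\<beta>]) @ (p, n) # ys) = \<dots>" .
    have 1: "red m n (word (xs @ (p, n) # (q, j) # ys))
        (if set (xs @ (p, n) # (q, j) # ys) \<subseteq> simple_roots m then 1 else 0)"
    proof (rule snoc.IH)
      show "is_path_word n (xs @ (p, n) # (q, j) # ys)"
        unfolding is_path_word_def
      proof (intro conjI allI)
        show "set (xs @ (p, n) # (q, j) # ys) \<subseteq> pos_roots n" using sub by simp
        fix k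
        show "length (filter (\<lambda>\<alpha>. fst \<alpha> = k) (xs @ (p, n) # (q, j) # ys)) + (if k = n then 1 else 0)
          = length (filter (\<lambda>\<alpha>. snd \<alpha> = k) (xs @ (p, n) # (q, j) # ys)) + (if k = 1 then 1 else 0)"
          using bal[of k] by (simp only: \<beta>  filter_append length_append length_filter_Cons append.assoc append_Cons append_Nil
              fst_conv snd_conv)
      qed
      show "length (xs @ (p, n) # (q, j) # ys) = length l" using snoc.prems(2) by simp
      show "snd \<alpha> \<noteq> n" if "\<alpha> \<in> set xs" for \<alpha> using snoc.prems(3) that by simp
    qed
    have 2: "red m n (if j = p then word (xs @ (q, n) # ys) else 0) 0"
    proof (cases "j = p")
      case True
      have "is_path_word n (xs @ (q, n) # ys)"
        unfolding is_path_word_def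
      proof (intro conjI allI)
        show "set (xs @ (q, n) # ys) \<subseteq> pos_roots n" using sub qj by (auto simp: pos_roots_def)
        fix k
        show "length (filter (\<lambda>\<alpha>. fst \<alpha> = k) (xs @ (q, n) # ys)) + (if k = n then 1 else 0)
          = length (filter (\<lambda>\<alpha>. snd \<alpha> = k) (xs @ (q, n) # ys)) + (if k = 1 then 1 else 0)"
          using bal[of k] by (simp only: \<beta> True filter_append length_append length_filter_Cons append.assoc append_Cons append_Nil
              fst_conv snd_conv)
      qed
      then have "red m n (word (xs @ (q, n) # ys)) (if set (xs @ (q, n) # ys) \<subseteq> simple_roots m then 1 else 0)"
        using snoc.prems(2) less.prems by (intro less.hyps) auto
      moreover have "(q, n) \<notin> simple_roots m" using qj True by (auto simp: simple_roots_def)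
      ultimately show ?thesis using True by simp
    next
      case False
      then show ?thesis by (simp add: red_ideal lie_ideal_closed)
    qed
    have 3: "red m n (word xs * r * word ys) 0"
      using r subm by (intro red_ideal lie_ideal_closed word_closed)
    have "(if set ((xs @ [\<beta>]) @ (p, n) # ys) \<subseteq> simple_roots m then 1 else (0::complex))
      = (if set (xs @ (p, n) # (q, j) # ys) \<subseteq> simple_roots m then 1 else 0) + (- 1 * 0 + 0)"
      by (auto simp: \<beta>)
    then show ?case unfolding eq using red_add[OF 1 red_add[OF red_cst[OF 2, of "- 1"] 3]] by (simp only:)
  qed
  show ?case
  proof (cases "n = 1")
    case True
    then have "l = []" using less.prems by (cases l) (auto simp: is_path_word_def pos_roots_def)
    moreover have "red m 1 (eprod {1}) (if {1} = {1..1::nat} then 1 else 0)"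
      by (rule red_eprod) simp_all
    ultimately show ?thesis using True by (simp add: word_simps eprod_singleton)
  next
    case False
    then obtain xs p ys where "l = xs @ (p, n) # ys" "\<And>\<alpha>. \<alpha> \<in> set xs \<Longrightarrow> snd \<alpha> \<noteq> n"
      using is_path_word_last[of n l] less.prems by auto
    then show ?thesis using moved[of xs p ys] less.prems by simp
  qed
qed

section \<open>The action of the enveloping algebra\<close>

definition rep_word :: "weight \<Rightarrow> nat \<Rightarrow> (nat \<times> nat) list \<Rightarrow> (nat \<times> nat) endo" where
  "rep_word \<mu> m w = prod_list (map (\<lambda>(i, j). verma \<mu> m i j) w)"

text \<open>The module structure extended to the free algebra; by \<open>rep_cong\<close> it
  descends to \<open>Ugl\<close>.\<close>

definition rep :: "weight \<Rightarrow> nat \<Rightarrow> gl_free \<Rightarrow> (nat \<times> nat) endo" where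
  "rep \<mu> m p = (\<Sum>w\<in>Poly_Mapping.keys p. scal (Poly_Mapping.lookup p w) * rep_word \<mu> m w)"

text \<open>Keys may cancel in a sum, so additivity is checked over a common index set.\<close>

lemma rep_superset:
  assumes "finite A" "Poly_Mapping.keys p \<subseteq> A"
  shows "rep \<mu> m p = (\<Sum>w\<in>A. scal (Poly_Mapping.lookup p w) * rep_word \<mu> m w)"
  unfolding rep_def using assms
  by (intro sum.mono_neutral_left) (auto simp: in_keys_iff scal_hom)

lemma rep_add: "rep \<mu> m (p + q) = rep \<mu> m p + rep \<mu> m q"
proof -
  let ?A = "Poly_Mapping.keys p \<union> Poly_Mapping.keys q"
  have "rep \<mu> m (p + q) = (\<Sum>w\<in>?A. scal (Poly_Mapping.lookup (p + q) w) * rep_word \<mu> m w)"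
    using keys_add[of p q] by (intro rep_superset) auto
  also have "\<dots> = rep \<mu> m p + rep \<mu> m q"
    by (simp add: rep_superset[of ?A] lookup_add scal_hom distrib_right sum.distrib)
  finally show ?thesis .
qed

lemma rep_single: "rep \<mu> m (Poly_Mapping.single w c) = scal c * rep_word \<mu> m w"
  by (subst rep_superset[of "{w}"]) (auto simp: scal_hom)

lemma rep_0: "rep \<mu> m 0 = 0"
  by (simp add: rep_def)

lemma rep_sum: "rep \<mu> m (sum f A) = (\<Sum>i\<in>A. rep \<mu> m (f i))"
  by (induction A rule: infinite_finite_induct) (simp_all add: rep_0 rep_add)

lemma rep_uminus: "rep \<mu> m (- p) = - rep \<mu> m p"
  using rep_add[of \<mu> m p "- p"] by (simp add: rep_0 add_eq_0_iff)

lemma rep_diff: "rep \<mu> m (p - q) = rep \<mu> m p - rep \<mu> m q"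
  using rep_add[of \<mu> m p "- q"] by (simp add: rep_uminus)

lemma rep_word_commute_scal: "scal c * rep_word \<mu> m w = rep_word \<mu> m w * scal c"
proof (induction w)
  case (Cons x w)
  obtain i j where x: "x = (i, j)" by (cases x)
  have "scal c * rep_word \<mu> m (x # w) = verma \<mu> m i j * (scal c * rep_word \<mu> m w)"
    by (simp add: rep_word_def x verma_commute_scal flip: mult.assoc)
  then show ?case unfolding Cons.IH by (simp add: rep_word_def x mult.assoc)
qed (simp add: rep_word_def)

lemma rep_word_append: "rep_word \<mu> m (w @ w') = rep_word \<mu> m w * rep_word \<mu> m w'"
  by (simp add: rep_word_def)

lemma rep_mult: "rep \<mu> m (p * q) = rep \<mu> m p * rep \<mu> m q"
proof -
  let ?P = "\<lambda>w. Poly_Mapping.single w (Poly_Mapping.lookup p w)"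
  let ?Q = "\<lambda>w. Poly_Mapping.single w (Poly_Mapping.lookup q w)"
  have p: "p = sum ?P (Poly_Mapping.keys p)" and q: "q = sum ?Q (Poly_Mapping.keys q)"
    by (rule poly_mapping_sum_single; simp)+
  have "rep \<mu> m (sum ?P A * sum ?Q B) = rep \<mu> m (sum ?P A) * rep \<mu> m (sum ?Q B)" for A B
  proof -
    have "rep \<mu> m (?P w * ?Q w') = rep \<mu> m (?P w) * rep \<mu> m (?Q w')" for w w'
    proof -
      have "rep \<mu> m (?P w * ?Q w') = scal (Poly_Mapping.lookup p w) *
          (scal (Poly_Mapping.lookup q w') * rep_word \<mu> m w) * rep_word \<mu> m w'"
        by (simp add: mult_single plus_list_def rep_single scal_hom rep_word_append mult.assoc)
      then show ?thesis
        unfolding rep_word_commute_scal by (simp add: rep_single mult.assoc)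
    qed
    then show ?thesis
      by (simp only: sum_product rep_sum)
  qed
  from this[of "Poly_Mapping.keys p" "Poly_Mapping.keys q"] show ?thesis
    unfolding p[symmetric] q[symmetric] .
qed

lemma rep_cst: "rep \<mu> m (cst c) = scal c"
  by (simp add: cst_def rep_single rep_word_def)

lemma rep_1: "rep \<mu> m 1 = 1"
  using rep_cst[of \<mu> m 1] by (simp add: cst_simps scal_hom)

lemma rep_gen: "rep \<mu> m (gen i j) = verma \<mu> m i j"
  by (simp add: gen_def rep_single rep_word_def scal_hom)

lemma rep_gl_emb: "rep \<mu> m (gl_emb m x) = (\<Sum>i\<in>{1..m}. \<Sum>j\<in>{1..m}. scal (x i j) * verma \<mu> m i j)"
  by (simp add: gl_emb_def rep_sum rep_single rep_word_def)

text \<open>By bilinearity this is \<open>verma_rels\<close> for matrix units; the work lies in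
  reordering the fourfold sums.\<close>

lemma rep_relator:
  "rep \<mu> m (gl_emb m x * gl_emb m y - gl_emb m y * gl_emb m x - gl_emb m (gl_bracket m x y)) = 0"
proof -
  let ?I = "{1..m}"
  let ?V = "verma \<mu> m"
  let ?L = "\<lambda>x. \<Sum>i\<in>?I. \<Sum>j\<in>?I. scal (x i j) * ?V i j"
  have sV: "?V i j * (scal c * p) = scal c * (?V i j * p)" for i j c p
    using verma_commute_scal[of c \<mu> m i j] by (simp flip: mult.assoc)
  have sc: "scal c * (scal d * p) = scal (c * d) * p" for c d and p :: "(nat \<times> nat) endo"
    by (simp add: scal_hom mult.assoc)
  have xy: "?L x * ?L y = (\<Sum>i\<in>?I. \<Sum>j\<in>?I. \<Sum>k\<in>?I. \<Sum>l\<in>?I. scal (x i j * y k l) * (?V i j * ?V k l))" for x y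
    by (simp only: sum_distrib_right) (simp only: sum_distrib_left mult.assoc sV sc)
  have "?L y * ?L x = (\<Sum>k\<in>?I. \<Sum>l\<in>?I. \<Sum>i\<in>?I. \<Sum>j\<in>?I. scal (x i j * y k l) * (?V k l * ?V i j))"
    unfolding xy by (simp only: mult.commute[of "y _ _"])
  also have "\<dots> = (\<Sum>k\<in>?I. \<Sum>i\<in>?I. \<Sum>l\<in>?I. \<Sum>j\<in>?I. scal (x i j * y k l) * (?V k l * ?V i j))"
    by (intro sum.cong refl sum.swap)
  also have "\<dots> = (\<Sum>i\<in>?I. \<Sum>k\<in>?I. \<Sum>l\<in>?I. \<Sum>j\<in>?I. scal (x i j * y k l) * (?V k l * ?V i j))"
    by (rule sum.swap)
  also have "\<dots> = (\<Sum>i\<in>?I. \<Sum>k\<in>?I. \<Sum>j\<in>?I. \<Sum>l\<in>?I. scal (x i j * y k l) * (?V k l * ?V i j))"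
    by (intro sum.cong refl sum.swap)
  also have "\<dots> = (\<Sum>i\<in>?I. \<Sum>j\<in>?I. \<Sum>k\<in>?I. \<Sum>l\<in>?I. scal (x i j * y k l) * (?V k l * ?V i j))"
    by (intro sum.cong refl sum.swap)
  finally have "?L x * ?L y - ?L y * ?L x =
     (\<Sum>i\<in>?I. \<Sum>j\<in>?I. \<Sum>k\<in>?I. \<Sum>l\<in>?I. scal (x i j * y k l) * (?V i j * ?V k l - ?V k l * ?V i j))"
    unfolding xy[of x y] by (simp only: sum_subtractf right_diff_distrib)
  also have "\<dots> = (\<Sum>i\<in>?I. \<Sum>j\<in>?I. \<Sum>k\<in>?I. \<Sum>l\<in>?I. (if j = k then scal (x i j * y k l) * ?V i l else 0)
      - (if i = l then scal (x i j * y k l) * ?V k j else 0))"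
  proof (intro sum.cong refl)
    fix i j k l assume "i \<in> ?I" "j \<in> ?I" "k \<in> ?I" "l \<in> ?I"
    then have "?V i j * ?V k l - ?V k l * ?V i j = (if j = k then ?V i l else 0) - (if i = l then ?V k j else 0)"
      using verma_rels[of m \<mu>] unfolding gl_rels_def by blast
    then show "scal (x i j * y k l) * (?V i j * ?V k l - ?V k l * ?V i j) =
        (if j = k then scal (x i j * y k l) * ?V i l else 0)
      - (if i = l then scal (x i j * y k l) * ?V k j else 0)"
      by (simp only: right_diff_distrib if_distrib[of "(*) _"] mult_zero_right)
  qed
  also have "\<dots> = (\<Sum>i\<in>?I. \<Sum>j\<in>?I. \<Sum>k\<in>?I. \<Sum>l\<in>?I. (if j = k then scal (x i j * y k l) * ?V i l else 0))
     - (\<Sum>i\<in>?I. \<Sum>j\<in>?I. \<Sum>k\<in>?I. \<Sum>l\<in>?I. (if i = l then scal (x i j * y k l) * ?V k j else 0))"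
    by (simp only: sum_subtractf)
  \<comment> \<open>The terms with \<open>j = k\<close> contract to the entries of the matrix
    product of \<open>x\<close> and \<open>y\<close>, those with \<open>i = l\<close> to the entries
    of the product in the other order.\<close>
  also have "(\<Sum>i\<in>?I. \<Sum>j\<in>?I. \<Sum>k\<in>?I. \<Sum>l\<in>?I. (if j = k then scal (x i j * y k l) * ?V i l else 0))
     = (\<Sum>i\<in>?I. \<Sum>l\<in>?I. \<Sum>j\<in>?I. scal (x i j * y j l) * ?V i l)"
  proof (rule sum.cong[OF refl])
    fix i
    have "(\<Sum>k\<in>?I. \<Sum>l\<in>?I. (if j = k then scal (x i j * y k l) * ?V i l else 0))
      = (\<Sum>l\<in>?I. scal (x i j * y j l) * ?V i l)" if "j \<in> ?I" for j
      using that by (subst sum.swap) simp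
    then have "(\<Sum>j\<in>?I. \<Sum>k\<in>?I. \<Sum>l\<in>?I. (if j = k then scal (x i j * y k l) * ?V i l else 0))
      = (\<Sum>j\<in>?I. \<Sum>l\<in>?I. scal (x i j * y j l) * ?V i l)" by (rule sum.cong[OF refl])
    also have "\<dots> = (\<Sum>l\<in>?I. \<Sum>j\<in>?I. scal (x i j * y j l) * ?V i l)"
      by (rule sum.swap)
    finally show "(\<Sum>j\<in>?I. \<Sum>k\<in>?I. \<Sum>l\<in>?I. (if j = k then scal (x i j * y k l) * ?V i l else 0))
      = (\<Sum>l\<in>?I. \<Sum>j\<in>?I. scal (x i j * y j l) * ?V i l)" .
  qed
  also have "(\<Sum>i\<in>?I. \<Sum>j\<in>?I. \<Sum>k\<in>?I. \<Sum>l\<in>?I. (if i = l then scal (x i j * y k l) * ?V k j else 0))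
     = (\<Sum>i\<in>?I. \<Sum>j\<in>?I. \<Sum>k\<in>?I. scal (x i j * y k i) * ?V k j)"
    by (intro sum.cong refl) simp
  also have "\<dots> = (\<Sum>i\<in>?I. \<Sum>k\<in>?I. \<Sum>j\<in>?I. scal (x i j * y k i) * ?V k j)"
    by (intro sum.cong refl sum.swap)
  also have "\<dots> = (\<Sum>k\<in>?I. \<Sum>i\<in>?I. \<Sum>j\<in>?I. scal (x i j * y k i) * ?V k j)"
    by (rule sum.swap)
  also have "\<dots> = (\<Sum>k\<in>?I. \<Sum>j\<in>?I. \<Sum>i\<in>?I. scal (x i j * y k i) * ?V k j)"
    by (intro sum.cong refl sum.swap)
  finally have comm: "?L x * ?L y - ?L y * ?L x =
     (\<Sum>i\<in>?I. \<Sum>l\<in>?I. \<Sum>j\<in>?I. scal (x i j * y j l) * ?V i l)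
     - (\<Sum>i\<in>?I. \<Sum>l\<in>?I. \<Sum>j\<in>?I. scal (x j l * y i j) * ?V i l)" .
  have ss: "scal (sum f A) = (\<Sum>i\<in>A. scal (f i) :: (nat \<times> nat) endo)" for f :: "nat \<Rightarrow> complex" and A
    by (induction A rule: infinite_finite_induct) (simp_all add: scal_hom)
  have "?L (gl_bracket m x y) = (\<Sum>i\<in>?I. \<Sum>l\<in>?I. \<Sum>j\<in>?I. scal (x i j * y j l) * ?V i l)
     - (\<Sum>i\<in>?I. \<Sum>l\<in>?I. \<Sum>j\<in>?I. scal (x j l * y i j) * ?V i l)"
    unfolding gl_bracket_def scal_hom(6) ss left_diff_distrib sum_subtractf sum_distrib_right
    by (simp only: mult.commute[of "y _ _"])
  then show ?thesis
    using comm by (simp add: rep_diff rep_mult rep_gl_emb)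
qed

text \<open>The elements acting by zero form an ideal containing the relators, and
  \<open>lie_ideal\<close> is the smallest such ideal.\<close>

lemma rep_lie_ideal:
  assumes "p \<in> lie_ideal m"
  shows "rep \<mu> m p = 0"
proof -
  interpret ring "tensor_alg m" by (rule ring_tensor_alg)
  let ?K = "{p \<in> carrier (tensor_alg m). rep \<mu> m p = 0}"
  have "ideal ?K (tensor_alg m)"
  proof (rule idealI[OF ring_tensor_alg])
    show "subgroup ?K (add_monoid (tensor_alg m))"
    proof (rule add.subgroupI)
      show "?K \<noteq> {}" using rep_0 tensor_alg_closed(1) by blast
      fix p assume p: "p \<in> ?K"
      have "\<ominus>\<^bsub>tensor_alg m\<^esub> p = - p"
        using p minus_tensor_alg[of 0 m p] tensor_alg_closed(1)[of m]
        by (simp add: a_minus_def tensor_alg_simps)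
      then show "\<ominus>\<^bsub>tensor_alg m\<^esub> p \<in> ?K" using p by (simp add: tensor_alg_closed rep_uminus)
    qed (auto simp: tensor_alg_simps tensor_alg_closed rep_add)
  qed (auto simp: tensor_alg_simps tensor_alg_closed rep_mult)
  then have "lie_ideal m \<subseteq> ?K"
    unfolding lie_ideal_def by (rule genideal_minimal) (auto simp: lie_relator_closed rep_relator)
  then show ?thesis using assms by blast
qed

lemma rep_cong:
  assumes "p \<in> carrier (tensor_alg m)" "q \<in> carrier (tensor_alg m)" "U_class m p = U_class m q"
  shows "rep \<mu> m p = rep \<mu> m q"
  using rep_lie_ideal[of "p - q" m \<mu>] assms by (simp add: U_class_eq_iff rep_diff)

abbreviation vac :: "(nat \<times> nat) pseries" where
  "vac \<equiv> mono_vec (\<lambda>_. 0)"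

text \<open>Strip off the largest cut point: with \<open>p\<close> the next one below, the leftmost
  factor is \<open>e_{n,p}\<close>, and \<open>verma_lower_mono\<close> applies.\<close>

lemma rep_eprod_vac:
  assumes "T \<subseteq> {1..n}" "1 \<in> T" "n \<in> T" "n \<le> m"
  shows "app (rep \<mu> m (eprod T)) vac = mono_vec (chi T)"
  using assms
proof (induction n arbitrary: T rule: less_induct)
  case (less n)
  show ?case
  proof (cases "n = 1")
    case True
    then have T: "T = {1}" using less.prems by auto
    have "chi {1} = (\<lambda>_. 0)" by (auto simp: chi_def blk_def fun_eq_iff)
    then show ?thesis using T by (simp add: eprod_singleton rep_1)
  next
    case False
    define p where "p = Max (T - {n})"
    have f: "finite (T - {n})" using less.prems(1) by (meson finite_Diff finite_atLeastAtMost finite_subset)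
    have p: "p \<in> T - {n}" unfolding p_def using less.prems False f by (intro Max_in) auto
    have le: "x \<le> p" if "x \<in> T - {n}" for x unfolding p_def using that f by simp
    have T': "T - {n} \<subseteq> {1..p}" "1 \<in> T - {n}"
    proof
      fix x assume x: "x \<in> T - {n}"
      then show "x \<in> {1..p}" using le[OF x] less.prems(1) by auto
    qed (use less.prems False in simp)
    have pn: "1 \<le> p" "p < n" using p less.prems(1) by (auto simp: order_less_le)
    have ins: "insert n (T - {n}) = T" using less.prems by blast
    have IH: "app (rep \<mu> m (eprod (T - {n}))) vac = mono_vec (chi (T - {n}))"
      using less.IH[OF pn(2) T' p] pn(2) less.prems(4) by simp
    show ?thesis
      using eprod_insert_top[OF T'(1) p pn(2)] verma_lower_mono[OF pn less.prems(4) T'(1) p] IH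
      unfolding ins by (simp add: rep_mult rep_gen)
  qed
qed

section \<open>Cut sets and the coefficients read off from the action on 1\<close>

definition cuts :: "nat \<Rightarrow> nat set set" where
  "cuts m = {T. T \<subseteq> {1..m} \<and> 1 \<in> T \<and> m \<in> T}"

lemma cuts_eq: "cuts m = (\<lambda>S. {1..m} - S) ` Pow {2..<m}" if "2 \<le> m"
proof
  show "cuts m \<subseteq> (\<lambda>S. {1..m} - S) ` Pow {2..<m}"
  proof
    fix T assume T: "T \<in> cuts m"
    then have "T = {1..m} - ({1..m} - T)" by (auto simp: cuts_def)
    moreover have "{1..m} - T \<subseteq> {2..<m}"
    proof
      fix x assume "x \<in> {1..m} - T"
      moreover from this have "x \<noteq> 1" "x \<noteq> m" using T by (auto simp: cuts_def)
      ultimately show "x \<in> {2..<m}" by simp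
    qed
    ultimately show "T \<in> (\<lambda>S. {1..m} - S) ` Pow {2..<m}" by blast
  qed
  show "(\<lambda>S. {1..m} - S) ` Pow {2..<m} \<subseteq> cuts m"
    using that by (auto simp: cuts_def)
qed

lemma finite_cuts: "finite (cuts m)"
  unfolding cuts_def by (rule finite_subset[of _ "Pow {1..m}"]) auto

text \<open>Since \<open>1 \<in> T\<close>, every other point of \<open>T\<close> is the upper end
  of a block, so the blocks determine \<open>T\<close>.\<close>

lemma chi_inj:
  assumes "T \<in> cuts m" "T' \<in> cuts m" "chi T = chi T'" "2 \<le> m"
  shows "T = T'"
proof -
  have "T \<subseteq> T'" if "T \<in> cuts m" "chi T = chi T'" "T' \<in> cuts m" for T T'
  proof
    fix x assume x: "x \<in> T"
    show "x \<in> T'"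
    proof (cases "x = 1")
      case False
      then have "1 < x" using x that by (force simp: cuts_def)
      have "1 \<in> T" using that by (simp add: cuts_def)
      then obtain p where "blk T (x, p)" using blk_exists_right[OF x _ \<open>1 < x\<close>] by blast
      then have "chi T' (x, p) = 1" unfolding that(2)[symmetric] by (simp add: chi_def)
      then have "blk T' (x, p)" by (simp add: chi_def split: if_splits)
      then show ?thesis by (rule blkD)
    qed (use that in \<open>simp add: cuts_def\<close>)
  qed
  then show ?thesis using assms by (metis subset_antisym)
qed

text \<open>Both claims are linear in \<open>X\<close>. They hold for \<open>eprod T\<close> because
  different cut sets give different monomials, and for the ideal because it acts by zero. In
  particular the number \<open>c\<close> in \<open>red\<close> depends only on
  \<open>X\<close>.\<close>

lemma red_expansion:
  fixes \<mu> :: weight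
  assumes "red m m X c" "2 \<le> m"
  defines "f \<equiv> app (rep \<mu> m X) vac"
  shows "X - (\<Sum>T\<in>cuts m. cst (f (chi T)) * eprod T) \<in> lie_ideal m \<and> f (chi {1..m}) = c"
  using assms(1) unfolding f_def
proof induction
  case (red_eprod T)
  have f: "app (rep \<mu> m (eprod T)) vac = mono_vec (chi T)"
    by (rule rep_eprod_vac[OF red_eprod order_refl])
  have T: "T \<in> cuts m" using red_eprod by (simp add: cuts_def)
  have full: "{1..m} \<in> cuts m" using assms(2) by (simp add: cuts_def)
  have v: "mono_vec (chi T) (chi T') = (if T' = T then 1 else 0)" if "T' \<in> cuts m" for T'
    using chi_inj[OF that T _ assms(2)] by (auto simp: mono_vec_def)
  have "(\<Sum>T'\<in>cuts m. cst (mono_vec (chi T) (chi T')) * eprod T') = (\<Sum>T'\<in>cuts m. if T' = T then eprod T else 0)"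
    using v by (intro sum.cong) (auto simp: cst_simps)
  then show ?case unfolding f using T v[OF full] by (auto simp: finite_cuts lie_ideal_closed)
next
  case (red_ideal x)
  then show ?case by (simp add: rep_lie_ideal cst_simps)
next
  case (red_add x c y d)
  let ?S = "\<lambda>x. \<Sum>T\<in>cuts m. cst (app (rep \<mu> m x) vac (chi T)) * eprod T"
  have "x + y - ?S (x + y) = (x - ?S x) + (y - ?S y)"
    by (simp add: rep_add cst_simps distrib_right sum.distrib)
  moreover have "(x - ?S x) + (y - ?S y) \<in> lie_ideal m"
    using red_add.IH by (intro lie_ideal_closed) blast+
  ultimately have "x + y - ?S (x + y) \<in> lie_ideal m" by (simp only:)
  then show ?case using red_add.IH by (simp only: rep_add app_simps plus_fun_apply simp_thms)
next
  case (red_cst x c s)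
  let ?S = "\<lambda>x. \<Sum>T\<in>cuts m. cst (app (rep \<mu> m x) vac (chi T)) * eprod T"
  have "cst s * x - ?S (cst s * x) = cst s * (x - ?S x)"
    by (simp add: rep_mult rep_cst cst_simps right_diff_distrib sum_distrib_left mult.assoc)
  moreover have "cst s * (x - ?S x) \<in> lie_ideal m"
    using red_cst.IH by (intro lie_ideal_closed tensor_alg_closed) blast
  ultimately have "cst s * x - ?S (cst s * x) \<in> lie_ideal m" by (simp only:)
  then show ?case using red_cst.IH by (simp only: rep_mult rep_cst app_simps app_scal simp_thms)
qed

section \<open>The weight rho, and passing the determinant to \<open>Ugl\<close>\<close>

lemma finite_pos_roots: "finite (pos_roots m)"
  by (rule finite_subset[of _ "{1..m} \<times> {1..m}"]) (auto simp: pos_roots_def)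

text \<open>The index \<open>k\<close> is the first one in \<open>m - k\<close> positive roots and
  the second one in \<open>k - 1\<close>.\<close>

lemma gl_rho_eq:
  assumes "k \<in> {1..m}"
  shows "gl_rho m k = (of_nat m + 1 - 2 * of_nat k) / 2"
proof -
  have "(\<Sum>\<alpha>\<in>pos_roots m. root_wt \<alpha> k)
      = (\<Sum>\<alpha>\<in>pos_roots m. (if fst \<alpha> = k then 1 else 0)) - (\<Sum>\<alpha>\<in>pos_roots m. (if snd \<alpha> = k then 1 else (0::complex)))"
    unfolding sum_subtractf[symmetric] by (intro sum.cong) (auto simp: root_wt_def gl_eps_def)
  also have "\<dots> = of_nat (card {\<alpha> \<in> pos_roots m. fst \<alpha> = k}) - of_nat (card {\<alpha> \<in> pos_roots m. snd \<alpha> = k})"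
    using finite_pos_roots by (simp add: sum.If_cases Int_def)
  also have "{\<alpha> \<in> pos_roots m. fst \<alpha> = k} = Pair k ` {Suc k..m}"
    using assms by (auto simp: pos_roots_def)
  also have "{\<alpha> \<in> pos_roots m. snd \<alpha> = k} = (\<lambda>i. (i, k)) ` {1..<k}"
    using assms by (auto simp: pos_roots_def)
  also have "card (Pair k ` {Suc k..m}) = m - k" by (simp add: card_image inj_on_def)
  also have "card ((\<lambda>i. (i, k)) ` {1..<k}) = k - 1" by (simp add: card_image inj_on_def)
  finally show ?thesis using assms by (simp add: gl_rho_def of_nat_diff)
qed

lemma wt_form_eps_diff:
  assumes "i \<in> {1..m}" "j \<in> {1..m}"
  shows "wt_form m \<alpha> (gl_eps i - gl_eps j) = \<alpha> i - \<alpha> j"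
proof -
  have "wt_form m \<alpha> (gl_eps i - gl_eps j) = (\<Sum>k\<in>{1..m}. (if k = i then \<alpha> i else 0) - (if k = j then \<alpha> j else 0))"
    unfolding wt_form_def by (intro sum.cong) (auto simp: gl_eps_def)
  then show ?thesis using assms by (simp add: sum_subtractf)
qed

text \<open>The pairing of \<open>\<rho>\<close> with this difference is \<open>k\<close>. The right
  side is written in the form of the factor in \<open>verma_singular_coeff\<close>, with
  \<open>b = k + 1\<close>.\<close>

lemma a_coeff_eq:
  assumes "k < m"
  shows "a_coeff m \<mu> k = \<mu> 1 - \<mu> (k + 1) + of_nat (k + 1) - 2"
  using assms by (simp add: a_coeff_def wt_form_eps_diff gl_rho_eq field_simps)

text \<open>\<open>U_class\<close> is a ring homomorphism and maps the determinant term by term.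
  Permutations keep the indices in range, where the entries of \<open>D_free\<close> represent those
  of \<open>D_matrix\<close>.\<close>

lemma ncdet_D_matrix:
  assumes "2 \<le> m"
  shows "ncdet (Ugl m) (m - 1) (D_matrix m \<mu>) = U_class m (rdet (m - 1) (D_free m (a_coeff m \<mu>)))"
    and "rdet (m - 1) (D_free m (a_coeff m \<mu>)) \<in> carrier (tensor_alg m)"
proof -
  interpret ring "Ugl m" by (rule ring_Ugl)
  let ?n = "m - 1"
  let ?F = "D_free m (a_coeff m \<mu>)"
  have clF: "?F i j \<in> carrier (tensor_alg m)" if "i \<in> {1..?n}" "j \<in> {1..?n}" for i j
    using that assms by (auto simp: D_free_def intro!: gen_closed tensor_alg_closed)
  have D: "D_matrix m \<mu> i j = U_class m (?F i j)" if "i \<in> {1..?n}" "j \<in> {1..?n}" for i j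
    using that assms
    by (auto simp: D_free_def D_matrix_def U_class_hom U_scalar_eq intro!: U_unit_eq)
  have im: "w k \<in> {1..?n}" if "w permutes {1..?n}" "k \<in> {1..?n}" for w k
    using permutes_in_image[OF that(1), of k] that(2) by simp
  let ?t = "\<lambda>w. of_int (sign w) * prod_list (map (\<lambda>k. ?F (w k) k) [1..<?n + 1])"
  have clt: "prod_list (map (\<lambda>k. ?F (w k) k) [1..<?n + 1]) \<in> carrier (tensor_alg m)"
    if w: "w permutes {1..?n}" for w
  proof (rule prod_list_closed)
    fix x assume "x \<in> set (map (\<lambda>k. ?F (w k) k) [1..<?n + 1])"
    then obtain k where "k \<in> set [1..<?n + 1]" "x = ?F (w k) k" unfolding set_map by blast
    moreover from this have "k \<in> {1..?n}" by (simp del: upt_Suc)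
    ultimately have "k \<in> {1..?n}" "x = ?F (w k) k" by blast+
    then show "x \<in> carrier (tensor_alg m)" using clF im[OF w] by simp
  qed
  have fin: "finite {w. w permutes {1..?n}}" by (simp add: finite_permutations)
  show cl: "rdet ?n ?F \<in> carrier (tensor_alg m)"
    unfolding rdet_def by (intro sum_closed tensor_alg_closed of_int_closed clt) simp
  have "U_class m (rdet ?n ?F) = (\<Oplus>\<^bsub>Ugl m\<^esub>w\<in>{w. w permutes {1..?n}}. U_class m (?t w))"
    unfolding rdet_def using fin by (intro U_class_sum tensor_alg_closed of_int_closed clt) simp_all
  also have "\<dots> = ncdet (Ugl m) ?n (D_matrix m \<mu>)"
    unfolding ncdet_def
  proof (rule finsum_cong')
    show "(\<lambda>w. [sign w] \<cdot>\<^bsub>Ugl m\<^esub> ncprod (Ugl m) (map (\<lambda>k. D_matrix m \<mu> (w k) k) [1..<?n + 1]))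
      \<in> {w. w permutes {1..?n}} \<rightarrow> carrier (Ugl m)"
    proof
      fix w assume "w \<in> {w. w permutes {1..?n}}"
      then have w: "w permutes {1..?n}" by simp
      have "ncprod (Ugl m) (map (\<lambda>k. D_matrix m \<mu> (w k) k) [1..<?n + 1]) \<in> carrier (Ugl m)"
      proof -
        have "ncprod (Ugl m) xs \<in> carrier (Ugl m)" if "set xs \<subseteq> carrier (Ugl m)" for xs
          using that by (induction xs) (simp_all add: ncprod_def)
        moreover have "set (map (\<lambda>k. D_matrix m \<mu> (w k) k) [1..<?n + 1]) \<subseteq> carrier (Ugl m)"
          using im[OF w] D clF U_class_hom(3) by (auto simp del: upt_Suc)
        ultimately show ?thesis by blast
      qed
      then show "[sign w] \<cdot>\<^bsub>Ugl m\<^esub> ncprod (Ugl m) (map (\<lambda>k. D_matrix m \<mu> (w k) k) [1..<?n + 1]) \<in> carrier (Ugl m)"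
        by (rule add.int_pow_closed)
    qed
  next
    fix w assume "w \<in> {w. w permutes {1..?n}}"
    then have w: "w permutes {1..?n}" by simp
    let ?P = "prod_list (map (\<lambda>k. ?F (w k) k) [1..<?n + 1])"
    have "U_class m ?P = ncprod (Ugl m) (map (U_class m) (map (\<lambda>k. ?F (w k) k) [1..<?n + 1]))"
      by (rule U_class_prod_list) (use clF im[OF w] in \<open>auto simp del: upt_Suc\<close>)
    also have "map (U_class m) (map (\<lambda>k. ?F (w k) k) [1..<?n + 1]) = map (\<lambda>k. D_matrix m \<mu> (w k) k) [1..<?n + 1]"
      unfolding map_map o_def by (rule map_cong[OF refl]) (use D im[OF w] in \<open>simp del: upt_Suc\<close>)
    finally have P: "ncprod (Ugl m) (map (\<lambda>k. D_matrix m \<mu> (w k) k) [1..<?n + 1]) = U_class m ?P" by simp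
    have cl: "U_class m ?P \<in> carrier (Ugl m)" by (rule U_class_hom(3)[OF clt[OF w]])
    show "U_class m (?t w) = [sign w] \<cdot>\<^bsub>Ugl m\<^esub> ncprod (Ugl m) (map (\<lambda>k. D_matrix m \<mu> (w k) k) [1..<?n + 1])"
      unfolding P
      by (cases w rule: sign_cases)
        (use cl clt[OF w] in \<open>simp_all add: U_class_hom(6) add.int_pow_neg add.int_pow_1 del: upt_Suc\<close>)
  qed simp
  finally show "ncdet (Ugl m) ?n (D_matrix m \<mu>) = U_class m (rdet ?n ?F)" by simp
qed

section \<open>Shapovalov elements\<close>

definition h_rep :: "nat \<Rightarrow> h_poly \<Rightarrow> gl_free" where
  "h_rep m P = (\<Sum>k\<in>Poly_Mapping.keys P. cst (Poly_Mapping.lookup P k) *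
     prod_list (map (\<lambda>i. gen i i ^ Poly_Mapping.lookup k i) [1..<m + 1]))"

lemma h_rep_closed: "h_rep m P \<in> carrier (tensor_alg m)"
  unfolding h_rep_def
  by (intro sum_closed tensor_alg_closed prod_list_closed) (auto intro!: power_closed gen_closed)

lemma U_poly_eq: "U_poly m P = U_class m (h_rep m P)"
proof -
  interpret ring "Ugl m" by (rule ring_Ugl)
  let ?f = "\<lambda>k i. gen i i ^ Poly_Mapping.lookup k i"
  have cl: "prod_list (map (?f k) [1..<m + 1]) \<in> carrier (tensor_alg m)" for k
    by (intro prod_list_closed) (auto intro!: power_closed gen_closed)
  have U: "U_class m (prod_list (map (?f k) [1..<m + 1])) =
      ncprod (Ugl m) (map (\<lambda>i. U_unit m i i [^]\<^bsub>Ugl m\<^esub> Poly_Mapping.lookup k i) [1..<m + 1])" for k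
  proof -
    have "U_class m (prod_list (map (?f k) [1..<m + 1])) = ncprod (Ugl m) (map (U_class m) (map (?f k) [1..<m + 1]))"
      by (rule U_class_prod_list) (auto intro!: power_closed gen_closed)
    also have "map (U_class m) (map (?f k) [1..<m + 1]) = map (\<lambda>i. U_unit m i i [^]\<^bsub>Ugl m\<^esub> Poly_Mapping.lookup k i) [1..<m + 1]"
      unfolding map_map o_def
      by (rule map_cong[OF refl]) (auto simp: U_class_power gen_closed U_unit_eq)
    finally show ?thesis .
  qed
  have "U_class m (h_rep m P) = (\<Oplus>\<^bsub>Ugl m\<^esub>k\<in>Poly_Mapping.keys P.
      U_class m (cst (Poly_Mapping.lookup P k) * prod_list (map (?f k) [1..<m + 1])))"
    unfolding h_rep_def by (intro U_class_sum tensor_alg_closed cl) simp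
  then show ?thesis
    unfolding U_poly_def U_class_hom(5)[OF tensor_alg_closed(3) cl] U U_scalar_eq by simp
qed

text \<open>The diagonal matrix units act on the highest weight vector by the entries of
  \<open>\<mu>\<close>. This is what links a Shapovalov element to its evaluation: both send 1 to
  the same vector.\<close>

lemma rep_h_rep_vac: "app (rep \<mu> m (h_rep m P)) vac = app (scal (h_poly_eval m P \<mu>)) vac"
proof -
  have pw: "app (rep \<mu> m (gen i i ^ n)) (app (scal c) vac) = app (scal (\<mu> i ^ n * c)) vac"
    if "i \<in> {1..m}" for i n c
  proof (induction n arbitrary: c)
    case (Suc n)
    have "app (verma \<mu> m i i) (app (scal c) vac) = app (scal c * verma \<mu> m i i) vac"
      unfolding verma_commute_scal by simp
    also have "\<dots> = app (scal (\<mu> i * c)) vac"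
      using verma_diag_vac[OF that, of \<mu>] by (simp add: fun_eq_iff)
    finally show ?case
      by (simp only: power_Suc2 rep_mult app_simps rep_gen Suc.IH mult.assoc)
  qed (simp add: rep_1)
  have "app (rep \<mu> m (prod_list (map (\<lambda>i. gen i i ^ Poly_Mapping.lookup k i) is))) vac
      = app (scal (prod_list (map (\<lambda>i. \<mu> i ^ Poly_Mapping.lookup k i) is))) vac"
    if "set is \<subseteq> {1..m}" for k "is"
    using that by (induction "is") (simp_all add: rep_1 scal_hom(4) rep_mult pw)
  from this[of "[1..<m + 1]"]
  have mon: "app (rep \<mu> m (prod_list (map (\<lambda>i. gen i i ^ Poly_Mapping.lookup k i) [1..<m + 1]))) vac
      = app (scal (\<Prod>i\<in>{1..m}. \<mu> i ^ Poly_Mapping.lookup k i)) vac" for k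
    by (simp add: atLeastLessThanSuc_atLeastAtMost flip: prod.distinct_set_conv_list del: upt_Suc)
  show ?thesis
  proof
    fix n
    have sumn: "sum F A n = (\<Sum>k\<in>A. F k n)" for F :: "(nat \<Rightarrow>\<^sub>0 nat) \<Rightarrow> (nat \<times> nat) pseries" and A
      by (induction A rule: infinite_finite_induct) auto
    show "app (rep \<mu> m (h_rep m P)) vac n = app (scal (h_poly_eval m P \<mu>)) vac n"
      unfolding h_rep_def rep_sum app_sum sumn rep_mult rep_cst app_simps(5) mon
      by (simp add: h_poly_eval_def sum_distrib_right mult.assoc)
  qed
qed

section \<open>Root partitions of the highest root\<close>

definition part_word :: "(nat \<times> nat) list \<Rightarrow> (nat \<times> nat \<Rightarrow> nat) \<Rightarrow> (nat \<times> nat) list" where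
  "part_word ord \<pi> = concat (map (\<lambda>\<alpha>. replicate (\<pi> \<alpha>) \<alpha>) ord)"

lemma e_neg_eq:
  assumes "set ord \<subseteq> pos_roots m"
  shows "e_neg m ord \<pi> = U_class m (word (part_word ord \<pi>))"
proof -
  have cl: "gen (snd \<alpha>) (fst \<alpha>) \<in> carrier (tensor_alg m)" if "\<alpha> \<in> set ord" for \<alpha>
    using that assms by (intro gen_closed) (auto simp: pos_roots_def)
  have "word (part_word ord \<pi>) = prod_list (map (\<lambda>\<alpha>. gen (snd \<alpha>) (fst \<alpha>) ^ \<pi> \<alpha>) ord)"
    by (induction ord) (simp_all add: part_word_def word_def)
  also have "U_class m \<dots> = ncprod (Ugl m) (map (U_class m) (map (\<lambda>\<alpha>. gen (snd \<alpha>) (fst \<alpha>) ^ \<pi> \<alpha>) ord))"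
    by (rule U_class_prod_list) (auto intro!: power_closed cl)
  also have "map (U_class m) (map (\<lambda>\<alpha>. gen (snd \<alpha>) (fst \<alpha>) ^ \<pi> \<alpha>) ord) =
      map (\<lambda>\<alpha>. U_unit m (snd \<alpha>) (fst \<alpha>) [^]\<^bsub>Ugl m\<^esub> \<pi> \<alpha>) ord"
    unfolding map_map o_def
  proof (rule map_cong[OF refl])
    fix \<alpha> assume \<alpha>: "\<alpha> \<in> set ord"
    then have "snd \<alpha> \<in> {1..m}" "fst \<alpha> \<in> {1..m}" using assms by (auto simp: pos_roots_def)
    then show "U_class m (gen (snd \<alpha>) (fst \<alpha>) ^ \<pi> \<alpha>) = U_unit m (snd \<alpha>) (fst \<alpha>) [^]\<^bsub>Ugl m\<^esub> \<pi> \<alpha>"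
      using cl[OF \<alpha>] by (simp add: U_class_power U_unit_eq)
  qed
  finally show ?thesis by (simp add: e_neg_def)
qed

lemma length_filter_part_word:
  "distinct ord \<Longrightarrow> length (filter P (part_word ord \<pi>)) = (\<Sum>\<alpha>\<in>set ord. if P \<alpha> then \<pi> \<alpha> else 0)"
proof (induction ord)
  case (Cons \<alpha> ord)
  have "length (filter P (replicate n \<alpha>)) = (if P \<alpha> then n else 0)" for n by simp
  then show ?case using Cons by (simp add: part_word_def)
qed (simp add: part_word_def)

text \<open>The weight equation lives in the complex numbers; with the negative terms moved across,
  both sides are images of naturals. For \<open>k\<close> outside the index range both sums are
  zero.\<close>

lemma root_partition_balance:
  assumes "\<pi> \<in> root_partitions m (gl_eps 1 - gl_eps m)" "1 \<le> m"
  shows "(\<Sum>\<alpha>\<in>pos_roots m. if fst \<alpha> = k then \<pi> \<alpha> else 0) + (if k = m then 1 else 0)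
    = (\<Sum>\<alpha>\<in>pos_roots m. if snd \<alpha> = k then \<pi> \<alpha> else 0) + (if k = 1 then 1 else 0)"
proof (cases "k \<in> {1..m}")
  case True
  have "(\<Sum>\<alpha>\<in>pos_roots m. of_nat (\<pi> \<alpha>) * root_wt \<alpha> k) = (gl_eps 1 - gl_eps m) k"
    using assms True unfolding root_partitions_def by blast
  also have "(\<Sum>\<alpha>\<in>pos_roots m. of_nat (\<pi> \<alpha>) * root_wt \<alpha> k) =
     (\<Sum>\<alpha>\<in>pos_roots m. of_nat (if fst \<alpha> = k then \<pi> \<alpha> else 0) - of_nat (if snd \<alpha> = k then \<pi> \<alpha> else 0))"
    by (intro sum.cong refl) (simp add: root_wt_def gl_eps_def)
  finally have "of_nat (\<Sum>\<alpha>\<in>pos_roots m. if fst \<alpha> = k then \<pi> \<alpha> else 0)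
      - of_nat (\<Sum>\<alpha>\<in>pos_roots m. if snd \<alpha> = k then \<pi> \<alpha> else 0)
    = of_nat (if k = 1 then 1 else 0) - (of_nat (if k = m then 1 else 0) :: complex)"
    by (simp add: sum_subtractf gl_eps_def)
  then have "(of_nat ((\<Sum>\<alpha>\<in>pos_roots m. if fst \<alpha> = k then \<pi> \<alpha> else 0) + (if k = m then 1 else 0)) :: complex)
    = of_nat ((\<Sum>\<alpha>\<in>pos_roots m. if snd \<alpha> = k then \<pi> \<alpha> else 0) + (if k = 1 then 1 else 0))"
    unfolding of_nat_add by (simp only: algebra_simps)
  then show ?thesis by (simp only: of_nat_eq_iff)
next
  case False
  then have "(\<Sum>\<alpha>\<in>pos_roots m. if fst \<alpha> = k then \<pi> \<alpha> else 0) = 0"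
    "(\<Sum>\<alpha>\<in>pos_roots m. if snd \<alpha> = k then \<pi> \<alpha> else 0) = 0"
    by (auto intro!: sum.neutral simp: pos_roots_def)
  then show ?thesis using False assms(2) by auto
qed

lemma is_path_word_part_word:
  assumes "\<pi> \<in> root_partitions m (gl_eps 1 - gl_eps m)" "set ord = pos_roots m" "distinct ord" "1 \<le> m"
  shows "is_path_word m (part_word ord \<pi>)"
  unfolding is_path_word_def length_filter_part_word[OF assms(3)] assms(2)
  using root_partition_balance[OF assms(1,4)] assms(2) by (auto simp: part_word_def split: if_splits)

text \<open>Weighting the balance at \<open>k\<close> by \<open>k\<close> bounds the number of roots by the height of \<open>\<eta>'\<close>.\<close>

lemma root_partition_le:
  assumes "\<pi> \<in> root_partitions m (gl_eps 1 - gl_eps m)" "1 \<le> m" "\<alpha> \<in> pos_roots m"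
  shows "\<pi> \<alpha> \<le> m"
proof -
  have bal: "(\<Sum>k\<in>{1..m}. k * (\<Sum>\<beta>\<in>pos_roots m. if fst \<beta> = k then \<pi> \<beta> else 0)) + m
     = (\<Sum>k\<in>{1..m}. k * (\<Sum>\<beta>\<in>pos_roots m. if snd \<beta> = k then \<pi> \<beta> else 0)) + 1"
  proof -
    have "(\<Sum>k\<in>{1..m}. k * ((\<Sum>\<beta>\<in>pos_roots m. if fst \<beta> = k then \<pi> \<beta> else 0) + (if k = m then 1 else 0)))
      = (\<Sum>k\<in>{1..m}. k * ((\<Sum>\<beta>\<in>pos_roots m. if snd \<beta> = k then \<pi> \<beta> else 0) + (if k = 1 then 1 else 0)))"
      using root_partition_balance[OF assms(1,2)] by (intro sum.cong refl) (simp only:)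
    then show ?thesis
      using assms(2) by (simp add: distrib_left sum.distrib if_distrib[of "(*) _"] cong: if_cong)
  qed
  have sw: "(\<Sum>k\<in>{1..m}. k * (\<Sum>\<beta>\<in>pos_roots m. if g \<beta> = k then \<pi> \<beta> else 0)) = (\<Sum>\<beta>\<in>pos_roots m. g \<beta> * \<pi> \<beta>)"
    if "\<And>\<beta>. \<beta> \<in> pos_roots m \<Longrightarrow> g \<beta> \<in> {1..m}" for g :: "nat \<times> nat \<Rightarrow> nat"
  proof -
    have "(\<Sum>k\<in>{1..m}. k * (\<Sum>\<beta>\<in>pos_roots m. if g \<beta> = k then \<pi> \<beta> else 0))
      = (\<Sum>\<beta>\<in>pos_roots m. \<Sum>k\<in>{1..m}. if k = g \<beta> then g \<beta> * \<pi> \<beta> else 0)"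
      unfolding sum_distrib_left by (subst sum.swap) (intro sum.cong refl, auto)
    then show ?thesis using that by simp
  qed
  have "(\<Sum>\<beta>\<in>pos_roots m. fst \<beta> * \<pi> \<beta>) + (\<Sum>\<beta>\<in>pos_roots m. \<pi> \<beta>) \<le> (\<Sum>\<beta>\<in>pos_roots m. snd \<beta> * \<pi> \<beta>)"
    unfolding sum.distrib[symmetric]
  proof (rule sum_mono)
    fix \<beta> assume "\<beta> \<in> pos_roots m"
    then have "(fst \<beta> + 1) * \<pi> \<beta> \<le> snd \<beta> * \<pi> \<beta>" by (intro mult_right_mono) (auto simp: pos_roots_def)
    then show "fst \<beta> * \<pi> \<beta> + \<pi> \<beta> \<le> snd \<beta> * \<pi> \<beta>" by simp
  qed
  moreover have "\<pi> \<alpha> \<le> (\<Sum>\<beta>\<in>pos_roots m. \<pi> \<beta>)"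
    using assms(3) finite_pos_roots by (intro member_le_sum) auto
  moreover have "(\<Sum>k\<in>{1..m}. k * (\<Sum>\<beta>\<in>pos_roots m. if fst \<beta> = k then \<pi> \<beta> else 0)) = (\<Sum>\<beta>\<in>pos_roots m. fst \<beta> * \<pi> \<beta>)"
    "(\<Sum>k\<in>{1..m}. k * (\<Sum>\<beta>\<in>pos_roots m. if snd \<beta> = k then \<pi> \<beta> else 0)) = (\<Sum>\<beta>\<in>pos_roots m. snd \<beta> * \<pi> \<beta>)"
    by (intro sw; auto simp: pos_roots_def)+
  ultimately show ?thesis using bal by linarith
qed

lemma finite_root_partitions:
  assumes "1 \<le> m"
  shows "finite (root_partitions m (gl_eps 1 - gl_eps m))"
proof (rule finite_subset)
  show "root_partitions m (gl_eps 1 - gl_eps m) \<subseteq>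
    {\<pi>. \<forall>\<alpha>. (\<alpha> \<in> pos_roots m \<longrightarrow> \<pi> \<alpha> \<in> {..m}) \<and> (\<alpha> \<notin> pos_roots m \<longrightarrow> \<pi> \<alpha> = 0)}"
    using root_partition_le assms by (auto simp: root_partitions_def)
  show "finite {\<pi>. \<forall>\<alpha>. (\<alpha> \<in> pos_roots m \<longrightarrow> \<pi> \<alpha> \<in> {..m}) \<and> (\<alpha> \<notin> pos_roots m \<longrightarrow> \<pi> \<alpha> = 0)}"
    by (intro finite_set_of_finite_funs finite_pos_roots) simp
qed

definition simple_part :: "nat \<Rightarrow> nat \<times> nat \<Rightarrow> nat" where
  "simple_part m \<alpha> = (if \<alpha> \<in> simple_roots m then 1 else 0)"

lemma sum_simple_single:
  assumes zero: "\<And>\<alpha>. \<alpha> \<notin> simple_roots m \<Longrightarrow> \<pi> \<alpha> = 0"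
    and uniq: "\<And>\<alpha>. \<alpha> \<in> simple_roots m \<Longrightarrow> P \<alpha> \<Longrightarrow> \<alpha> = \<beta>" and "P \<beta>"
  shows "(\<Sum>\<alpha>\<in>pos_roots m. if P \<alpha> then \<pi> \<alpha> else (0::nat)) = \<pi> \<beta>"
proof -
  have eq: "(if P \<alpha> then \<pi> \<alpha> else 0) = (if \<alpha> = \<beta> then \<pi> \<beta> else 0)" for \<alpha>
    using zero[of \<alpha>] uniq[of \<alpha>] \<open>P \<beta>\<close> by (cases "\<alpha> \<in> simple_roots m"; cases "P \<alpha>") auto
  have "\<pi> \<beta> = 0" if "\<beta> \<notin> pos_roots m"
    using that by (intro zero) (auto simp: simple_roots_def pos_roots_def)
  then show ?thesis unfolding eq using finite_pos_roots by auto
qed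

lemma simple_sums:
  fixes \<pi> :: "nat \<times> nat \<Rightarrow> nat"
  assumes "\<And>\<alpha>. \<alpha> \<notin> simple_roots m \<Longrightarrow> \<pi> \<alpha> = 0"
  shows "(\<Sum>\<alpha>\<in>pos_roots m. if fst \<alpha> = k then \<pi> \<alpha> else 0) = \<pi> (k, Suc k)"
    and "(\<Sum>\<alpha>\<in>pos_roots m. if snd \<alpha> = Suc k then \<pi> \<alpha> else 0) = \<pi> (k, Suc k)"
proof -
  show "(\<Sum>\<alpha>\<in>pos_roots m. if fst \<alpha> = k then \<pi> \<alpha> else 0) = \<pi> (k, Suc k)"
    by (rule sum_simple_single) (use assms in \<open>auto simp: simple_roots_def\<close>)
  show "(\<Sum>\<alpha>\<in>pos_roots m. if snd \<alpha> = Suc k then \<pi> \<alpha> else 0) = \<pi> (k, Suc k)"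
    by (rule sum_simple_single) (use assms in \<open>auto simp: simple_roots_def\<close>)
qed

text \<open>For a partition into simple roots the balance at \<open>k + 1\<close> compares
  neighbouring multiplicities. Starting with 1 at the first simple root, they all equal 1;
  conversely the simple roots telescope.\<close>

lemma simple_part_unique:
  assumes "2 \<le> m"
  shows "\<pi> \<in> root_partitions m (gl_eps 1 - gl_eps m) \<and> (\<forall>\<alpha>. \<alpha> \<notin> simple_roots m \<longrightarrow> \<pi> \<alpha> = 0)
    \<longleftrightarrow> \<pi> = simple_part m"
proof
  assume \<pi>: "\<pi> \<in> root_partitions m (gl_eps 1 - gl_eps m) \<and> (\<forall>\<alpha>. \<alpha> \<notin> simple_roots m \<longrightarrow> \<pi> \<alpha> = 0)"
  have bal: "\<pi> (Suc k, Suc (Suc k)) + (if Suc k = m then 1 else 0) = \<pi> (k, Suc k) + (if Suc k = 1 then 1 else 0)" for k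
    using root_partition_balance[of \<pi> m "Suc k"] \<pi> assms simple_sums[of m \<pi>] by simp
  have one: "\<pi> (Suc k, Suc (Suc k)) = 1" if "Suc k < m" for k
    using that
  proof (induction k)
    case 0
    \<comment> \<open>The pair \<open>(0, 1)\<close> is not a root, so the balance at 1 starts the
      chain with multiplicity 1.\<close>
    have "(0, Suc 0) \<notin> simple_roots m" by (simp add: simple_roots_def)
    then have "\<pi> (0, Suc 0) = 0" using \<pi> by blast
    then show ?case using bal[of 0] 0 by simp
  next
    case (Suc k)
    then show ?case using bal[of "Suc k"] by simp
  qed
  show "\<pi> = simple_part m"
  proof
    fix \<alpha> 
    show "\<pi> \<alpha> = simple_part m \<alpha>"
    proof (cases "\<alpha> \<in> simple_roots m")
      case True
      then obtain k where "\<alpha> = (Suc k, Suc (Suc k))" "Suc k < m"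
        by (cases \<alpha>, cases "fst \<alpha>") (auto simp: simple_roots_def)
      then show ?thesis using one True by (simp add: simple_part_def)
    next
      case False
      then have "\<pi> \<alpha> = 0" using \<pi> by blast
      then show ?thesis using False by (simp add: simple_part_def)
    qed
  qed
next
  assume \<pi>: "\<pi> = simple_part m"
  have z: "\<pi> \<alpha> = 0" if "\<alpha> \<notin> simple_roots m" for \<alpha> using that by (simp add: \<pi> simple_part_def)
  have "\<pi> \<alpha> = 0" if "\<alpha> \<notin> pos_roots m" for \<alpha>
    using that by (intro z) (auto simp: simple_roots_def pos_roots_def)
  moreover have "(\<Sum>\<alpha>\<in>pos_roots m. of_nat (\<pi> \<alpha>) * root_wt \<alpha> k) = (gl_eps 1 - gl_eps m) k" if "k \<in> {1..m}" for k
  proof -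
    obtain l where l: "k = Suc l" using \<open>k \<in> {1..m}\<close> by (cases k) auto
    have "(\<Sum>\<alpha>\<in>pos_roots m. of_nat (\<pi> \<alpha>) * root_wt \<alpha> k) =
       (\<Sum>\<alpha>\<in>pos_roots m. of_nat (if fst \<alpha> = k then \<pi> \<alpha> else 0) - (of_nat (if snd \<alpha> = k then \<pi> \<alpha> else 0) :: complex))"
      by (intro sum.cong refl) (simp add: root_wt_def gl_eps_def)
    also have "\<dots> = of_nat (\<Sum>\<alpha>\<in>pos_roots m. if fst \<alpha> = k then \<pi> \<alpha> else 0)
        - of_nat (\<Sum>\<alpha>\<in>pos_roots m. if snd \<alpha> = k then \<pi> \<alpha> else 0)"
      by (simp only: sum_subtractf of_nat_sum)
    also have "\<dots> = of_nat (\<pi> (k, Suc k)) - of_nat (\<pi> (l, k))"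
      using simple_sums[of m \<pi> k] simple_sums[of m \<pi> l] z unfolding l by simp
    also have "\<dots> = (gl_eps 1 - gl_eps m) k"
      using that l assms by (auto simp: \<pi> simple_part_def simple_roots_def gl_eps_def)
    finally show ?thesis .
  qed
  ultimately show "\<pi> \<in> root_partitions m (gl_eps 1 - gl_eps m) \<and> (\<forall>\<alpha>. \<alpha> \<notin> simple_roots m \<longrightarrow> \<pi> \<alpha> = 0)"
    using z by (simp add: root_partitions_def)
qed

lemma h_poly_eval_1: "h_poly_eval m 1 \<mu> = 1"
  by (simp add: h_poly_eval_def)

lemma red_sum:
  assumes "finite A" "\<And>i. i \<in> A \<Longrightarrow> red m n (f i) (c i)"
  shows "red m n (sum f A) (sum c A)"
  using assms
  by (induction A rule: finite_induct) (auto intro: red_add red_ideal lie_ideal_closed)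

section \<open>The Shapovalov conditions on the highest weight vector\<close>

lemma rep_h_mat_vac:
  "app (rep \<mu> m (gl_emb m (h_mat \<eta>))) vac = app (scal (wt_form m \<mu> \<eta>)) vac"
proof
  fix n
  have sumn: "sum F A n = (\<Sum>k\<in>A. F k n)" for F :: "nat \<Rightarrow> (nat \<times> nat) pseries" and A
    by (induction A rule: infinite_finite_induct) auto
  have "app (rep \<mu> m (gl_emb m (h_mat \<eta>))) vac n
      = (\<Sum>i\<in>{1..m}. \<Sum>j\<in>{1..m}. h_mat \<eta> i j * app (verma \<mu> m i j) vac n)"
    unfolding rep_gl_emb app_sum sumn app_simps(5) app_scal ..
  also have "\<dots> = (\<Sum>i\<in>{1..m}. \<Sum>j\<in>{1..m}. if j = i then \<mu> i * \<eta> i * vac n else 0)"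
    using verma_diag_vac[where \<mu> = \<mu> and n = m] by (intro sum.cong refl) (auto simp: h_mat_def)
  finally show "app (rep \<mu> m (gl_emb m (h_mat \<eta>))) vac n = app (scal (wt_form m \<mu> \<eta>)) vac n"
    by (simp add: wt_form_def sum_distrib_right)
qed

text \<open>Both summands are lifted to the free algebra and applied to 1: the strictly upper
  triangular matrix units kill it, and the generator of the left ideal acts by
  \<open>wt_form m \<mu> \<eta> + c\<close>.\<close>

lemma rep_shapovalov_target:
  assumes p: "p \<in> carrier (tensor_alg m)"
    and mem: "U_class m p \<in> U_left_ideal m (U_emb m (h_mat \<eta>) \<oplus>\<^bsub>Ugl m\<^esub> U_scalar m c) <+>\<^bsub>Ugl m\<^esub> U_n_plus m"
    and zero: "wt_form m \<mu> \<eta> + c = 0"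
  shows "app (rep \<mu> m p) vac = 0"
proof -
  interpret ring "Ugl m" by (rule ring_Ugl)
  obtain y z where yz: "U_class m p = y \<oplus>\<^bsub>Ugl m\<^esub> z"
    "y \<in> U_left_ideal m (U_emb m (h_mat \<eta>) \<oplus>\<^bsub>Ugl m\<^esub> U_scalar m c)" "z \<in> U_n_plus m"
    using mem unfolding set_add_def' by blast
  let ?h = "gl_emb m (h_mat \<eta>) + cst c"
  have h: "?h \<in> carrier (tensor_alg m)" by (intro tensor_alg_closed gl_emb_closed)
  obtain X where X: "X \<in> carrier (Ugl m)" "y = X \<otimes>\<^bsub>Ugl m\<^esub> U_class m ?h"
    using yz(2) by (auto simp: U_left_ideal_def U_emb_def U_scalar_eq U_class_hom gl_emb_closed tensor_alg_closed)
  obtain x where x: "x \<in> carrier (tensor_alg m)" "X = U_class m x"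
    using carrier_Ugl_cases[OF X(1)] .
  have y: "y = U_class m (x * ?h)" unfolding X(2) x(2) using x(1) h by (simp add: U_class_hom)
  obtain u where u: "u \<in> pos_roots m \<rightarrow> carrier (Ugl m)"
    "z = (\<Oplus>\<^bsub>Ugl m\<^esub>\<alpha>\<in>pos_roots m. u \<alpha> \<otimes>\<^bsub>Ugl m\<^esub> U_unit m (fst \<alpha>) (snd \<alpha>))"
    using yz(3) by (auto simp: U_n_plus_def)
  have "\<forall>\<alpha>\<in>pos_roots m. \<exists>v. v \<in> carrier (tensor_alg m) \<and> u \<alpha> = U_class m v"
  proof
    fix \<alpha> assume "\<alpha> \<in> pos_roots m"
    then have "u \<alpha> \<in> carrier (Ugl m)" using u(1) by blast
    then obtain v where "v \<in> carrier (tensor_alg m)" "u \<alpha> = U_class m v" by (rule carrier_Ugl_cases)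
    then show "\<exists>v. v \<in> carrier (tensor_alg m) \<and> u \<alpha> = U_class m v" by blast
  qed
  then obtain v where v: "\<And>\<alpha>. \<alpha> \<in> pos_roots m \<Longrightarrow> v \<alpha> \<in> carrier (tensor_alg m)"
    "\<And>\<alpha>. \<alpha> \<in> pos_roots m \<Longrightarrow> u \<alpha> = U_class m (v \<alpha>)"
    by metis
  let ?z = "\<Sum>\<alpha>\<in>pos_roots m. v \<alpha> * gen (fst \<alpha>) (snd \<alpha>)"
  have g: "gen (fst \<alpha>) (snd \<alpha>) \<in> carrier (tensor_alg m)"
    "U_unit m (fst \<alpha>) (snd \<alpha>) = U_class m (gen (fst \<alpha>) (snd \<alpha>))" if "\<alpha> \<in> pos_roots m" for \<alpha>
    using that by (auto simp: pos_roots_def intro!: gen_closed U_unit_eq)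
  have zc: "?z \<in> carrier (tensor_alg m)" by (intro sum_closed tensor_alg_closed v g)
  have z: "z = U_class m ?z"
  proof -
    have "U_class m ?z = (\<Oplus>\<^bsub>Ugl m\<^esub>\<alpha>\<in>pos_roots m. U_class m (v \<alpha> * gen (fst \<alpha>) (snd \<alpha>)))"
      by (intro U_class_sum finite_pos_roots tensor_alg_closed v g)
    also have "\<dots> = z"
      unfolding u(2)
    proof (rule finsum_cong')
      show "(\<lambda>\<alpha>. u \<alpha> \<otimes>\<^bsub>Ugl m\<^esub> U_unit m (fst \<alpha>) (snd \<alpha>)) \<in> pos_roots m \<rightarrow> carrier (Ugl m)"
        using u(1) g U_class_hom(3) by (intro Pi_I m_closed) auto
      show "U_class m (v \<alpha> * gen (fst \<alpha>) (snd \<alpha>)) = u \<alpha> \<otimes>\<^bsub>Ugl m\<^esub> U_unit m (fst \<alpha>) (snd \<alpha>)"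
        if "\<alpha> \<in> pos_roots m" for \<alpha>
        using v[OF that] g[OF that] by (simp add: U_class_hom)
    qed simp
    finally show ?thesis by simp
  qed
  have xh: "x * ?h \<in> carrier (tensor_alg m)" using x(1) h by (rule tensor_alg_closed)
  have "U_class m p = U_class m (x * ?h + ?z)"
    unfolding yz(1) y z using xh zc by (simp add: U_class_hom)
  then have "rep \<mu> m p = rep \<mu> m (x * ?h + ?z)"
    by (intro rep_cong p tensor_alg_closed xh zc)
  moreover have "app (rep \<mu> m ?h) vac = 0"
  proof -
    have "app (rep \<mu> m ?h) vac = app (scal (wt_form m \<mu> \<eta> + c)) vac"
      unfolding rep_add rep_cst scal_hom app_simps rep_h_mat_vac ..
    then show ?thesis unfolding zero scal_hom by simp
  qed
  moreover have "app (rep \<mu> m ?z) vac = 0"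
    unfolding rep_sum app_sum
  proof (rule sum.neutral, rule ballI)
    fix \<alpha> assume "\<alpha> \<in> pos_roots m"
    then have "app (verma \<mu> m (fst \<alpha>) (snd \<alpha>)) vac = 0"
      by (intro verma_upper_vac) (auto simp: pos_roots_def)
    then show "app (rep \<mu> m (v \<alpha> * gen (fst \<alpha>) (snd \<alpha>))) vac = 0"
      unfolding rep_mult rep_gen app_simps by simp
  qed
  ultimately show ?thesis unfolding rep_add rep_mult[of \<mu> m x] by (simp only: app_simps app_zero add_0)
qed

theorem theorem4p5:
  fixes m :: nat and ord :: "(nat \<times> nat) list" and \<eta>' :: weight
    and \<theta> :: "gl_free set" and H :: "(nat \<times> nat \<Rightarrow> nat) \<Rightarrow> h_poly"
  assumes "2 \<le> m"
    and "set ord = pos_roots m" and "distinct ord"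
    and "\<eta>' = gl_eps 1 - gl_eps m"
    and "shapovalov m ord \<eta>' \<theta> H"
  shows "\<forall>\<mu> :: weight. wt_form m (\<mu> + gl_rho m) \<eta>' = 1 \<longrightarrow>
    shapovalov_eval m ord \<eta>' H \<mu> = ncdet (Ugl m) (m - 1) (D_matrix m \<mu>)"
proof (intro allI impI)
  fix \<mu> :: weight assume hyper: "wt_form m (\<mu> + gl_rho m) \<eta>' = 1"
  note m = assms(1) and ord = assms(2,3) and \<eta>' = assms(4)
  have m1: "1 \<le> m" using m by simp
  let ?RP = "root_partitions m \<eta>'"
  let ?w = "\<lambda>\<pi>. word (part_word ord \<pi>)"
  let ?E = "\<lambda>\<pi>. h_poly_eval m (H \<pi>) \<mu>"
  \<comment> \<open>\<open>\<Theta>\<close> lifts the Shapovalov element and \<open>X\<close> its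
    evaluation at \<open>\<mu>\<close>. Singularity is known for \<open>\<Theta>\<close>, the
    expansion is wanted for \<open>X\<close>, and both send 1 to \<open>f\<close>.\<close>
  define \<Theta> where "\<Theta> = (\<Sum>\<pi>\<in>?RP. ?w \<pi> * h_rep m (H \<pi>))"
  define X where "X = (\<Sum>\<pi>\<in>?RP. ?w \<pi> * cst (?E \<pi>))"
  define f where "f = app (rep \<mu> m X) vac"
  have fin: "finite ?RP" unfolding \<eta>' by (rule finite_root_partitions[OF m1])
  have path: "is_path_word m (part_word ord \<pi>)" if "\<pi> \<in> ?RP" for \<pi>
    using that unfolding \<eta>' by (rule is_path_word_part_word[OF _ ord m1])
  have wc: "?w \<pi> \<in> carrier (tensor_alg m)" if "\<pi> \<in> ?RP" for \<pi>
    using path[OF that] by (intro word_closed) (simp add: is_path_word_def)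
  have e: "e_neg m ord \<pi> = U_class m (?w \<pi>)" for \<pi>
    by (rule e_neg_eq) (simp add: ord)
  have \<Theta>c: "\<Theta> \<in> carrier (tensor_alg m)"
    unfolding \<Theta>_def by (intro sum_closed tensor_alg_closed(5) wc h_rep_closed)
  have Xc: "X \<in> carrier (tensor_alg m)"
    unfolding X_def by (intro sum_closed tensor_alg_closed(3,5) wc)
  interpret ring "Ugl m" by (rule ring_Ugl)
  have "U_class m \<Theta> = (\<Oplus>\<^bsub>Ugl m\<^esub>\<pi>\<in>?RP. U_class m (?w \<pi> * h_rep m (H \<pi>)))"
    unfolding \<Theta>_def by (intro U_class_sum fin tensor_alg_closed wc h_rep_closed)
  also have "\<dots> = (\<Oplus>\<^bsub>Ugl m\<^esub>\<pi>\<in>?RP. e_neg m ord \<pi> \<otimes>\<^bsub>Ugl m\<^esub> U_poly m (H \<pi>))"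
    by (rule finsum_cong') (use wc in \<open>auto simp: e U_poly_eq U_class_hom h_rep_closed\<close>)
  also have "\<dots> = \<theta>" using assms(5) unfolding shapovalov_def by (elim conjE) (rule sym)
  finally have \<theta>: "\<theta> = U_class m \<Theta>" by simp
  have "U_class m X = (\<Oplus>\<^bsub>Ugl m\<^esub>\<pi>\<in>?RP. U_class m (?w \<pi> * cst (?E \<pi>)))"
    unfolding X_def by (intro U_class_sum fin tensor_alg_closed wc)
  also have "\<dots> = shapovalov_eval m ord \<eta>' H \<mu>"
    unfolding shapovalov_eval_def
    by (rule finsum_cong') (use wc in \<open>auto simp: e U_scalar_eq U_class_hom tensor_alg_closed\<close>)
  finally have ev: "shapovalov_eval m ord \<eta>' H \<mu> = U_class m X" by simp
  have f\<Theta>: "app (rep \<mu> m \<Theta>) vac = f"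
    unfolding f_def \<Theta>_def X_def rep_sum app_sum rep_mult app_simps rep_h_rep_vac rep_cst ..
  have form: "wt_form m \<nu> \<eta>' = \<nu> 1 - \<nu> m" for \<nu>
    unfolding \<eta>' using m by (intro wt_form_eps_diff) auto
  have e_shap: "\<forall>\<alpha>\<in>pos_roots m. U_unit m (fst \<alpha>) (snd \<alpha>) \<otimes>\<^bsub>Ugl m\<^esub> \<theta> \<in>
        U_left_ideal m (U_emb m (h_mat \<eta>') \<oplus>\<^bsub>Ugl m\<^esub>
          U_scalar m (wt_eval m (gl_rho m) (h_mat \<eta>') - wt_form m \<eta>' \<eta>' / 2))
        <+>\<^bsub>Ugl m\<^esub> U_n_plus m"
    and H1: "\<forall>\<pi>\<in>?RP. (\<forall>\<alpha>. \<alpha> \<notin> simple_roots m \<longrightarrow> \<pi> \<alpha> = 0) \<longrightarrow> H \<pi> = 1"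
    using assms(5) unfolding shapovalov_def by blast+
  have sing: "app (verma \<mu> m a (Suc a)) f = 0" if "1 \<le> a" "a < m" for a
  proof -
    let ?c = "wt_eval m (gl_rho m) (h_mat \<eta>') - wt_form m \<eta>' \<eta>' / 2"
    have \<alpha>: "(a, Suc a) \<in> pos_roots m" using that by (simp add: pos_roots_def)
    have U: "U_unit m a (Suc a) \<otimes>\<^bsub>Ugl m\<^esub> \<theta> = U_class m (gen a (Suc a) * \<Theta>)"
      unfolding \<theta> using that \<Theta>c by (simp add: U_unit_eq U_class_hom gen_closed)
    have "U_unit m a (Suc a) \<otimes>\<^bsub>Ugl m\<^esub> \<theta> \<in>
        U_left_ideal m (U_emb m (h_mat \<eta>') \<oplus>\<^bsub>Ugl m\<^esub> U_scalar m ?c) <+>\<^bsub>Ugl m\<^esub> U_n_plus m"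
      using bspec[OF e_shap \<alpha>] by (simp only: fst_conv snd_conv)
    moreover have "gen a (Suc a) * \<Theta> \<in> carrier (tensor_alg m)"
      using that \<Theta>c by (intro tensor_alg_closed gen_closed) auto
    \<comment> \<open>The hyperplane condition gives 1 and half the squared length of
      \<open>\<eta>'\<close> is 1.\<close>
    moreover have "wt_form m \<mu> \<eta>' + ?c = 0"
    proof -
      have comm: "wt_form m \<eta>' (gl_rho m) = wt_form m (gl_rho m) \<eta>'"
        by (simp add: wt_form_def mult.commute)
      have two: "\<eta>' 1 - \<eta>' m = 2" using m by (simp add: \<eta>' gl_eps_def)
      show ?thesis
        using hyper unfolding wt_eval_h_mat comm form two by (simp add: algebra_simps)
    qed
    ultimately have "app (rep \<mu> m (gen a (Suc a) * \<Theta>)) vac = 0"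
      unfolding U by (intro rep_shapovalov_target)
    then show ?thesis unfolding rep_mult rep_gen app_simps f\<Theta> .
  qed
  \<comment> \<open>Only the partition into all simple roots reaches the full cut set, and its
    coefficient is normalised to 1; this starts the recursion for \<open>f\<close>.\<close>
  have "red m m X (\<Sum>\<pi>\<in>?RP. ?E \<pi> * (if set (part_word ord \<pi>) \<subseteq> simple_roots m then 1 else 0))"
    unfolding X_def cst_central[symmetric]
    by (intro red_sum fin red_cst red_word path m1 order_refl)
  also have "(\<Sum>\<pi>\<in>?RP. ?E \<pi> * (if set (part_word ord \<pi>) \<subseteq> simple_roots m then 1 else 0))
      = (\<Sum>\<pi>\<in>?RP. if \<pi> = simple_part m then 1 else 0)"
  proof (rule sum.cong[OF refl])
    fix \<pi> assume \<pi>: "\<pi> \<in> ?RP"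
    have set: "set (part_word ord \<pi>) = {\<alpha> \<in> pos_roots m. \<pi> \<alpha> \<noteq> 0}"
      unfolding ord(1)[symmetric] by (auto simp: part_word_def)
    have out: "\<pi> \<alpha> = 0" if "\<alpha> \<notin> pos_roots m" for \<alpha>
      using \<pi> that unfolding root_partitions_def by blast
    have "set (part_word ord \<pi>) \<subseteq> simple_roots m \<longleftrightarrow> (\<forall>\<alpha>. \<alpha> \<notin> simple_roots m \<longrightarrow> \<pi> \<alpha> = 0)"
      unfolding set using out by (metis (mono_tags, lifting) mem_Collect_eq subset_iff)
    also have "\<dots> \<longleftrightarrow> \<pi> = simple_part m"
      using simple_part_unique[OF m, of \<pi>] \<pi> unfolding \<eta>' by (simp only: simp_thms)
    finally have iff: "set (part_word ord \<pi>) \<subseteq> simple_roots m \<longleftrightarrow> \<pi> = simple_part m" .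
    have "?E \<pi> = 1" if "\<pi> = simple_part m"
    proof -
      have "\<forall>\<alpha>. \<alpha> \<notin> simple_roots m \<longrightarrow> \<pi> \<alpha> = 0" using that by (simp add: simple_part_def)
      then have "H \<pi> = 1" by (rule mp[OF bspec[OF H1 \<pi>]])
      then show ?thesis by (simp only: h_poly_eval_1)
    qed
    then show "?E \<pi> * (if set (part_word ord \<pi>) \<subseteq> simple_roots m then 1 else 0)
        = (if \<pi> = simple_part m then 1 else 0)"
      unfolding iff by (cases "\<pi> = simple_part m") simp_all
  qed
  also have "\<dots> = 1"
  proof -
    have "simple_part m \<in> ?RP" using simple_part_unique[OF m] unfolding \<eta>' by blast
    then show ?thesis using fin by simp
  qed
  finally have red: "red m m X 1" .
  have XI: "X - (\<Sum>T\<in>cuts m. cst (f (chi T)) * eprod T) \<in> lie_ideal m" and full: "f (chi {1..m}) = 1"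
    using red_expansion[OF red m, of \<mu>] unfolding f_def by blast+
  have inj: "inj_on (\<lambda>S. {1..m} - S) (Pow {2..<m})"
  proof (rule inj_onI)
    fix S S' assume "S \<in> Pow {2..<m}" "S' \<in> Pow {2..<m}" "{1..m} - S = {1..m} - S'"
    moreover from this have "S \<subseteq> {1..m}" "S' \<subseteq> {1..m}" by auto
    ultimately show "S = S'" by blast
  qed
  have "(\<Sum>T\<in>cuts m. cst (f (chi T)) * eprod T)
      = (\<Sum>S\<in>Pow {2..<m}. cst (f (chi ({1..m} - S))) * eprod ({1..m} - S))"
    unfolding cuts_eq[OF m] sum.reindex[OF inj] o_def ..
  also have "\<dots> = (\<Sum>S\<in>Pow {2..<m}. cst (\<Prod>b\<in>S. a_coeff m \<mu> (b - 1)) * eprod ({1..m} - S))"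
  proof (rule sum.cong[OF refl])
    fix S assume S: "S \<in> Pow {2..<m}"
    then have "f (chi ({1..m} - S)) = (\<Prod>b\<in>S. \<mu> 1 - \<mu> b + of_nat b - 2) * f (chi {1..m})"
      using m by (intro verma_singular_coeff sing) auto
    moreover have "(\<Prod>b\<in>S. \<mu> 1 - \<mu> b + of_nat b - 2) = (\<Prod>b\<in>S. a_coeff m \<mu> (b - 1))"
    proof (rule prod.cong[OF refl])
      fix b assume "b \<in> S"
      then have "2 \<le> b" "b < m" using S by auto
      then have "b - 1 < m" "b - 1 + 1 = b" by simp_all
      then show "\<mu> 1 - \<mu> b + of_nat b - 2 = a_coeff m \<mu> (b - 1)"
        using a_coeff_eq[of "b - 1" m \<mu>] by (simp only:)
    qed
    ultimately show "cst (f (chi ({1..m} - S))) * eprod ({1..m} - S)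
        = cst (\<Prod>b\<in>S. a_coeff m \<mu> (b - 1)) * eprod ({1..m} - S)"
      using full by simp
  qed
  also have "\<dots> = rdet (m - 1) (D_free m (a_coeff m \<mu>))"
    by (rule rdet_D_free[OF m, symmetric])
  finally have "X - rdet (m - 1) (D_free m (a_coeff m \<mu>)) \<in> lie_ideal m"
    using XI by simp
  then show "shapovalov_eval m ord \<eta>' H \<mu> = ncdet (Ugl m) (m - 1) (D_matrix m \<mu>)"
    unfolding ev ncdet_D_matrix(1)[OF m] U_class_eq_iff[OF Xc ncdet_D_matrix(2)[OF m]] .
qed

end
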